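(* Let $n\ge 2$. Let $f_{2n-1}:S^{2n-1}\to S^n$ be the $O(n)$-equivariant map $f_{2n-1}(x,y)=\exp_{e_0}\!\left(\pi\,\tau\!\left(\tfrac{y}{|y|}\right)x\right)$ (with value $-e_0$ when $y=0$), and let $f_{2n-1}^*O(n+1)=\{(z,Q)\in S^{2n-1}\times O(n+1): f_{2n-1}(z)=pr_n(Q)\}$ be the pullback of the principal $O(n)$-bundle $pr_n:O(n+1)\to S^n$. Then the quotient of $f_{2n-1}^*O(n+1)$ by the free $O(n)$-action $g\star(z,Q)=(gz,gQ)$ is diffeomorphic to the Kervaire manifold $\Sigma^{2n-1}$ of dimension $2n-1$.
   Context: $\tau:S^{n-1}\to O(n)$ is $\tau(x)v=2\langle x,v\rangle x-v$; it satisfies $\tau(gx)=g\tau(x)g^{-1}$ for $g\in O(n)$. The Kervaire manifold is $\Sigma^{2n-1}=D^n\times S^{n-1}\cup_{g_\tau^{-1}f_\tau}S^{n-1}\times D^n$, i.e. $(x,y)\in\partial(D^n\times S^{n-1})=S^{n-1}\times S^{n-1}$ is identified with $g_\tau^{-1}f_\tau(x,y)\in\partial(S^{n-1}\times D^n)$, where $f_\tau(x,y)=(x,\tau(x)y)$ and $g_\tau(x,y)=(\tau(y)x,y)$. $S^{2n-1}$ is the unit sphere of $\mathbb{R}^n\times\mathbb{R}^n$, with points written $(x,y)$, and $O(n)$ acts on it biaxially by $g(x,y)=(gx,gy)$. $S^n$ is the unit sphere of $\mathbb{R}^{n+1}=\mathbb{R}e_0\oplus\mathbb{R}^n$, with $\exp_{e_0}(\pi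 v)=\cos(\pi|v|)e_0+\sin(\pi|v|)\frac{v}{|v|}$ for $v\in\mathbb{R}^n=T_{e_0}S^n$. The group $O(n)$ is embedded in $O(n+1)$ as the block diagonal matrices $\mathrm{diag}(1,g)$. The map $pr_n:O(n+1)\to S^n$ is projection onto the first column; it is a principal $O(n)$-bundle for right multiplication by $O(n)$, and $pr_n(gQh)=g\,pr_n(Q)$ for $g,h\in O(n)$, where $O(n)$ acts on $S^n$ linearly fixing $e_0$. In the expression $gQ$, $g$ is regarded as an element of $O(n+1)$ via this embedding. *)

theory Defs
  imports "HOL-Analysis.Analysis"
begin

section \<open>Smooth maps\<close>

primrec Ck_on :: "nat \<Rightarrow> 'a::real_normed_vector set \<Rightarrow> ('a \<Rightarrow> 'b::real_normed_vector) \<Rightarrow> bool" where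
  "Ck_on 0 S f \<longleftrightarrow> continuous_on S f"
| "Ck_on (Suc k) S f \<longleftrightarrow>
     (\<forall>x\<in>S. f differentiable (at x)) \<and> (\<forall>v. Ck_on k S (\<lambda>x. frechet_derivative f (at x) v))"

text \<open>\<^const>\<open>Ck_on\<close> is meant for open sets. On an arbitrary subset of a Euclidean space, in
  particular on an embedded submanifold, smoothness means local extendability to a smooth map on an
  open set; for an open subset this is the usual notion.\<close>

definition smooth_on :: "'a::euclidean_space set \<Rightarrow> ('a \<Rightarrow> 'b::euclidean_space) \<Rightarrow> bool" where
  "smooth_on S f \<longleftrightarrow>
     (\<forall>x\<in>S. \<exists>W F. open W \<and> x \<in> W \<and> (\<forall>k. Ck_on k W F) \<and> (\<forall>y\<in>W \<inter> S. F y = f y))"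

definition smooth_diffeo_onto_open :: "'a::euclidean_space set \<Rightarrow> ('a \<Rightarrow> 'e::euclidean_space) \<Rightarrow> bool" where
  "smooth_diffeo_onto_open S f \<longleftrightarrow>
     smooth_on S f \<and> inj_on f S \<and> open (f ` S) \<and> smooth_on (f ` S) (inv_into S f)"

text \<open>Tangent vectors of an embedded submanifold \<open>S\<close> at \<open>p\<close> are the velocities of smooth curves in
  \<open>S\<close> through \<open>p\<close>; the clause on \<open>\<gamma>\<close> says that the differential of \<open>f\<close> at \<open>p\<close> is onto.\<close>

definition smooth_submersion_on :: "'a::euclidean_space set \<Rightarrow> ('a \<Rightarrow> 'e::euclidean_space) \<Rightarrow> bool" where
  "smooth_submersion_on S f \<longleftrightarrow>
     smooth_on S f \<and>
     (\<forall>p\<in>S. \<forall>v. \<exists>(\<gamma>::real \<Rightarrow> 'a) \<epsilon>. \<epsilon> > 0 \<and> smooth_on {-\<epsilon><..<\<epsilon>} \<gamma> \<and> \<gamma> ` {-\<epsilon><..<\<epsilon>} \<subseteq> S \<and>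
        \<gamma> 0 = p \<and> ((f \<circ> \<gamma>) has_vector_derivative v) (at 0))"


section \<open>Smooth manifolds modelled on a Euclidean space\<close>

text \<open>A chart is a pair of an open set and a coordinate map, whose values off the open set are
  irrelevant.\<close>

type_synonym ('a, 'e) chart = "'a set \<times> ('a \<Rightarrow> 'e)"

definition is_chart :: "'a topology \<Rightarrow> ('a, 'e::euclidean_space) chart \<Rightarrow> bool" where
  "is_chart X c \<longleftrightarrow> (case c of (U, \<phi>) \<Rightarrow>
     openin X U \<and> open (\<phi> ` U) \<and> homeomorphic_map (subtopology X U) (top_of_set (\<phi> ` U)) \<phi>)"

definition smooth_transition :: "('a, 'e::euclidean_space) chart \<Rightarrow> ('a, 'e) chart \<Rightarrow> bool" where
  "smooth_transition c d \<longleftrightarrow> (case c of (U, \<phi>) \<Rightarrow> case d of (V, \<psi>) \<Rightarrow>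
     smooth_on (\<phi> ` (U \<inter> V)) (\<psi> \<circ> inv_into U \<phi>))"

definition smooth_manifold :: "'a topology \<Rightarrow> ('a, 'e::euclidean_space) chart set \<Rightarrow> bool" where
  "smooth_manifold X A \<longleftrightarrow>
     Hausdorff_space X \<and> second_countable X \<and>
     (\<forall>c\<in>A. is_chart X c) \<and> (\<Union>c\<in>A. fst c) = topspace X \<and>
     (\<forall>c\<in>A. \<forall>d\<in>A. smooth_transition c d)"

definition smooth_map ::
  "'a topology \<Rightarrow> ('a, 'e::euclidean_space) chart set \<Rightarrow>
   'b topology \<Rightarrow> ('b, 'f::euclidean_space) chart set \<Rightarrow> ('a \<Rightarrow> 'b) \<Rightarrow> bool" where
  "smooth_map X A Y B h \<longleftrightarrow>
     continuous_map X Y h \<and>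
     (\<forall>(U, \<phi>)\<in>A. \<forall>(V, \<psi>)\<in>B. smooth_on (\<phi> ` {x\<in>U. h x \<in> V}) (\<psi> \<circ> h \<circ> inv_into U \<phi>))"

definition diffeomorphic ::
  "'a topology \<Rightarrow> ('a, 'e::euclidean_space) chart set \<Rightarrow>
   'b topology \<Rightarrow> ('b, 'f::euclidean_space) chart set \<Rightarrow> bool" where
  "diffeomorphic X A Y B \<longleftrightarrow>
     (\<exists>h. bij_betw h (topspace X) (topspace Y) \<and> smooth_map X A Y B h \<and>
          smooth_map Y B X A (inv_into (topspace X) h))"

definition quotient_topology :: "'a topology \<Rightarrow> ('a \<Rightarrow> 'b) \<Rightarrow> 'b topology" where
  "quotient_topology X p =
     topology (\<lambda>U. U \<subseteq> p ` topspace X \<and> openin X {x \<in> topspace X. p x \<in> U})"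

lemma openin_quotient_topology:
  "openin (quotient_topology X p) U \<longleftrightarrow>
     U \<subseteq> p ` topspace X \<and> openin X {x \<in> topspace X. p x \<in> U}"
proof -
  have 1: "{x \<in> topspace X. p x \<in> S \<inter> T} = {x \<in> topspace X. p x \<in> S} \<inter> {x \<in> topspace X. p x \<in> T}" for S T
    by auto
  have 2: "{x \<in> topspace X. p x \<in> \<Union>K} = (\<Union>S\<in>K. {x \<in> topspace X. p x \<in> S})" for K
    by auto
  have "istopology (\<lambda>U. U \<subseteq> p ` topspace X \<and> openin X {x \<in> topspace X. p x \<in> U})"
    unfolding istopology_def 1 2 by blast
  then show ?thesis
    by (simp add: quotient_topology_def)
qed

lemma topspace_quotient_topology: "topspace (quotient_topology X p) = p ` topspace X"
proof -
  have "{x \<in> topspace X. p x \<in> p ` topspace X} = topspace X"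
    by auto
  then have "openin (quotient_topology X p) (p ` topspace X)"
    by (simp add: openin_quotient_topology)
  then show ?thesis
    by (meson openin_quotient_topology openin_subset openin_topspace subset_antisym)
qed


section \<open>Quotients of submanifolds by actions of the orthogonal group\<close>

definition orthogonal_group :: "(real^'n^'n) set" where
  "orthogonal_group = {g. orthogonal_matrix g}"

definition free_action :: "(real^'n^'n \<Rightarrow> 'a \<Rightarrow> 'a) \<Rightarrow> 'a set \<Rightarrow> bool" where
  "free_action act M \<longleftrightarrow>
     (\<forall>g\<in>orthogonal_group. \<forall>p\<in>M. act g p \<in> M) \<and>
     (\<forall>p\<in>M. act (mat 1) p = p) \<and>
     (\<forall>g\<in>orthogonal_group. \<forall>h\<in>orthogonal_group. \<forall>p\<in>M. act (g ** h) p = act g (act h p)) \<and>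
     (\<forall>g\<in>orthogonal_group. \<forall>p\<in>M. act g p = p \<longrightarrow> g = mat 1)"

definition orbit :: "(real^'n^'n \<Rightarrow> 'a \<Rightarrow> 'a) \<Rightarrow> 'a \<Rightarrow> 'a set" where
  "orbit act p = (\<lambda>g. act g p) ` orthogonal_group"

definition orbit_space :: "(real^'n^'n \<Rightarrow> 'a \<Rightarrow> 'a) \<Rightarrow> 'a::euclidean_space set \<Rightarrow> 'a set topology" where
  "orbit_space act M = quotient_topology (top_of_set M) (orbit act)"

text \<open>The quotient smooth structure is the one for which the projection \<open>M \<rightarrow> M / O(n)\<close> is a
  smooth submersion. Its charts (all of them, so this is a maximal atlas) are the topological charts
  in which the projection is a smooth submersion.\<close>

definition orbit_charts ::
  "(real^'n^'n \<Rightarrow> 'a \<Rightarrow> 'a) \<Rightarrow> 'a::euclidean_space set \<Rightarrow> ('a set, 'e::euclidean_space) chart set" where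
  "orbit_charts act M =
     {(U, \<phi>). is_chart (orbit_space act M) (U, \<phi>) \<and>
              smooth_submersion_on {p\<in>M. orbit act p \<in> U} (\<phi> \<circ> orbit act)}"


section \<open>The Kervaire manifold\<close>

text \<open>\<open>n\<close> is \<open>CARD('n)\<close>.\<close>

abbreviation unit_sphere :: "'a::euclidean_space set" ("\<S>") where "\<S> \<equiv> sphere 0 1"
abbreviation unit_disc :: "'a::euclidean_space set" ("\<D>") where "\<D> \<equiv> cball 0 1"

definition tau :: "real^'n \<Rightarrow> real^'n \<Rightarrow> real^'n" where
  "tau x v = (2 * (x \<bullet> v)) *\<^sub>R x - v"

definition f_tau :: "(real^'n) \<times> (real^'n) \<Rightarrow> (real^'n) \<times> (real^'n)" where
  "f_tau = (\<lambda>(x, y). (x, tau x y))"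

definition g_tau :: "(real^'n) \<times> (real^'n) \<Rightarrow> (real^'n) \<times> (real^'n)" where
  "g_tau = (\<lambda>(x, y). (tau y x, y))"

definition kervaire_gluing :: "(real^'n) \<times> (real^'n) \<Rightarrow> (real^'n) \<times> (real^'n)" where
  "kervaire_gluing = inv_into (\<S> \<times> \<S>) g_tau \<circ> f_tau"

text \<open>The tag \<^term>\<open>False\<close> marks points of \<open>D\<^sup>n \<times> S\<^sup>n\<^sup>-\<^sup>1\<close>, the tag \<^term>\<open>True\<close>
  points of \<open>S\<^sup>n\<^sup>-\<^sup>1 \<times> D\<^sup>n\<close>.\<close>

definition kervaire_pieces :: "(bool \<times> (real^'n) \<times> (real^'n)) topology" where
  "kervaire_pieces = sum_topology (\<lambda>i. top_of_set (if i then \<S> \<times> \<D> else \<D> \<times> \<S>)) UNIV"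

definition kervaire_identified ::
  "bool \<times> (real^'n) \<times> (real^'n) \<Rightarrow> bool \<times> (real^'n) \<times> (real^'n) \<Rightarrow> bool" where
  "kervaire_identified a b \<longleftrightarrow> (\<exists>p \<in> \<S> \<times> \<S>. a = (False, p) \<and> b = (True, kervaire_gluing p))"

definition kervaire_class :: "bool \<times> (real^'n) \<times> (real^'n) \<Rightarrow> (bool \<times> (real^'n) \<times> (real^'n)) set" where
  "kervaire_class a = {b. equivclp kervaire_identified a b}"

definition kervaire_space :: "(bool \<times> (real^'n) \<times> (real^'n)) set topology" where
  "kervaire_space = quotient_topology kervaire_pieces kervaire_class"

text \<open>Smooth structure of the glued manifold: it is given by the interiors of the two pieces and by
  the bicollar of the common boundary obtained from the radial collars
  \<open>(t, x, y) \<mapsto> ((1 + t) x, y)\<close>, \<open>-1 < t \<le> 0\<close>, of \<open>\<partial>(D\<^sup>n \<times> S\<^sup>n\<^sup>-\<^sup>1)\<close> and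
  \<open>(t, x, y) \<mapsto> (x, (1 - t) y)\<close>, \<open>0 \<le> t < 1\<close>, of \<open>\<partial>(S\<^sup>n\<^sup>-\<^sup>1 \<times> D\<^sup>n)\<close>. All three are required to be
  diffeomorphisms onto open submanifolds.\<close>

definition kervaire_bicollar :: "real \<times> (real^'n) \<times> (real^'n) \<Rightarrow> (bool \<times> (real^'n) \<times> (real^'n)) set" where
  "kervaire_bicollar = (\<lambda>(t, x, y).
     if t \<le> 0 then kervaire_class (False, ((1 + t) *\<^sub>R x, y))
     else (case kervaire_gluing (x, y) of (x', y') \<Rightarrow> kervaire_class (True, (x', (1 - t) *\<^sub>R y'))))"

definition kervaire_charts ::
  "((bool \<times> (real^'n) \<times> (real^'n)) set, 'e::euclidean_space) chart set" where
  "kervaire_charts =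
     {(U, \<phi>). is_chart kervaire_space (U, \<phi>) \<and>
        smooth_diffeo_onto_open {p \<in> ball 0 1 \<times> \<S>. kervaire_class (False, p) \<in> U}
          (\<lambda>p. \<phi> (kervaire_class (False, p))) \<and>
        smooth_diffeo_onto_open {p \<in> \<S> \<times> ball 0 1. kervaire_class (True, p) \<in> U}
          (\<lambda>p. \<phi> (kervaire_class (True, p))) \<and>
        smooth_diffeo_onto_open {q \<in> {-1<..<1} \<times> \<S> \<times> \<S>. kervaire_bicollar q \<in> U}
          (\<lambda>q. \<phi> (kervaire_bicollar q))}"


section \<open>The pullback bundle\<close>

text \<open>\<open>\<real>\<^sup>n\<^sup>+\<^sup>1 = \<real> e\<^sub>0 \<oplus> \<real>\<^sup>n\<close> is indexed by \<^typ>\<open>'n option\<close>, the coordinate \<^term>\<open>None\<close> being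
  that of \<open>e\<^sub>0\<close>; it also indexes the first row and the first column of \<open>(n+1) \<times> (n+1)\<close> matrices.\<close>

definition e0 :: "real^('n::finite option)" where
  "e0 = axis None 1"

definition incl :: "real^'n \<Rightarrow> real^('n::finite option)" where
  "incl v = (\<chi> i. case i of None \<Rightarrow> 0 | Some j \<Rightarrow> v $ j)"

text \<open>\<^term>\<open>sgn w\<close> is \<open>w / |w|\<close>, and \<open>0\<close> for \<open>w = 0\<close>.\<close>

definition exp_e0 :: "real^'n \<Rightarrow> real^('n::finite option)" where
  "exp_e0 w = cos (norm w) *\<^sub>R e0 + sin (norm w) *\<^sub>R incl (sgn w)"

definition f_map :: "(real^'n) \<times> (real^'n) \<Rightarrow> real^('n::finite option)" where
  "f_map = (\<lambda>(x, y). if y = 0 then - e0 else exp_e0 (pi *\<^sub>R tau (sgn y) x))"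

type_synonym 'n pullback_ambient = "((real^'n) \<times> (real^'n)) \<times> (real^('n option)^('n option))"

definition block_diag :: "real^'n^'n \<Rightarrow> real^('n option)^('n::finite option)" where
  "block_diag g = (\<chi> i j. case (i, j) of (None, None) \<Rightarrow> 1 | (Some k, Some l) \<Rightarrow> g $ k $ l | _ \<Rightarrow> 0)"

definition pullback_bundle :: "('n::finite) pullback_ambient set" where
  "pullback_bundle = {(z, Q). z \<in> \<S> \<and> Q \<in> orthogonal_group \<and> f_map z = column None Q}"

definition star_action ::
  "real^'n^'n \<Rightarrow> ('n::finite) pullback_ambient \<Rightarrow> 'n pullback_ambient" where
  "star_action g = (\<lambda>((x, y), Q). ((g *v x, g *v y), block_diag g ** Q))"

end

theory Submission
  imports Defs
begin

text \<open>The vectors \<open>Q\<^sup>T e\<^sub>0\<close>, \<open>Q\<^sup>T x\<close>, \<open>Q\<^sup>T y\<close> form a complete set of invariants of the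
  \<open>\<star>\<close>-action, so the quotient is a compact submanifold of \<open>(\<real>\<^sup>n\<^sup>+\<^sup>1)\<^sup>3\<close>. The two reflection sections of
  \<open>O(n+1) \<rightarrow> S\<^sup>n\<close>, defined off \<open>- e\<^sub>0\<close> and off \<open>e\<^sub>0\<close>, yield slices
  \<open>z \<mapsto> (z, T (f z))\<close> over \<open>{y \<noteq> 0}\<close> and \<open>{x \<noteq> 0}\<close>. At a point \<open>a = C e\<^sub>0 + S x\<close> of \<open>S\<^sup>n\<close> the two
  sections differ by \<open>\<tau>(x)\<close>; in the polar coordinates \<open>(sin (\<pi> r / 4) \<tau>(y) x, cos (\<pi> r / 4) y)\<close> of \<open>S\<^sup>2\<^sup>n\<^sup>-\<^sup>1\<close>
  the slices are therefore glued by \<open>(x, y) \<mapsto> (\<tau>(x) \<tau>(y) x, \<tau>(x) y)\<close>, which is \<open>g\<^sub>\<tau>\<^sup>-\<^sup>1 f\<^sub>\<tau>\<close>. The choice of the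
  angle \<open>\<pi> r / 4\<close> makes the radial collars of the two pieces fit together smoothly.\<close>

section \<open>Calculus of smooth maps\<close>

text \<open>Both smooth structures are prescribed as maximal sets of charts on abstract quotients,
  one by a submersion condition, the other by three parametrisations. Each atlas is shown to equal
  the one carried over from the set of invariants by a homeomorphism; the diffeomorphism then reads
  as the identity of that set. The homeomorphisms come from compactness. The analytic obstacle is
  the apparent singularity of norms and unit vectors at x = 0 and at y = 0. Even functions of a norm
  are power series in its square, hence smooth; near y = 0 this is combined with sin(pi |x|) =
  sin(pi - pi |x|) and |y|^2 = 1 - |x|^2. The twist tau(y) x in the first polar coordinates cancels
  the tau inside f, so that f sees only the direction x and the radius. The angle pi r / 4 is chosen
  because r = 1 + t on one collar and r = 1 - t on the other give complementary angles: sine and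
  cosine are exchanged together with the two factors.\<close>

lemma Ck_on_cong:
  assumes "open S" "\<And>x. x \<in> S \<Longrightarrow> f x = g x"
  shows "Ck_on k S f \<longleftrightarrow> Ck_on k S g"
  using assms(2)
proof (induction k arbitrary: f g)
  case 0
  then show ?case by (auto intro: continuous_on_cong)
next
  case (Suc k)
  have d: "f differentiable (at x) \<longleftrightarrow> g differentiable (at x)" if "x \<in> S" for x
    using that Suc.prems \<open>open S\<close>
    by (metis (no_types, lifting) differentiable_def has_derivative_transform_within_open)
  have e: "frechet_derivative f (at x) = frechet_derivative g (at x)"
    if "x \<in> S" "f differentiable (at x)" for x
    using frechet_derivative_transform_within_open[OF that(2) \<open>open S\<close> that(1)] Suc.prems by blast
  show ?case
  proof (cases "\<forall>x\<in>S. f differentiable (at x)")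
    case True
    have "Ck_on k S (\<lambda>x. frechet_derivative f (at x) v) = Ck_on k S (\<lambda>x. frechet_derivative g (at x) v)" for v
      by (rule Suc.IH) (use e True in auto)
    then show ?thesis using True d by auto
  next
    case False
    then show ?thesis using d by auto
  qed
qed

text \<open>An explicit derivative may stand in for the chosen \<open>frechet_derivative\<close>.
  The inductions on k below go through because such derivatives are expressions to which the closure
  rules apply again.\<close>

lemma Ck_on_SucI:
  assumes "open S" "\<And>x. x \<in> S \<Longrightarrow> (f has_derivative f' x) (at x)"
    and "\<And>v. Ck_on k S (\<lambda>x. f' x v)"
  shows "Ck_on (Suc k) S f"
proof -
  have "Ck_on k S (\<lambda>x. frechet_derivative f (at x) v)" for v
  proof -
    have "Ck_on k S (\<lambda>x. frechet_derivative f (at x) v) = Ck_on k S (\<lambda>x. f' x v)"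
      by (rule Ck_on_cong[OF assms(1)]) (use frechet_derivative_at[OF assms(2)] in metis)
    then show ?thesis using assms(3) by simp
  qed
  then show ?thesis
    using assms(2) by (auto simp: differentiable_def)
qed

lemma Ck_on_SucD: "Ck_on (Suc k) S f \<Longrightarrow> Ck_on k S f"
proof (induction k arbitrary: f)
  case 0
  then show ?case
    by (auto intro!: continuous_at_imp_continuous_on differentiable_imp_continuous_within)
next
  case (Suc k)
  show ?case
    using Suc.prems Suc.IH by (metis Ck_on.simps(2))
qed

lemma Ck_on_continuous: "Ck_on k S f \<Longrightarrow> continuous_on S f"
  by (induction k arbitrary: f) (auto dest!: Ck_on_SucD simp del: Ck_on.simps(2))

lemma Ck_on_subset: "Ck_on k S f \<Longrightarrow> T \<subseteq> S \<Longrightarrow> Ck_on k T f"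
  by (induction k arbitrary: f) (auto intro: continuous_on_subset)

lemma Ck_on_has_derivative:
  "Ck_on (Suc k) S f \<Longrightarrow> x \<in> S \<Longrightarrow> (f has_derivative frechet_derivative f (at x)) (at x)"
  using frechet_derivative_works by auto

lemma Ck_on_local:
  assumes "\<And>x. x \<in> S \<Longrightarrow> \<exists>W. open W \<and> x \<in> W \<and> Ck_on k W f"
  shows "Ck_on k S f"
  using assms
proof (induction k arbitrary: f)
  case 0
  show ?case
    unfolding Ck_on.simps
  proof (rule continuous_at_imp_continuous_on, rule ballI)
    fix x assume "x \<in> S"
    then obtain W where W: "open W" "x \<in> W" "continuous_on W f"
      using 0 by auto
    then show "isCont f x" using continuous_on_eq_continuous_at by blast
  qed
next
  case (Suc k)
  have "f differentiable (at x)" if "x \<in> S" for x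
    using Suc.prems[OF that] by auto
  moreover have "Ck_on k S (\<lambda>x. frechet_derivative f (at x) v)" for v
    by (rule Suc.IH) (use Suc.prems in fastforce)
  ultimately show ?case by auto
qed

lemma Ck_on_const: "Ck_on k S (\<lambda>x. c)"
  by (induction k arbitrary: c) auto

lemma Ck_on_bounded_linear:
  assumes "bounded_linear f" "open S"
  shows "Ck_on k S f"
proof (cases k)
  case 0
  then show ?thesis using assms by (auto intro: linear_continuous_on)
next
  case (Suc m)
  show ?thesis unfolding Suc
    by (rule Ck_on_SucI[OF assms(2) bounded_linear_imp_has_derivative[OF assms(1)] Ck_on_const])
qed

lemma Ck_on_bounded_linear_comp:
  assumes "bounded_linear L" "open S" "Ck_on k S f"
  shows "Ck_on k S (\<lambda>x. L (f x))"
  using assms(3)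
proof (induction k arbitrary: f)
  case 0
  then show ?case using bounded_linear.continuous_on[OF assms(1)] by auto
next
  case (Suc k)
  show ?case
  proof (rule Ck_on_SucI[OF assms(2)])
    fix x assume "x \<in> S"
    then show "((\<lambda>x. L (f x)) has_derivative (\<lambda>v. L (frechet_derivative f (at x) v))) (at x)"
      using bounded_linear.has_derivative[OF assms(1)] Ck_on_has_derivative[OF Suc.prems] by blast
  qed (use Suc in auto)
qed

lemma Ck_on_add:
  assumes "open S" "Ck_on k S f" "Ck_on k S g"
  shows "Ck_on k S (\<lambda>x. f x + g x)"
  using assms(2,3)
proof (induction k arbitrary: f g)
  case 0
  then show ?case by (auto intro: continuous_on_add)
next
  case (Suc k)
  show ?case
  proof (rule Ck_on_SucI[OF assms(1)])
    fix x assume "x \<in> S"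
    then show "((\<lambda>x. f x + g x) has_derivative
      (\<lambda>v. frechet_derivative f (at x) v + frechet_derivative g (at x) v)) (at x)"
      using Ck_on_has_derivative[OF Suc.prems(1)] Ck_on_has_derivative[OF Suc.prems(2)]
      by (intro has_derivative_add) auto
  qed (use Suc in auto)
qed

lemma Ck_on_bilinear:
  assumes "bounded_bilinear p" "open S" "Ck_on k S f" "Ck_on k S g"
  shows "Ck_on k S (\<lambda>x. p (f x) (g x))"
  using assms(3,4)
proof (induction k arbitrary: f g)
  case 0
  then show ?case using bounded_bilinear.continuous_on[OF assms(1)] by auto
next
  case (Suc k)
  show ?case
  proof (rule Ck_on_SucI[OF assms(2)])
    fix x assume "x \<in> S"
    then show "((\<lambda>x. p (f x) (g x)) has_derivative
      (\<lambda>v. p (f x) (frechet_derivative g (at x) v) + p (frechet_derivative f (at x) v) (g x))) (at x)"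
      using Ck_on_has_derivative[OF Suc.prems(1)] Ck_on_has_derivative[OF Suc.prems(2)]
      by (intro bounded_bilinear.FDERIV[OF assms(1)]) auto
  next
    fix v
    show "Ck_on k S (\<lambda>x. p (f x) (frechet_derivative g (at x) v) + p (frechet_derivative f (at x) v) (g x))"
      using Suc.prems Suc.prems[THEN Ck_on_SucD]
      by (intro Ck_on_add[OF assms(2)]; intro Suc.IH) auto
  qed
qed

lemma Ck_on_sum:
  assumes "open S" "finite I" "\<And>i. i \<in> I \<Longrightarrow> Ck_on k S (f i)"
  shows "Ck_on k S (\<lambda>x. \<Sum>i\<in>I. f i x)"
  using assms(2,3) by (induction rule: finite_induct) (auto intro: Ck_on_const Ck_on_add assms(1))

lemma Ck_on_prod:
  fixes f :: "'i \<Rightarrow> 'a::real_normed_vector \<Rightarrow> real"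
  assumes "open S" "finite I" "\<And>i. i \<in> I \<Longrightarrow> Ck_on k S (f i)"
  shows "Ck_on k S (\<lambda>x. \<Prod>i\<in>I. f i x)"
  using assms(2,3)
  by (induction rule: finite_induct)
    (auto intro: Ck_on_const Ck_on_bilinear[OF bounded_bilinear_mult] assms(1))

lemma Ck_on_compose:
  fixes f :: "'a::real_normed_vector \<Rightarrow> 'b::euclidean_space" and g :: "'b \<Rightarrow> 'c::real_normed_vector"
  assumes "open S" "open T" "f ` S \<subseteq> T" "Ck_on k S f" "Ck_on k T g"
  shows "Ck_on k S (\<lambda>x. g (f x))"
  using assms(4,5)
proof (induction k arbitrary: g)
  case 0
  then show ?case using assms(3) continuous_on_compose2 by auto
next
  case (Suc k)
  let ?F = "\<lambda>x. frechet_derivative f (at x)" and ?G = "\<lambda>y. frechet_derivative g (at y)"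
  show ?case
  proof (rule Ck_on_SucI[OF assms(1)])
    fix x assume "x \<in> S"
    then show "((\<lambda>x. g (f x)) has_derivative (\<lambda>v. ?G (f x) (?F x v))) (at x)"
      using diff_chain_at[OF Ck_on_has_derivative[OF Suc.prems(1)] Ck_on_has_derivative[OF Suc.prems(2)]]
        assms(3) by (auto simp: o_def)
  next
    fix v
    \<comment> \<open>The direction \<open>?F x v\<close> moves with x, whereas the induction
      hypothesis treats a fixed direction. Expanding along the basis separates the two dependences
      into products of C^k functions.\<close>
    have "?G (f x) (?F x v) = (\<Sum>b\<in>Basis. (?F x v \<bullet> b) *\<^sub>R ?G (f x) b)" if "x \<in> S" for x
    proof -
      have lin: "linear (?G (f x))"
        using Suc.prems(2) assms(3) that by (auto intro!: linear_frechet_derivative)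
      have "?G (f x) (?F x v) = ?G (f x) (\<Sum>b\<in>Basis. (?F x v \<bullet> b) *\<^sub>R b)"
        by (simp add: euclidean_representation)
      also have "\<dots> = (\<Sum>b\<in>Basis. (?F x v \<bullet> b) *\<^sub>R ?G (f x) b)"
        by (simp add: linear_sum[OF lin] linear_scale[OF lin])
      finally show ?thesis .
    qed
    moreover have "Ck_on k S (\<lambda>x. ?G (f x) b)" for b
      by (rule Suc.IH[OF Ck_on_SucD[OF Suc.prems(1)]]) (use Suc.prems in auto)
    then have "Ck_on k S (\<lambda>x. \<Sum>b\<in>Basis. (?F x v \<bullet> b) *\<^sub>R ?G (f x) b)"
      using Suc.prems
      by (intro Ck_on_sum assms(1) Ck_on_bilinear[OF bounded_bilinear_scaleR] finite_Basis
          Ck_on_bounded_linear_comp[OF bounded_linear_inner_left]) auto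
    ultimately show "Ck_on k S (\<lambda>x. ?G (f x) (?F x v))"
      using Ck_on_cong[OF assms(1)] by (metis (no_types, lifting))
  qed
qed

lemma Ck_on_real_SucI:
  fixes f :: "real \<Rightarrow> real"
  assumes "open S" "\<And>x. x \<in> S \<Longrightarrow> (f has_real_derivative f' x) (at x)" "Ck_on k S f'"
  shows "Ck_on (Suc k) S f"
proof (rule Ck_on_SucI[OF assms(1)])
  show "(f has_derivative (\<lambda>v. f' x * v)) (at x)" if "x \<in> S" for x
    using assms(2)[OF that] by (simp add: has_field_derivative_def)
  show "Ck_on k S (\<lambda>x. f' x * v)" for v
    by (intro Ck_on_bilinear[OF bounded_bilinear_mult] assms Ck_on_const)
qed

text \<open>The derivative is a polynomial in the function itself, so the induction on k closes. The
  square root is treated in the same way, with 1 / (2 sqrt x) as derivative.\<close>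

lemma Ck_on_inverse:
  assumes "open S" "0 \<notin> S"
  shows "Ck_on k S (inverse :: real \<Rightarrow> real)"
proof (induction k)
  case 0
  show ?case using assms by (auto intro!: continuous_intros)
next
  case (Suc k)
  show ?case
  proof (rule Ck_on_real_SucI[OF assms(1)])
    show "(inverse has_real_derivative (- 1) * (inverse x * inverse x)) (at x)" if "x \<in> S" for x :: real
      using that assms DERIV_inverse[of x] by (auto simp: power2_eq_square)
    show "Ck_on k S (\<lambda>x. (- 1) * (inverse x * inverse x) :: real)"
      by (intro Ck_on_bilinear[OF bounded_bilinear_mult] assms Ck_on_const Suc)
  qed
qed

lemma Ck_on_inverse_comp:
  fixes f :: "'a::real_normed_vector \<Rightarrow> real"
  assumes "open S" "\<And>x. x \<in> S \<Longrightarrow> f x \<noteq> 0" "Ck_on k S f"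
  shows "Ck_on k S (\<lambda>x. inverse (f x))"
  by (rule Ck_on_compose[OF assms(1) _ _ assms(3) Ck_on_inverse[of "- {0}"]]) (use assms in auto)

lemma Ck_on_sqrt: "Ck_on k {0<..} sqrt"
proof (induction k)
  case 0
  show ?case by (auto intro!: continuous_intros)
next
  case (Suc k)
  show ?case
  proof (rule Ck_on_real_SucI)
    show "(sqrt has_real_derivative inverse (sqrt x) * (1/2)) (at x)" if "x \<in> {0<..}" for x
      using DERIV_real_sqrt[of x] that by simp
    show "Ck_on k {0<..} (\<lambda>x. inverse (sqrt x) * (1/2))"
      by (intro Ck_on_bilinear[OF bounded_bilinear_mult] Ck_on_const Ck_on_inverse_comp Suc) auto
  qed auto
qed

lemma Ck_on_arctan: "Ck_on k UNIV arctan"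
proof (cases k)
  case 0
  then show ?thesis by (auto intro!: continuous_intros)
next
  case (Suc m)
  show ?thesis unfolding Suc
  proof (rule Ck_on_real_SucI)
    show "(arctan has_real_derivative inverse (1 + x * x)) (at x)" for x
      using DERIV_arctan[of x] by (simp add: power2_eq_square)
    have "1 + x * x \<noteq> 0" for x :: real
      by (smt (verit) zero_le_square)
    then show "Ck_on m UNIV (\<lambda>x::real. inverse (1 + x * x))"
      by (intro Ck_on_inverse_comp Ck_on_add Ck_on_const Ck_on_bilinear[OF bounded_bilinear_mult]
          Ck_on_bounded_linear[OF bounded_linear_ident]) auto
  qed auto
qed

text \<open>Termwise differentiation keeps the interval of convergence, so the induction runs over
  all coefficient sequences at once.\<close>

lemma Ck_on_power_series:
  fixes c :: "nat \<Rightarrow> real"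
  assumes "\<And>x. \<bar>x\<bar> < K \<Longrightarrow> summable (\<lambda>n. c n * x ^ n)"
  shows "Ck_on k {-K<..<K} (\<lambda>x. \<Sum>n. c n * x ^ n)"
  using assms
proof (induction k arbitrary: c)
  case 0
  have "((\<lambda>z. \<Sum>n. c n * z^n) has_field_derivative (\<Sum>n. diffs c n * x^n)) (at x)" if "\<bar>x\<bar> < K" for x
    using termdiffs_strong'[of K c x] that 0 by auto
  then show ?case
    by (auto intro!: continuous_at_imp_continuous_on intro: DERIV_isCont simp: abs_less_iff) (meson DERIV_isCont minus_less_iff)
next
  case (Suc k)
  show ?case
  proof (rule Ck_on_real_SucI)
    show "((\<lambda>z. \<Sum>n. c n * z^n) has_real_derivative (\<Sum>n. diffs c n * x^n)) (at x)"
      if "x \<in> {-K<..<K}" for x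
      using termdiffs_strong'[of K c x] that Suc.prems by auto
    show "Ck_on k {-K<..<K} (\<lambda>x. \<Sum>n. diffs c n * x ^ n)"
    proof (rule Suc.IH)
      show "summable (\<lambda>n. diffs c n * x ^ n)" if "\<bar>x\<bar> < K" for x
        using termdiff_converges[of x K c] that Suc.prems by auto
    qed
  qed auto
qed

subsection \<open>Inverses of smooth maps\<close>

lemma Ck_on_vec_lambda:
  assumes "open S" "\<And>i. Ck_on k S (f i)"
  shows "Ck_on k S (\<lambda>x. (\<chi> i. f i x) :: real^'n::finite)"
proof -
  have "(\<lambda>x. (\<chi> i. f i x) :: real^'n) = (\<lambda>x. \<Sum>i\<in>UNIV. f i x *\<^sub>R axis i 1)"
    by (auto simp: vec_eq_iff fun_eq_iff axis_def if_distrib cong: if_cong)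
  then show ?thesis
    by (auto intro!: Ck_on_sum Ck_on_bilinear[OF bounded_bilinear_scaleR] Ck_on_const assms)
qed

lemma Ck_on_det:
  assumes "open S" "\<And>i j. Ck_on k S (\<lambda>x. A x $ i $ j)"
  shows "Ck_on k S (\<lambda>x. det (A x :: real^'n::finite^'n))"
  unfolding det_def
  by (auto intro!: Ck_on_sum Ck_on_bilinear[OF bounded_bilinear_mult] Ck_on_const Ck_on_prod assms
      simp: finite_permutations)

text \<open>A continuous right inverse G of F is differentiable because the differential of F is
  onto, hence invertible between spaces of equal dimension. Its derivative is a rational expression
  in the entries of DF along G, so each degree of smoothness of G yields the next.\<close>

lemma Ck_on_inverse_map:
  fixes F :: "real^'m::finite \<Rightarrow> real^'m"
  assumes "open S" "open V" and cont: "continuous_on V G" and GV: "G ` V \<subseteq> S"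
    and FG: "\<And>y. y \<in> V \<Longrightarrow> F (G y) = y" and F: "\<And>k. Ck_on k S F"
    and surj: "\<And>x. x \<in> S \<Longrightarrow> surj (frechet_derivative F (at x))"
  shows "Ck_on k V G"
proof (induction k)
  case 0
  show ?case using cont by simp
next
  case (Suc k)
  define A where "A y = matrix (frechet_derivative F (at (G y)))" for y
  \<comment> \<open>The inverse matrix by Cramer's rule: every coordinate is a quotient of
    determinants, which makes its regularity visible.\<close>
  define G' where "G' y v = (\<chi> l. det (\<chi> i j. if j = l then v $ i else A y $ i $ j) / det (A y))"
    for y :: "real^'m" and v :: "real^'m"
  have dF: "(F has_derivative (*v) (A y)) (at (G y))" if "y \<in> V" for y
  proof -
    have "(F has_derivative frechet_derivative F (at (G y))) (at (G y))"
      using Ck_on_has_derivative[OF F] GV that by blast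
    moreover have "linear (frechet_derivative F (at (G y)))"
      using calculation has_derivative_linear by blast
    ultimately show ?thesis by (simp add: A_def matrix_works ext)
  qed
  have detA: "det (A y) \<noteq> 0" if "y \<in> V" for y
  proof -
    have "(*v) (A y) = frechet_derivative F (at (G y))"
      using frechet_derivative_at[OF dF[OF that]] .
    then have "surj ((*v) (A y))" using surj GV that by auto
    then show ?thesis
      using matrix_right_invertible_surjective matrix_left_right_inverse invertible_det_nz invertible_def by metis
  qed
  have dG: "(G has_derivative G' y) (at y)" if "y \<in> V" for y
  proof (rule has_derivative_inverse_basic[OF dF[OF that] _ _ _ \<open>open V\<close> that FG])
    obtain A' where A': "A y ** A' = mat 1" "A' ** A y = mat 1"
      using detA[OF \<open>y \<in> V\<close>] invertible_det_nz invertible_def by metis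
    have eq: "G' y = (*v) A'"
    proof
      fix v
      have "A y *v (A' *v v) = v"
        by (simp add: matrix_vector_mul_assoc A')
      then show "G' y v = A' *v v"
        unfolding G'_def using cramer[OF detA[OF that], of _ v] by auto
    qed
    show "bounded_linear (G' y)" unfolding eq by (rule matrix_vector_mul_bounded_linear)
    show "G' y \<circ> (*v) (A y) = id"
      unfolding eq by (auto simp: fun_eq_iff matrix_vector_mul_assoc A')
    show "isCont G y" using cont that \<open>open V\<close> continuous_on_eq_continuous_at by blast
  qed
  show ?case
  proof (rule Ck_on_SucI[OF \<open>open V\<close> dG])
    fix v
    have A: "Ck_on k V (\<lambda>y. A y $ i $ j)" for i j
    proof -
      have "Ck_on k S (\<lambda>x. frechet_derivative F (at x) (axis j 1))"
        using F[of "Suc k"] by simp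
      then have "Ck_on k V (\<lambda>y. frechet_derivative F (at (G y)) (axis j 1))"
        by (intro Ck_on_compose[OF \<open>open V\<close> \<open>open S\<close> GV Suc])
      then have "Ck_on k V (\<lambda>y. frechet_derivative F (at (G y)) (axis j 1) $ i)"
        by (intro Ck_on_bounded_linear_comp[OF bounded_linear_vec_nth] \<open>open V\<close>)
      then show ?thesis by (simp add: A_def matrix_def)
    qed
    have "Ck_on k V (\<lambda>y. (if j = l then v $ i else A y $ i $ j))" for i j l
      using A by (cases "j = l") (simp_all add: Ck_on_const)
    then show "Ck_on k V (\<lambda>y. G' y v)"
      unfolding G'_def divide_inverse using detA
      by (intro Ck_on_vec_lambda \<open>open V\<close> Ck_on_bilinear[OF bounded_bilinear_mult] Ck_on_inverse_comp
          Ck_on_det A) auto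
  qed
qed



subsection \<open>Smooth maps on arbitrary sets\<close>

declare Ck_on.simps [simp del]

lemma smooth_onI_Ck: "open S \<Longrightarrow> (\<And>k. Ck_on k S f) \<Longrightarrow> smooth_on S f"
  unfolding smooth_on_def by blast

lemma smooth_on_extend:
  assumes "smooth_on S f" "x \<in> S"
  obtains W F where "open W" "x \<in> W" "\<And>k. Ck_on k W F" "\<And>y. y \<in> W \<Longrightarrow> y \<in> S \<Longrightarrow> F y = f y"
proof -
  obtain W F where W: "open W" "x \<in> W" "\<forall>k. Ck_on k W F" "\<forall>y\<in>W \<inter> S. F y = f y"
    using assms(1)[unfolded smooth_on_def, rule_format, OF assms(2)] by (elim exE conjE)
  show ?thesis
    by (rule that[OF W(1,2) spec[OF W(3)] bspec[OF W(4) IntI]])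
qed

lemma smooth_onI_extend:
  assumes "\<And>x. x \<in> S \<Longrightarrow> \<exists>W F. open W \<and> x \<in> W \<and> (\<forall>k. Ck_on k W F) \<and> (\<forall>y\<in>W \<inter> S. F y = f y)"
  shows "smooth_on S f"
  using assms by (simp add: smooth_on_def)

lemma smooth_on_imp_Ck:
  assumes "open S" "smooth_on S f"
  shows "Ck_on k S f"
proof (rule Ck_on_local)
  fix x assume "x \<in> S"
  obtain W F where W: "open W" "x \<in> W" "\<And>k. Ck_on k W F" "\<And>y. y \<in> W \<Longrightarrow> y \<in> S \<Longrightarrow> F y = f y"
    using smooth_on_extend[OF assms(2) \<open>x \<in> S\<close>] by metis
  have "Ck_on k (W \<inter> S) f \<longleftrightarrow> Ck_on k (W \<inter> S) F"
    by (rule Ck_on_cong) (use W assms in auto)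
  then have "Ck_on k (W \<inter> S) f" using Ck_on_subset[OF W(3)] by blast
  then show "\<exists>W. open W \<and> x \<in> W \<and> Ck_on k W f"
    using W(1,2) assms(1) \<open>x \<in> S\<close> by (intro exI[of _ "W \<inter> S"] conjI) auto
qed

lemma smooth_on_subset:
  assumes "smooth_on S f" "T \<subseteq> S"
  shows "smooth_on T f"
proof (rule smooth_onI_extend)
  fix x assume "x \<in> T"
  then obtain W F where W: "open W" "x \<in> W" "\<And>k. Ck_on k W F" "\<And>y. y \<in> W \<Longrightarrow> y \<in> S \<Longrightarrow> F y = f y"
    using smooth_on_extend[OF assms(1)] assms(2) by (metis subsetD)
  show "\<exists>W F. open W \<and> x \<in> W \<and> (\<forall>k. Ck_on k W F) \<and> (\<forall>y\<in>W \<inter> T. F y = f y)"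
    using W assms(2) by (intro exI[of _ W] exI[of _ F] conjI allI ballI) auto
qed

lemma smooth_on_cong:
  assumes "smooth_on S f" "\<And>x. x \<in> S \<Longrightarrow> g x = f x"
  shows "smooth_on S g"
proof (rule smooth_onI_extend)
  fix x assume "x \<in> S"
  then obtain W F where W: "open W" "x \<in> W" "\<And>k. Ck_on k W F" "\<And>y. y \<in> W \<Longrightarrow> y \<in> S \<Longrightarrow> F y = f y"
    using smooth_on_extend[OF assms(1)] by metis
  show "\<exists>W F. open W \<and> x \<in> W \<and> (\<forall>k. Ck_on k W F) \<and> (\<forall>y\<in>W \<inter> S. F y = g y)"
    using W assms(2) by (intro exI[of _ W] exI[of _ F] conjI allI ballI) auto
qed

lemma smooth_on_local:
  assumes "\<And>x. x \<in> S \<Longrightarrow> \<exists>W. openin (top_of_set S) W \<and> x \<in> W \<and> smooth_on W f"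
  shows "smooth_on S f"
proof (rule smooth_onI_extend)
  fix x assume "x \<in> S"
  then obtain W where W: "openin (top_of_set S) W" "x \<in> W" "smooth_on W f"
    using assms by blast
  then obtain O' where O': "open O'" "W = S \<inter> O'" using openin_open by metis
  obtain V F where "open V" "x \<in> V" "\<And>k. Ck_on k V F" "\<And>y. y \<in> V \<Longrightarrow> y \<in> W \<Longrightarrow> F y = f y"
    using smooth_on_extend[OF W(3,2)] by metis
  note V = this
  have "Ck_on k (V \<inter> O') F" for k
    using Ck_on_subset[OF V(3)] by blast
  then show "\<exists>W F. open W \<and> x \<in> W \<and> (\<forall>k. Ck_on k W F) \<and> (\<forall>y\<in>W \<inter> S. F y = f y)"
    using O' W(2) V by (intro exI[of _ "V \<inter> O'"] exI[of _ F] conjI allI ballI) auto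
qed

lemma smooth_on_imp_continuous_on: "smooth_on S f \<Longrightarrow> continuous_on S f"
proof (rule continuous_on_eq_continuous_within[THEN iffD2], rule ballI)
  fix x assume "smooth_on S f" "x \<in> S"
  then obtain W F where W: "open W" "x \<in> W" "Ck_on 0 W F" "\<And>y. y \<in> W \<Longrightarrow> y \<in> S \<Longrightarrow> F y = f y"
    using smooth_on_extend by metis
  have "isCont F x" using W(1,2) Ck_on_continuous[OF W(3)] continuous_on_eq_continuous_at by blast
  then have "continuous (at x within S) F" by (rule continuous_at_imp_continuous_at_within)
  moreover have "eventually (\<lambda>y. F y = f y) (at x within S)"
    unfolding eventually_at_topological using W by blast
  moreover have "F x = f x" using W \<open>x \<in> S\<close> by blast
  ultimately show "continuous (at x within S) f"
    unfolding continuous_within using tendsto_cong by metis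
qed

lemma smooth_on_compose:
  assumes "smooth_on S f" "smooth_on T g" "\<And>x. x \<in> S \<Longrightarrow> f x \<in> T"
  shows "smooth_on S (\<lambda>x. g (f x))"
  unfolding smooth_on_def
proof
  fix x assume x: "x \<in> S"
  obtain W F where W: "open W" "x \<in> W" "\<And>k. Ck_on k W F" "\<And>y. y \<in> W \<Longrightarrow> y \<in> S \<Longrightarrow> F y = f y"
    using smooth_on_extend[OF assms(1) x] by metis
  obtain V G where V: "open V" "f x \<in> V" "\<And>k. Ck_on k V G" "\<And>y. y \<in> V \<Longrightarrow> y \<in> T \<Longrightarrow> G y = g y"
    using smooth_on_extend[OF assms(2) assms(3)[OF x]] by metis
  have "continuous_on W F" using W(3) Ck_on_continuous by blast
  then have op: "open (W \<inter> F -` V)" using W(1) V(1) continuous_open_preimage by blast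
  have "Ck_on k (W \<inter> F -` V) (\<lambda>x. G (F x))" for k
    by (rule Ck_on_compose[OF op V(1) _ Ck_on_subset[OF W(3)] V(3)]) auto
  moreover have "x \<in> W \<inter> F -` V" using W V x by auto
  ultimately show "\<exists>W' H. open W' \<and> x \<in> W' \<and> (\<forall>k. Ck_on k W' H) \<and> (\<forall>y\<in>W' \<inter> S. H y = g (f y))"
    using op W(4) V(4) assms(3)
    by (intro exI[of _ "W \<inter> F -` V"] exI[of _ "\<lambda>x. G (F x)"] conjI allI ballI) auto
qed



section \<open>Closure properties of smooth maps on arbitrary sets\<close>

named_theorems smooth_intros

lemma smooth_on_const [smooth_intros]: "smooth_on S (\<lambda>x. c)"
  by (rule smooth_on_subset[OF smooth_onI_Ck[of UNIV]]) (auto simp: Ck_on_const)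

lemma smooth_on_bounded_linear: "bounded_linear f \<Longrightarrow> smooth_on S f"
  by (rule smooth_on_subset[OF smooth_onI_Ck[of UNIV]]) (auto simp: Ck_on_bounded_linear)

lemma smooth_on_ident [smooth_intros]: "smooth_on S (\<lambda>x. x)"
  by (rule smooth_on_bounded_linear) (rule bounded_linear_ident)

lemma smooth_on_bounded_linear_comp:
  assumes "bounded_linear L" "smooth_on S f"
  shows "smooth_on S (\<lambda>x. L (f x))"
  by (rule smooth_on_compose[OF assms(2) smooth_on_bounded_linear[OF assms(1)], of UNIV]) simp

text \<open>One argument for every binary operation: two local extensions are restricted to a common
  neighbourhood and combined there.\<close>

lemma smooth_on_Ck_combine:
  fixes S :: "'a::euclidean_space set"
  assumes "smooth_on S f" "smooth_on S g"
    and "\<And>k (W :: 'a set) F G. open W \<Longrightarrow> Ck_on k W F \<Longrightarrow> Ck_on k W G \<Longrightarrow> Ck_on k W (\<lambda>x. p (F x) (G x))"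
  shows "smooth_on S (\<lambda>x. p (f x) (g x))"
  unfolding smooth_on_def
proof
  fix x assume x: "x \<in> S"
  obtain W F where W: "open W" "x \<in> W" "\<And>k. Ck_on k W F" "\<And>y. y \<in> W \<Longrightarrow> y \<in> S \<Longrightarrow> F y = f y"
    using smooth_on_extend[OF assms(1) x] by metis
  obtain V G where V: "open V" "x \<in> V" "\<And>k. Ck_on k V G" "\<And>y. y \<in> V \<Longrightarrow> y \<in> S \<Longrightarrow> G y = g y"
    using smooth_on_extend[OF assms(2) x] by metis
  have "Ck_on k (W \<inter> V) (\<lambda>x. p (F x) (G x))" for k
    using Ck_on_subset[OF W(3), of "W \<inter> V"] Ck_on_subset[OF V(3), of "W \<inter> V"] W(1) V(1)
    by (intro assms(3)) auto
  then show "\<exists>W' H. open W' \<and> x \<in> W' \<and> (\<forall>k. Ck_on k W' H) \<and> (\<forall>y\<in>W' \<inter> S. H y = p (f y) (g y))"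
    using W V by (intro exI[of _ "W \<inter> V"] exI[of _ "\<lambda>x. p (F x) (G x)"] conjI allI ballI) auto
qed

lemma smooth_on_bilinear:
  assumes "bounded_bilinear p" "smooth_on S f" "smooth_on S g"
  shows "smooth_on S (\<lambda>x. p (f x) (g x))"
  by (rule smooth_on_Ck_combine[where p = p, OF assms(2,3)]) (rule Ck_on_bilinear[OF assms(1)])

lemma smooth_on_add [smooth_intros]:
  "smooth_on S f \<Longrightarrow> smooth_on S g \<Longrightarrow> smooth_on S (\<lambda>x. f x + g x)"
  by (rule smooth_on_Ck_combine[where p = "(+)"]) (auto intro: Ck_on_add)

lemma smooth_on_uminus [smooth_intros]: "smooth_on S f \<Longrightarrow> smooth_on S (\<lambda>x. - f x)"
  by (rule smooth_on_bounded_linear_comp[OF bounded_linear_minus[OF bounded_linear_ident]])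

lemma smooth_on_diff [smooth_intros]:
  "smooth_on S f \<Longrightarrow> smooth_on S g \<Longrightarrow> smooth_on S (\<lambda>x. f x - g x)"
  using smooth_on_add[of S f "\<lambda>x. - g x"] smooth_on_uminus[of S g] by simp

lemmas smooth_on_scaleR [smooth_intros] = smooth_on_bilinear[OF bounded_bilinear_scaleR]
lemmas smooth_on_inner [smooth_intros] = smooth_on_bilinear[OF bounded_bilinear_inner]

lemma smooth_on_mult [smooth_intros]:
  fixes f g :: "'a::euclidean_space \<Rightarrow> real"
  shows "smooth_on S f \<Longrightarrow> smooth_on S g \<Longrightarrow> smooth_on S (\<lambda>x. f x * g x)"
  by (rule smooth_on_bilinear[OF bounded_bilinear_mult])

lemmas smooth_on_fst [smooth_intros] = smooth_on_bounded_linear_comp[OF bounded_linear_fst]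
lemmas smooth_on_snd [smooth_intros] = smooth_on_bounded_linear_comp[OF bounded_linear_snd]
lemmas smooth_on_vec_nth [smooth_intros] = smooth_on_bounded_linear_comp[OF bounded_linear_vec_nth]

lemma smooth_on_Pair [smooth_intros]:
  fixes f :: "'a::euclidean_space \<Rightarrow> 'b::euclidean_space" and g :: "'a \<Rightarrow> 'c::euclidean_space"
  assumes "smooth_on S f" "smooth_on S g"
  shows "smooth_on S (\<lambda>x. (f x, g x))"
proof -
  have "bounded_linear (\<lambda>x::'b. (x, 0::'c))" "bounded_linear (\<lambda>x::'c. (0::'b, x))"
    by (auto intro!: bounded_linear_Pair bounded_linear_ident bounded_linear_zero)
  from this[THEN smooth_on_bounded_linear_comp]
  have "smooth_on S (\<lambda>x. (f x, 0) + (0, g x))"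
    using assms by (intro smooth_on_add) auto
  then show ?thesis by simp
qed

lemma smooth_on_sum [smooth_intros]:
  "finite I \<Longrightarrow> (\<And>i. i \<in> I \<Longrightarrow> smooth_on S (f i)) \<Longrightarrow> smooth_on S (\<lambda>x. \<Sum>i\<in>I. f i x)"
  by (induction rule: finite_induct) (auto intro: smooth_intros)

lemma smooth_on_vec_lambda [smooth_intros]:
  fixes f :: "'n::finite \<Rightarrow> 'a::euclidean_space \<Rightarrow> 'b::euclidean_space"
  assumes "\<And>i. smooth_on S (f i)"
  shows "smooth_on S (\<lambda>x. (\<chi> i. f i x))"
proof -
  have "linear (\<lambda>y::'b. (\<chi> j. if j = i then y else 0) :: 'b^'n)" for i
    by (rule linearI) (auto simp: vec_eq_iff)
  then have "bounded_linear (\<lambda>y::'b. (\<chi> j. if j = i then y else 0) :: 'b^'n)" for i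
    by (simp add: linear_conv_bounded_linear)
  from smooth_on_bounded_linear_comp[OF this assms]
  have "smooth_on S (\<lambda>x. \<Sum>i\<in>UNIV. (\<chi> j. if j = i then f i x else 0) :: 'b^'n)"
    by (intro smooth_on_sum) auto
  moreover have "(\<lambda>x. \<Sum>i\<in>UNIV. (\<chi> j. if j = i then f i x else 0) :: 'b^'n) = (\<lambda>x. (\<chi> i. f i x))"
    by (auto simp: vec_eq_iff fun_eq_iff)
  ultimately show ?thesis by simp
qed

lemma smooth_on_inverse [smooth_intros]:
  fixes f :: "'a::euclidean_space \<Rightarrow> real"
  assumes "smooth_on S f" "\<And>x. x \<in> S \<Longrightarrow> f x \<noteq> 0"
  shows "smooth_on S (\<lambda>x. inverse (f x))"
  by (rule smooth_on_compose[OF assms(1) smooth_onI_Ck[of "- {0}"]])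
    (use assms in \<open>auto intro: Ck_on_inverse\<close>)

lemma smooth_on_divide [smooth_intros]:
  fixes f :: "'a::euclidean_space \<Rightarrow> real"
  assumes "smooth_on S f" "smooth_on S g" "\<And>x. x \<in> S \<Longrightarrow> g x \<noteq> 0"
  shows "smooth_on S (\<lambda>x. f x / g x)"
  unfolding divide_inverse using assms by (intro smooth_intros)

lemma smooth_on_sqrt [smooth_intros]:
  assumes "smooth_on S f" "\<And>x. x \<in> S \<Longrightarrow> 0 < f x"
  shows "smooth_on S (\<lambda>x. sqrt (f x))"
  by (rule smooth_on_compose[OF assms(1) smooth_onI_Ck[OF _ Ck_on_sqrt]]) (use assms in auto)

lemma smooth_on_arctan [smooth_intros]:
  assumes "smooth_on S f"
  shows "smooth_on S (\<lambda>x. arctan (f x))"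
  by (rule smooth_on_compose[OF assms(1) smooth_onI_Ck[OF _ Ck_on_arctan]]) auto

lemma smooth_on_norm [smooth_intros]:
  assumes "smooth_on S f" "\<And>x. x \<in> S \<Longrightarrow> f x \<noteq> 0"
  shows "smooth_on S (\<lambda>x. norm (f x))"
  unfolding norm_eq_sqrt_inner using assms by (auto intro!: smooth_intros)

lemma smooth_on_sgn [smooth_intros]:
  fixes f :: "'a::euclidean_space \<Rightarrow> 'b::euclidean_space"
  assumes "smooth_on S f" "\<And>x. x \<in> S \<Longrightarrow> f x \<noteq> 0"
  shows "smooth_on S (\<lambda>x. sgn (f x))"
  unfolding sgn_div_norm using assms by (auto intro!: smooth_intros)

lemma smooth_on_matrix_vector_mult [smooth_intros]:
  fixes f :: "'a::euclidean_space \<Rightarrow> real^'n::finite^'m::finite"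
  assumes "smooth_on S f" "smooth_on S g"
  shows "smooth_on S (\<lambda>x. f x *v g x)"
  unfolding matrix_vector_mult_def using assms by (auto intro!: smooth_intros)

lemma smooth_on_matrix_mult [smooth_intros]:
  fixes f :: "'a::euclidean_space \<Rightarrow> real^'n::finite^'m::finite"
    and g :: "'a::euclidean_space \<Rightarrow> real^'l::finite^'n::finite"
  assumes "smooth_on S f" "smooth_on S g"
  shows "smooth_on S (\<lambda>x. f x ** g x)"
  unfolding matrix_matrix_mult_def using assms by (auto intro!: smooth_intros)

lemma smooth_on_transpose [smooth_intros]:
  fixes f :: "'a::euclidean_space \<Rightarrow> real^'n::finite^'m::finite"
  assumes "smooth_on S f"
  shows "smooth_on S (\<lambda>x. transpose (f x))"
  unfolding transpose_def using assms by (auto intro!: smooth_intros)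

lemma smooth_on_power_series:
  fixes c :: "nat \<Rightarrow> real"
  assumes "\<And>x. \<bar>x\<bar> < K \<Longrightarrow> summable (\<lambda>n. c n * x ^ n)"
  shows "smooth_on {-K<..<K} (\<lambda>x. \<Sum>n. c n * x ^ n)"
  by (rule smooth_onI_Ck) (auto intro: Ck_on_power_series assms)

subsection \<open>Even functions of the norm\<close>

text \<open>With r = s^2 these three are cos s, sin s / s and arctan s / s. They are even in s and
  therefore smooth in r, also at r = 0; inserting an inner product \<open>v \<bullet> v\<close> for
  r gives smoothness at v = 0, where the norm has a corner.\<close>

definition cosr :: "real \<Rightarrow> real" where "cosr r = cos (sqrt r)"
definition sincr :: "real \<Rightarrow> real" where "sincr r = (if r = 0 then 1 else sin (sqrt r) / sqrt r)"
definition arctanr :: "real \<Rightarrow> real" where "arctanr r = (if r = 0 then 1 else arctan (sqrt r) / sqrt r)"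

text \<open>A power series that converges at a positive y converges absolutely at all smaller |x|,
  so the nonnegative half of the interval controls the negative half.\<close>

lemma summable_scaled_power:
  fixes c :: "nat \<Rightarrow> real"
  assumes "\<And>x. 0 \<le> x \<Longrightarrow> x < K \<Longrightarrow> summable (\<lambda>n. c n * x ^ n)" "\<bar>x\<bar> < K"
  shows "summable (\<lambda>n. c n * x ^ n)"
proof -
  obtain y where "\<bar>x\<bar> < y" "y < K" using assms(2) dense by blast
  then show ?thesis
    using powser_inside[of c y x] assms(1)[of y] by auto
qed

text \<open>Smoothness at the end point 0 requires an extension to negative arguments; the sum of
  the series provides it.\<close>

lemma smooth_on_nonneg_power_series:
  fixes c :: "nat \<Rightarrow> real"
  assumes "\<And>x. 0 \<le> x \<Longrightarrow> x < K \<Longrightarrow> (\<lambda>n. c n * x ^ n) sums f x"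
  shows "smooth_on {0..<K} f"
proof (rule smooth_on_cong)
  have "\<And>x::real. \<bar>x\<bar> < K \<Longrightarrow> summable (\<lambda>n. c n * x ^ n)"
    using assms summable_scaled_power sums_summable by metis
  from smooth_on_power_series[OF this]
  show "smooth_on {0..<K} (\<lambda>x. \<Sum>n. c n * x ^ n)"
    by (rule smooth_on_subset) auto
  show "f x = (\<Sum>n. c n * x ^ n)" if "x \<in> {0..<K}" for x
    using assms[of x] that sums_unique by auto
qed

lemma smooth_on_nonneg:
  assumes "\<And>K::real. smooth_on {0..<K} f"
  shows "smooth_on {0..} f"
proof (rule smooth_on_local)
  fix x :: real assume "x \<in> {0..}"
  moreover have "{0..<x+1} = {0..} \<inter> {..<x+1}" by auto
  moreover have "openin (top_of_set {0..}) ({0..} \<inter> {..<x+1})"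
    by (rule openin_open_Int) simp
  ultimately show "\<exists>W. openin (top_of_set {0..}) W \<and> x \<in> W \<and> smooth_on W f"
    using assms[of "x+1"] by (intro exI[of _ "{0..<x+1}"] conjI) simp_all
qed

lemma smooth_on_cosr: "smooth_on {0..} cosr"
proof (rule smooth_on_nonneg)
  fix K :: real
  show "smooth_on {0..<K} cosr"
  proof (rule smooth_on_nonneg_power_series)
    fix y :: real assume y: "0 \<le> y"
    have "(\<lambda>n. (- 1) ^ n / fact (2 * n) * sqrt y ^ (2 * n)) sums cos (sqrt y)"
      by (rule cos_paired)
    then show "(\<lambda>n. (- 1) ^ n / fact (2 * n) * y ^ n) sums cosr y"
      using y by (simp add: cosr_def power_mult)
  qed
qed

lemma sqrt_odd_power_divide:
  assumes "0 \<le> y" "y \<noteq> 0"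
  shows "sqrt y ^ (2 * n + 1) / sqrt y = y ^ n"
  using assms by (simp add: power_mult)

lemma smooth_on_sincr: "smooth_on {0..} sincr"
proof (rule smooth_on_nonneg)
  fix K :: real
  show "smooth_on {0..<K} sincr"
  proof (rule smooth_on_nonneg_power_series)
    fix y :: real assume y: "0 \<le> y"
    show "(\<lambda>n. (- 1) ^ n / fact (2 * n + 1) * y ^ n) sums sincr y"
    proof (cases "y = 0")
      case True
      then show ?thesis using powser_sums_zero[of "\<lambda>n. (- 1) ^ n / fact (2 * n + 1) :: real"]
        by (simp add: sincr_def)
    next
      case False
      have "(\<lambda>n. (- 1) ^ n / fact (2 * n + 1) * sqrt y ^ (2 * n + 1)) sums sin (sqrt y)"
        by (rule sin_paired)
      from sums_divide[OF this, of "sqrt y"] show ?thesis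
        unfolding times_divide_eq_right[symmetric] sqrt_odd_power_divide[OF y False]
        using False by (simp only: sincr_def if_False)
    qed
  qed
qed

text \<open>The bound 1 is the radius of convergence of the arctangent series. It is the reason why
  the inverse polar coordinates are treated as smooth only where one norm is strictly smaller than
  the other.\<close>

lemma smooth_on_arctanr: "smooth_on {0..<1} arctanr"
proof (rule smooth_on_nonneg_power_series)
  fix y :: real assume y: "0 \<le> y" "y < 1"
  show "(\<lambda>n. (- 1) ^ n / real (2 * n + 1) * y ^ n) sums arctanr y"
  proof (cases "y = 0")
    case True
    then show ?thesis using powser_sums_zero[of "\<lambda>n. (- 1) ^ n / real (2 * n + 1)"]
      by (simp add: arctanr_def)
  next
    case False
    have "\<bar>sqrt y\<bar> \<le> 1" using y by simp
    from sums_divide[OF summable_sums[OF summable_arctan_series[OF this]], of "sqrt y"]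
    have "(\<lambda>n. (- 1) ^ n * (1 / real (n * 2 + 1)) * (sqrt y ^ (2 * n + 1) / sqrt y)) sums arctanr y"
      using False arctan_series[OF \<open>\<bar>sqrt y\<bar> \<le> 1\<close>] by (simp add: arctanr_def mult.commute mult.left_commute)
    then show ?thesis
      unfolding sqrt_odd_power_divide[OF y(1) False] by (simp add: mult.commute)
  qed
qed

lemma smooth_on_cosr_comp [smooth_intros]:
  "smooth_on S f \<Longrightarrow> (\<And>x. x \<in> S \<Longrightarrow> 0 \<le> f x) \<Longrightarrow> smooth_on S (\<lambda>x. cosr (f x))"
  by (rule smooth_on_compose[OF _ smooth_on_cosr]) auto

lemma smooth_on_sincr_comp [smooth_intros]:
  "smooth_on S f \<Longrightarrow> (\<And>x. x \<in> S \<Longrightarrow> 0 \<le> f x) \<Longrightarrow> smooth_on S (\<lambda>x. sincr (f x))"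
  by (rule smooth_on_compose[OF _ smooth_on_sincr]) auto

lemma smooth_on_arctanr_comp [smooth_intros]:
  "smooth_on S f \<Longrightarrow> (\<And>x. x \<in> S \<Longrightarrow> 0 \<le> f x \<and> f x < 1) \<Longrightarrow> smooth_on S (\<lambda>x. arctanr (f x))"
  by (rule smooth_on_compose[OF _ smooth_on_arctanr]) auto

lemma cosr_power2: "cosr (x\<^sup>2) = cos x"
  by (simp add: cosr_def)

lemma sincr_power2: "x * sincr (x\<^sup>2) = sin x"
  by (auto simp: sincr_def abs_if)

lemma arctanr_power2: "x * arctanr (x\<^sup>2) = arctan x"
  by (auto simp: arctanr_def abs_if arctan_minus)

section \<open>Transport of smooth structures\<close>

text \<open>A smooth left inverse on the image is the inverse there, so it gives injectivity and the
  smoothness of \<open>inv_into\<close> together.\<close>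

lemma smooth_diffeo_onto_openI:
  assumes "smooth_on S f" "open (f ` S)" "smooth_on (f ` S) g" "\<And>x. x \<in> S \<Longrightarrow> g (f x) = x"
  shows "smooth_diffeo_onto_open S f"
proof -
  have inj: "inj_on f S" using assms(4) by (metis inj_onI)
  have "smooth_on (f ` S) (inv_into S f)"
    by (rule smooth_on_cong[OF assms(3)]) (use assms(4) inj in auto)
  then show ?thesis using assms inj by (simp add: smooth_diffeo_onto_open_def)
qed

lemma smooth_diffeo_onto_openD:
  assumes "smooth_diffeo_onto_open S f"
  shows "smooth_on S f" "inj_on f S" "open (f ` S)" "smooth_on (f ` S) (inv_into S f)"
  using assms by (auto simp: smooth_diffeo_onto_open_def)

lemma image_openin_open:
  assumes "open (f ` S)" "inj_on f S" "continuous_on (f ` S) (inv_into S f)" "openin (top_of_set S) T"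
  shows "open (f ` T)"
proof -
  have "T \<subseteq> S" using assms(4) openin_imp_subset by blast
  then have "f ` T = f ` S \<inter> inv_into S f -` T" using assms(2) by auto
  moreover have "openin (top_of_set (f ` S)) (f ` S \<inter> inv_into S f -` T)"
    by (rule continuous_openin_preimage[OF assms(3) _ assms(4)]) (auto intro!: inv_into_into)
  ultimately show ?thesis using assms(1) openin_open_eq by metis
qed

lemma smooth_diffeo_onto_open_subset:
  assumes "smooth_diffeo_onto_open S f" "openin (top_of_set S) T"
  shows "smooth_diffeo_onto_open T f"
proof -
  note d = smooth_diffeo_onto_openD[OF assms(1)]
  have sub: "T \<subseteq> S" using assms(2) openin_imp_subset by blast
  show ?thesis
  proof (rule smooth_diffeo_onto_openI)
    show "open (f ` T)"
      using image_openin_open[OF d(3,2) smooth_on_imp_continuous_on[OF d(4)] assms(2)] .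
    show "smooth_on (f ` T) (inv_into S f)" by (rule smooth_on_subset[OF d(4)]) (use sub in auto)
  qed (use d sub in \<open>auto intro: smooth_on_subset\<close>)
qed

lemma is_chart_top_of_set_iff:
  fixes N :: "'a::euclidean_space set" and \<phi> :: "'a \<Rightarrow> 'e::euclidean_space"
  shows "is_chart (top_of_set N) (U, \<phi>) \<longleftrightarrow> openin (top_of_set N) U \<and> open (\<phi> ` U) \<and>
    inj_on \<phi> U \<and> continuous_on U \<phi> \<and> continuous_on (\<phi> ` U) (inv_into U \<phi>)"
proof (cases "openin (top_of_set N) U")
  case True
  then have U: "subtopology (top_of_set N) U = top_of_set U"
    by (metis openin_imp_subset subtopology_subtopology inf.absorb2)
  have "homeomorphic_map (top_of_set U) (top_of_set (\<phi> ` U)) \<phi> \<longleftrightarrow>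
    inj_on \<phi> U \<and> continuous_on U \<phi> \<and> continuous_on (\<phi> ` U) (inv_into U \<phi>)" (is "?l = ?r")
  proof
    assume l: ?l
    then have inj: "inj_on \<phi> U" and c: "continuous_on U \<phi>"
      by (auto simp: homeomorphic_eq_everything_map)
    from l obtain g where g: "homeomorphic_maps (top_of_set U) (top_of_set (\<phi> ` U)) \<phi> g"
      using homeomorphic_map_maps by blast
    then have g': "continuous_on (\<phi> ` U) g" "\<And>x. x \<in> U \<Longrightarrow> g (\<phi> x) = x"
      by (auto simp: homeomorphic_maps_def)
    have "inv_into U \<phi> y = g y" if "y \<in> \<phi> ` U" for y
      using that inj g'(2) by auto
    then have "continuous_on (\<phi> ` U) (inv_into U \<phi>)"
      using continuous_on_cong[of "\<phi> ` U" "\<phi> ` U" "inv_into U \<phi>" g] g'(1) by simp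
    then show ?r using inj c by simp
  next
    assume r: ?r
    then have "homeomorphic_maps (top_of_set U) (top_of_set (\<phi> ` U)) \<phi> (inv_into U \<phi>)"
      by (auto simp: homeomorphic_maps_def inv_into_into)
    then show ?l using homeomorphic_map_maps by blast
  qed
  then show ?thesis using True U by (auto simp: is_chart_def)
qed (auto simp: is_chart_def)

lemma is_chart_pullback:
  assumes h: "homeomorphic_map X Y h" and c: "is_chart Y (V, \<psi>)"
  shows "is_chart X ({x \<in> topspace X. h x \<in> V}, \<psi> \<circ> h)"
proof -
  let ?U = "{x \<in> topspace X. h x \<in> V}"
  have V: "openin Y V" "open (\<psi> ` V)" "homeomorphic_map (subtopology Y V) (top_of_set (\<psi> ` V)) \<psi>"
    using c by (auto simp: is_chart_def)
  have img: "h ` ?U = V"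
    using homeomorphic_imp_surjective_map[OF h] openin_subset[OF V(1)] by auto
  have 1: "homeomorphic_map (subtopology X ?U) (subtopology Y V) h"
    by (rule homeomorphic_map_subtopologies_alt[OF h]) auto
  have "openin X ?U"
    using h V(1) openin_continuous_map_preimage homeomorphic_imp_continuous_map by blast
  moreover have im: "(\<psi> \<circ> h) ` ?U = \<psi> ` V" using img by (metis image_comp)
  ultimately show ?thesis
    unfolding is_chart_def split_beta fst_conv snd_conv im
    using V(2) homeomorphic_map_compose[OF 1 V(3)] by blast
qed

lemma homeomorphic_map_inv_into:
  assumes "homeomorphic_map X Y h"
  shows "homeomorphic_map Y X (inv_into (topspace X) h)"
proof -
  obtain g where g: "homeomorphic_maps X Y h g" using assms homeomorphic_map_maps by blast
  have "inj_on h (topspace X)" "h ` topspace X = topspace Y"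
    using assms by (auto simp: homeomorphic_eq_everything_map)
  moreover have g': "homeomorphic_map Y X g" "\<And>x. x \<in> topspace X \<Longrightarrow> g (h x) = x"
    using g[unfolded homeomorphic_maps_map] by auto
  ultimately have "g y = inv_into (topspace X) h y" if "y \<in> topspace Y" for y
    using that by (metis imageE inv_into_f_f)
  then show ?thesis by (rule homeomorphic_map_eq[OF g'(1)])
qed

lemma homeomorphic_map_inv_into_f:
  assumes "homeomorphic_map X Y h"
  shows "x \<in> topspace X \<Longrightarrow> inv_into (topspace X) h (h x) = x"
    "y \<in> topspace Y \<Longrightarrow> h (inv_into (topspace X) h y) = y"
    "x \<in> topspace X \<Longrightarrow> h x \<in> topspace Y"
    "y \<in> topspace Y \<Longrightarrow> inv_into (topspace X) h y \<in> topspace X"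
proof -
  have h: "inj_on h (topspace X)" "h ` topspace X = topspace Y"
    using assms by (auto simp: homeomorphic_eq_everything_map)
  show "x \<in> topspace X \<Longrightarrow> inv_into (topspace X) h (h x) = x" by (rule inv_into_f_f[OF h(1)])
  show "y \<in> topspace Y \<Longrightarrow> h (inv_into (topspace X) h y) = y" by (rule f_inv_into_f) (use h in simp)
  show "x \<in> topspace X \<Longrightarrow> h x \<in> topspace Y" using h by blast
  show "y \<in> topspace Y \<Longrightarrow> inv_into (topspace X) h y \<in> topspace X" by (rule inv_into_into) (use h in simp)
qed

lemma is_chart_pushforward:
  assumes h: "homeomorphic_map X Y h" and c: "is_chart X (U, \<phi>)"
  shows "is_chart Y (h ` U, \<phi> \<circ> inv_into (topspace X) h)"
proof -
  have "U \<subseteq> topspace X" using c openin_subset by (auto simp: is_chart_def)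
  then have "{y \<in> topspace Y. inv_into (topspace X) h y \<in> U} = h ` U"
    using homeomorphic_map_inv_into_f[OF h] by (auto simp: image_iff) (metis subsetD)
  then show ?thesis
    using is_chart_pullback[OF homeomorphic_map_inv_into[OF h] c] by simp
qed

text \<open>The maximal smooth structure for which h is a diffeomorphism onto its image in Euclidean
  space. Both atlases of the theorem turn out to be of this form, for two maps h with the same
  image.\<close>

definition induced_charts ::
  "'a topology \<Rightarrow> ('a \<Rightarrow> 'b::euclidean_space) \<Rightarrow> ('a, 'e::euclidean_space) chart set" where
  "induced_charts X h = {(U, \<phi>). is_chart X (U, \<phi>) \<and>
     smooth_diffeo_onto_open (h ` U) (\<phi> \<circ> inv_into (topspace X) h)}"

text \<open>Seen through \<open>hX\<close> and \<open>hY\<close>, the map g is the identity of N, so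
  its coordinate expression is one smooth chart after the inverse of another. The case of the
  identity g gives chart changes, the general case maps between two spaces.\<close>

lemma induced_charts_transition:
  assumes hX: "homeomorphic_map X (top_of_set N) hX" and hY: "homeomorphic_map Y (top_of_set N) hY"
    and c: "(U, \<phi>) \<in> induced_charts X hX" and d: "(V, \<psi>) \<in> induced_charts Y hY"
    and "S \<subseteq> U" and g: "\<And>x. x \<in> S \<Longrightarrow> g x \<in> V \<and> hY (g x) = hX x"
  shows "smooth_on (\<phi> ` S) (\<psi> \<circ> g \<circ> inv_into U \<phi>)"
proof -
  let ?k = "inv_into (topspace X) hX" and ?l = "inv_into (topspace Y) hY"
  have U: "U \<subseteq> topspace X" "is_chart X (U, \<phi>)" and dU: "smooth_diffeo_onto_open (hX ` U) (\<phi> \<circ> ?k)"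
    using c openin_subset by (auto simp: induced_charts_def is_chart_def)
  have V: "V \<subseteq> topspace Y" and dV: "smooth_diffeo_onto_open (hY ` V) (\<psi> \<circ> ?l)"
    using d openin_subset by (auto simp: induced_charts_def is_chart_def)
  have k: "?k (hX x) = x" if "x \<in> U" for x
    using homeomorphic_map_inv_into_f(1)[OF hX] that U by blast
  have l: "?l (hY x) = x" if "x \<in> V" for x
    using homeomorphic_map_inv_into_f(1)[OF hY] that V by blast
  have inj: "inj_on \<phi> U"
  proof (rule inj_onI)
    fix x y assume xy: "x \<in> U" "y \<in> U" "\<phi> x = \<phi> y"
    then have "hX x = hX y"
      using k by (intro inj_onD[OF smooth_diffeo_onto_openD(2)[OF dU]]) auto
    then show "x = y" using k xy by metis
  qed
  have eq: "inv_into (hX ` U) (\<phi> \<circ> ?k) (\<phi> x) = hX x" if "x \<in> U" for x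
    using inv_into_f_f[OF smooth_diffeo_onto_openD(2)[OF dU], of "hX x"] k that by auto
  have im: "(\<phi> \<circ> ?k) ` hX ` U = \<phi> ` U" using k by force
  have "smooth_on (\<phi> ` S) (\<lambda>y. (\<psi> \<circ> ?l) (inv_into (hX ` U) (\<phi> \<circ> ?k) y))"
  proof (rule smooth_on_compose[OF _ smooth_diffeo_onto_openD(1)[OF dV]])
    show "smooth_on (\<phi> ` S) (inv_into (hX ` U) (\<phi> \<circ> ?k))"
      by (rule smooth_on_subset[OF smooth_diffeo_onto_openD(4)[OF dU]]) (use im \<open>S \<subseteq> U\<close> in auto)
    fix y assume "y \<in> \<phi> ` S"
    then obtain x where x: "x \<in> S" "y = \<phi> x" by blast
    then have "inv_into (hX ` U) (\<phi> \<circ> ?k) y = hY (g x)"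
      using eq[of x] g[of x] \<open>S \<subseteq> U\<close> by auto
    then show "inv_into (hX ` U) (\<phi> \<circ> ?k) y \<in> hY ` V"
      using imageI[of "g x" V hY] g[OF x(1)] by metis
  qed
  then show ?thesis
  proof (rule smooth_on_cong)
    fix y assume "y \<in> \<phi> ` S"
    then obtain x where x: "x \<in> S" "y = \<phi> x" by blast
    then have "x \<in> U" using \<open>S \<subseteq> U\<close> by blast
    show "(\<psi> \<circ> g \<circ> inv_into U \<phi>) y = (\<psi> \<circ> ?l) (inv_into (hX ` U) (\<phi> \<circ> ?k) y)"
      using inv_into_f_f[OF inj \<open>x \<in> U\<close>] eq[OF \<open>x \<in> U\<close>] l[of "g x"] g[OF x(1)] x(2) by simp
  qed
qed

lemma second_countable_euclidean:
  "second_countable (euclidean :: 'a::second_countable_topology topology)"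
proof -
  obtain B :: "'a set set" where B: "countable B" "topological_basis B"
    using ex_countable_basis by blast
  then have "\<And>V. V \<in> B \<Longrightarrow> open V" "\<And>U x. open U \<Longrightarrow> x \<in> U \<Longrightarrow> \<exists>V\<in>B. x \<in> V \<and> V \<subseteq> U"
    using topological_basis_open topological_basisE by (blast, metis)
  then show ?thesis
    unfolding second_countable_def using B(1) by (auto intro!: exI[of _ B])
qed

text \<open>The separation and countability axioms come from Euclidean space along h, and
  compatibility of charts is automatic. The local charts of N assumed in \<open>ch\<close> serve to
  cover X.\<close>

lemma smooth_manifold_induced_charts:
  fixes N :: "'b::euclidean_space set"
  assumes h: "homeomorphic_map X (top_of_set N) h"
    and ch: "\<And>q. q \<in> N \<Longrightarrow> \<exists>W \<xi>. openin (top_of_set N) W \<and> q \<in> W \<and>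
               smooth_diffeo_onto_open W (\<xi> :: 'b \<Rightarrow> 'e::euclidean_space)"
  shows "smooth_manifold X (induced_charts X h :: ('a, 'e) chart set)"
  unfolding smooth_manifold_def
proof (intro conjI ballI)
  have hs: "X homeomorphic_space top_of_set N"
    using h homeomorphic_map_imp_homeomorphic_space by blast
  have "Hausdorff_space (top_of_set N)"
    by (simp add: Hausdorff_space_subtopology)
  then show "Hausdorff_space X" using homeomorphic_Hausdorff_space[OF hs] by simp
  show "second_countable X"
    using homeomorphic_space_second_countability[OF hs]
      second_countable_subtopology[OF second_countable_euclidean] by simp
next
  fix c :: "('a, 'e) chart" assume "c \<in> induced_charts X h"
  then show "is_chart X c" by (auto simp: induced_charts_def)
next
  have "x \<in> (\<Union>c\<in>(induced_charts X h :: ('a, 'e) chart set). fst c)" if x: "x \<in> topspace X" for x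
  proof -
    obtain W and \<xi> :: "'b \<Rightarrow> 'e" where W: "openin (top_of_set N) W" "h x \<in> W"
      "smooth_diffeo_onto_open W \<xi>"
      using ch[of "h x"] homeomorphic_map_inv_into_f(3)[OF h x] by auto
    have "is_chart (top_of_set N) (W, \<xi>)"
      unfolding is_chart_top_of_set_iff
      using W(1) smooth_diffeo_onto_openD[OF W(3)] smooth_diffeo_onto_openD(1,4)[OF W(3), THEN smooth_on_imp_continuous_on]
      by simp
    from is_chart_pullback[OF h this]
    have c: "is_chart X ({x \<in> topspace X. h x \<in> W}, \<xi> \<circ> h)" .
    have WN: "W \<subseteq> N" using W(1) openin_imp_subset by blast
    have im: "h ` {x \<in> topspace X. h x \<in> W} = W"
      using WN homeomorphic_imp_surjective_map[OF h] by auto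
    have eq: "\<xi> q = (\<xi> \<circ> h \<circ> inv_into (topspace X) h) q" if "q \<in> W" for q
      using homeomorphic_map_inv_into_f(2)[OF h, of q] that WN by auto
    have "smooth_diffeo_onto_open W (\<xi> \<circ> h \<circ> inv_into (topspace X) h)"
    proof (rule smooth_diffeo_onto_openI)
      have i: "(\<xi> \<circ> h \<circ> inv_into (topspace X) h) ` W = \<xi> ` W"
        by (rule image_cong[OF refl eq[symmetric]])
      show "open ((\<xi> \<circ> h \<circ> inv_into (topspace X) h) ` W)"
        "smooth_on ((\<xi> \<circ> h \<circ> inv_into (topspace X) h) ` W) (inv_into W \<xi>)"
        unfolding i using smooth_diffeo_onto_openD[OF W(3)] by auto
      show "smooth_on W (\<xi> \<circ> h \<circ> inv_into (topspace X) h)"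
        by (rule smooth_on_cong[OF smooth_diffeo_onto_openD(1)[OF W(3)]]) (rule eq[symmetric])
      show "inv_into W \<xi> ((\<xi> \<circ> h \<circ> inv_into (topspace X) h) q) = q" if "q \<in> W" for q
        unfolding eq[OF that, symmetric] by (rule inv_into_f_f[OF smooth_diffeo_onto_openD(2)[OF W(3)] that])
    qed
    then have "({x \<in> topspace X. h x \<in> W}, \<xi> \<circ> h) \<in> induced_charts X h"
      using c im by (simp add: induced_charts_def)
    then show ?thesis by (rule UN_I) (use x W(2) in simp)
  qed
  moreover have "fst c \<subseteq> topspace X" if "c \<in> induced_charts X h" for c :: "('a, 'e) chart"
    using that by (auto simp: induced_charts_def is_chart_def dest: openin_subset[THEN subsetD])
  ultimately show "(\<Union>c\<in>(induced_charts X h :: ('a, 'e) chart set). fst c) = topspace X" by blast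
next
  fix c d :: "('a, 'e) chart"
  assume c: "c \<in> induced_charts X h" and d: "d \<in> induced_charts X h"
  obtain U \<phi> where c': "c = (U, \<phi>)" by (cases c)
  obtain V \<psi> where d': "d = (V, \<psi>)" by (cases d)
  have "smooth_on (\<phi> ` (U \<inter> V)) (\<psi> \<circ> id \<circ> inv_into U \<phi>)"
    by (rule induced_charts_transition[OF h h c[unfolded c'] d[unfolded d']]) auto
  then show "smooth_transition c d" by (simp add: c' d' smooth_transition_def)
qed

lemma smooth_map_induced_charts:
  assumes hX: "homeomorphic_map X (top_of_set N) hX" and hY: "homeomorphic_map Y (top_of_set N) hY"
    and g: "continuous_map X Y g" "\<And>x. x \<in> topspace X \<Longrightarrow> hY (g x) = hX x"
  shows "smooth_map X (induced_charts X hX) Y (induced_charts Y hY) g"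
  unfolding smooth_map_def
proof (intro conjI g(1) ballI, clarify)
  fix U \<phi> V \<psi>
  assume U: "(U, \<phi>) \<in> induced_charts X hX" and V: "(V, \<psi>) \<in> induced_charts Y hY"
  have "U \<subseteq> topspace X"
    using U by (auto simp: induced_charts_def is_chart_def dest: openin_subset[THEN subsetD])
  then show "smooth_on (\<phi> ` {x \<in> U. g x \<in> V}) (\<psi> \<circ> g \<circ> inv_into U \<phi>)"
    using g(2) by (intro induced_charts_transition[OF hX hY U V]) blast+
qed

text \<open>The diffeomorphism is \<open>hX\<close> followed by the inverse of \<open>hY\<close>; in
  the coordinates of N it is the identity.\<close>

lemma diffeomorphic_induced_charts:
  assumes hX: "homeomorphic_map X (top_of_set N) hX" and hY: "homeomorphic_map Y (top_of_set N) hY"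
  shows "diffeomorphic X (induced_charts X hX) Y (induced_charts Y hY)"
proof -
  let ?h = "inv_into (topspace Y) hY \<circ> hX"
  let ?h' = "inv_into (topspace X) ?h"
  note fX = homeomorphic_map_inv_into_f[OF hX] and fY = homeomorphic_map_inv_into_f[OF hY]
  have hom: "homeomorphic_map X Y ?h"
    by (rule homeomorphic_map_compose[OF hX homeomorphic_map_inv_into[OF hY]])
  note f = homeomorphic_map_inv_into_f[OF hom]
  have e: "hY (?h x) = hX x" if "x \<in> topspace X" for x
    using fX(3)[OF that] fY(2) by auto
  have e': "hX (?h' y) = hY y" if "y \<in> topspace Y" for y
    using e[OF f(4)[OF that]] f(2)[OF that] by simp
  have "smooth_map X (induced_charts X hX) Y (induced_charts Y hY) ?h"
    by (rule smooth_map_induced_charts[OF hX hY homeomorphic_imp_continuous_map[OF hom] e])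
  moreover have "smooth_map Y (induced_charts Y hY) X (induced_charts X hX) ?h'"
    by (rule smooth_map_induced_charts[OF hY hX
          homeomorphic_imp_continuous_map[OF homeomorphic_map_inv_into[OF hom]] e'])
  moreover have "bij_betw ?h (topspace X) (topspace Y)"
    using hom by (auto simp: homeomorphic_eq_everything_map bij_betw_def)
  ultimately show ?thesis unfolding diffeomorphic_def by (intro exI[of _ ?h] conjI)
qed

text \<open>A continuous surjection from a compact space to a Hausdorff space is a quotient map, so
  two maps with the same fibres, p and q, determine the same topology.\<close>

lemma quotient_topology_homeomorphic:
  assumes "compact_space X" "Hausdorff_space Y" "continuous_map X Y q" "q ` topspace X = topspace Y"
    and pq: "\<And>a b. a \<in> topspace X \<Longrightarrow> b \<in> topspace X \<Longrightarrow> p a = p b \<longleftrightarrow> q a = q b"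
  obtains h where "homeomorphic_map (quotient_topology X p) Y h"
    "\<And>a. a \<in> topspace X \<Longrightarrow> h (p a) = q a"
proof -
  define h where "h = q \<circ> inv_into (topspace X) p"
  have hp: "h (p a) = q a" if "a \<in> topspace X" for a
    using pq[of "inv_into (topspace X) p (p a)" a] that
    by (auto simp: h_def inv_into_into f_inv_into_f)
  have q: "quotient_map X Y q"
    using continuous_imp_quotient_map assms by blast
  have "homeomorphic_map (quotient_topology X p) Y h"
    unfolding homeomorphic_map_def quotient_map_def topspace_quotient_topology
  proof (intro conjI allI impI)
    show "h ` p ` topspace X = topspace Y"
      using hp assms(4) by (force simp: image_image)
    show "inj_on h (p ` topspace X)"
      using hp pq by (auto simp: inj_on_def)
    fix U assume "U \<subseteq> topspace Y"
    have "{x \<in> topspace X. p x \<in> {x \<in> p ` topspace X. h x \<in> U}} = {x \<in> topspace X. q x \<in> U}"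
      using hp by (auto, metis)
    then show "openin (quotient_topology X p) {x \<in> p ` topspace X. h x \<in> U} = openin Y U"
      unfolding openin_quotient_topology using q \<open>U \<subseteq> topspace Y\<close>
      by (auto simp: quotient_map_def)
  qed
  then show ?thesis using that hp by blast
qed

section \<open>Charts of a submanifold seen through submersions and embeddings\<close>

lemma openin_Int_subset_trans:
  assumes "openin (top_of_set N) A" "openin (top_of_set N) B"
  shows "openin (top_of_set A) (A \<inter> B)" "openin (top_of_set B) (A \<inter> B)"
  by (rule openin_subset_trans[OF openin_Int[OF assms]]; use assms openin_imp_subset in auto)+

lemma is_chart_top_of_setD:
  fixes N :: "'a::euclidean_space set" and \<phi> :: "'a \<Rightarrow> 'e::euclidean_space"
  assumes "is_chart (top_of_set N) (U, \<phi>)"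
  shows "openin (top_of_set N) U" "U \<subseteq> N" "open (\<phi> ` U)" "inj_on \<phi> U" "continuous_on U \<phi>"
    "continuous_on (\<phi> ` U) (inv_into U \<phi>)"
    "\<And>T. openin (top_of_set N) T \<Longrightarrow> open (\<phi> ` (U \<inter> T))"
proof -
  note d = assms[unfolded is_chart_top_of_set_iff]
  show *: "openin (top_of_set N) U" "open (\<phi> ` U)" "inj_on \<phi> U" "continuous_on U \<phi>"
    "continuous_on (\<phi> ` U) (inv_into U \<phi>)" using d by auto
  show "U \<subseteq> N" using *(1) openin_imp_subset by blast
  fix T assume T: "openin (top_of_set N) T"
  have "openin (top_of_set U) (U \<inter> T)"
    by (rule openin_Int_subset_trans(1)[OF *(1) T])
  then show "open (\<phi> ` (U \<inter> T))"
    using image_openin_open[OF *(2,3,5)] by blast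
qed

text \<open>Injectivity and openness of the image are global properties already contained in
  \<open>is_chart\<close>; only smoothness in both directions remains, and this is local.\<close>

lemma smooth_diffeo_onto_open_local:
  fixes N :: "'a::euclidean_space set" and \<phi> :: "'a \<Rightarrow> 'e::euclidean_space"
  assumes c: "is_chart (top_of_set N) (U, \<phi>)"
    and loc: "\<And>q. q \<in> U \<Longrightarrow> \<exists>T. openin (top_of_set N) T \<and> q \<in> T \<and> smooth_diffeo_onto_open (U \<inter> T) \<phi>"
  shows "smooth_diffeo_onto_open U \<phi>"
proof -
  note c' = is_chart_top_of_setD[OF c]
  have "smooth_on U \<phi>"
  proof (rule smooth_on_local)
    fix q assume "q \<in> U"
    then obtain T where T: "openin (top_of_set N) T" "q \<in> T" "smooth_diffeo_onto_open (U \<inter> T) \<phi>"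
      using loc by blast
    have "openin (top_of_set U) (U \<inter> T)"
      by (rule openin_Int_subset_trans(1)[OF c'(1) T(1)])
    then show "\<exists>W. openin (top_of_set U) W \<and> q \<in> W \<and> smooth_on W \<phi>"
      using T \<open>q \<in> U\<close> smooth_diffeo_onto_openD(1)[OF T(3)] by blast
  qed
  moreover have "smooth_on (\<phi> ` U) (inv_into U \<phi>)"
  proof (rule smooth_on_local)
    fix y assume "y \<in> \<phi> ` U"
    then obtain q where q: "q \<in> U" "y = \<phi> q" by blast
    then obtain T where T: "openin (top_of_set N) T" "q \<in> T" "smooth_diffeo_onto_open (U \<inter> T) \<phi>"
      using loc by blast
    have "open (\<phi> ` (U \<inter> T))" using c'(7)[OF T(1)] .
    then have "openin (top_of_set (\<phi> ` U)) (\<phi> ` (U \<inter> T))"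
      by (intro open_openin_trans c'(3)) auto
    moreover have "smooth_on (\<phi> ` (U \<inter> T)) (inv_into U \<phi>)"
    proof (rule smooth_on_cong[OF smooth_diffeo_onto_openD(4)[OF T(3)]])
      fix z assume "z \<in> \<phi> ` (U \<inter> T)"
      then obtain r where r: "r \<in> U \<inter> T" "z = \<phi> r" by blast
      show "inv_into U \<phi> z = inv_into (U \<inter> T) \<phi> z"
        using inv_into_f_f[OF c'(4), of r] inv_into_f_f[OF smooth_diffeo_onto_openD(2)[OF T(3)] r(1)] r
        by simp
    qed
    ultimately show "\<exists>W. openin (top_of_set (\<phi> ` U)) W \<and> y \<in> W \<and> smooth_on W (inv_into U \<phi>)"
      using q T(2) by (intro exI[of _ "\<phi> ` (U \<inter> T)"]) auto
  qed
  ultimately show ?thesis using c' by (simp add: smooth_diffeo_onto_open_def)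
qed

text \<open>The inverse e is carried along explicitly, so that its smoothness on the image can be
  stated and composed. The image is open relative to N and need not be open in the ambient
  space.\<close>

definition smooth_open_embedding ::
  "'a::euclidean_space set \<Rightarrow> ('a \<Rightarrow> 'b::euclidean_space) \<Rightarrow> 'b set \<Rightarrow> ('b \<Rightarrow> 'a) \<Rightarrow> bool" where
  "smooth_open_embedding S d N e \<longleftrightarrow> smooth_on S d \<and> openin (top_of_set N) (d ` S) \<and>
     smooth_on (d ` S) e \<and> (\<forall>s\<in>S. e (d s) = s)"

lemma smooth_open_embeddingD:
  assumes "smooth_open_embedding S d N e"
  shows "smooth_on S d" "openin (top_of_set N) (d ` S)" "smooth_on (d ` S) e" "\<And>s. s \<in> S \<Longrightarrow> e (d s) = s"
  using assms by (auto simp: smooth_open_embedding_def)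

lemma smooth_open_embedding_subset:
  assumes d: "smooth_open_embedding S d N e" and T: "openin (top_of_set S) T"
  shows "smooth_open_embedding T d N e"
proof -
  note d' = smooth_open_embeddingD[OF d]
  have sub: "T \<subseteq> S" using T openin_imp_subset by blast
  have "d ` T = d ` S \<inter> e -` T" using d'(4) sub by (auto simp: image_iff) 
  moreover have "openin (top_of_set (d ` S)) (d ` S \<inter> e -` T)"
    by (rule continuous_openin_preimage[OF smooth_on_imp_continuous_on[OF d'(3)] _ T]) (use d'(4) in auto)
  ultimately have "openin (top_of_set N) (d ` T)" using d'(2) openin_trans by metis
  moreover have "smooth_on T d" "smooth_on (d ` T) e"
    using smooth_on_subset[OF d'(1) sub] smooth_on_subset[OF d'(3) image_mono[OF sub]] .
  ultimately show ?thesis using d'(4) sub by (auto simp: smooth_open_embedding_def)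
qed

lemma smooth_open_embedding_chart:
  assumes d: "smooth_open_embedding S d N e" and g: "smooth_diffeo_onto_open S f"
  shows "openin (top_of_set N) (d ` S)" "smooth_diffeo_onto_open (d ` S) (f \<circ> e)"
proof -
  note d' = smooth_open_embeddingD[OF d] and g' = smooth_diffeo_onto_openD[OF g]
  show "openin (top_of_set N) (d ` S)" using d'(2) .
  have im: "(f \<circ> e) ` d ` S = f ` S" using d'(4) by force
  show "smooth_diffeo_onto_open (d ` S) (f \<circ> e)"
  proof (rule smooth_diffeo_onto_openI[where g = "\<lambda>y. d (inv_into S f y)"])
    show "smooth_on (d ` S) (f \<circ> e)"
      unfolding o_def by (rule smooth_on_compose[OF d'(3) g'(1)]) (use d'(4) in auto)
    show "open ((f \<circ> e) ` d ` S)" unfolding im by (rule g'(3))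
    show "smooth_on ((f \<circ> e) ` d ` S) (\<lambda>y. d (inv_into S f y))"
      unfolding im by (rule smooth_on_compose[OF g'(4) d'(1)]) (rule inv_into_into)
    show "d (inv_into S f ((f \<circ> e) x)) = x" if "x \<in> d ` S" for x
      using that d'(4) g'(2) by auto
  qed
qed

text \<open>Together with the converse that follows, this translates a chart condition on a
  parameter space S into a chart condition on its image in N. The chart conditions of the Kervaire
  manifold are of the first kind.\<close>

lemma smooth_diffeo_compose_embedding:
  fixes N :: "'b::euclidean_space set" and \<phi> :: "'b \<Rightarrow> 'e::euclidean_space"
  assumes c: "is_chart (top_of_set N) (U, \<phi>)" and d: "smooth_open_embedding S d N e"
    and D: "smooth_diffeo_onto_open U \<phi>"
  shows "smooth_diffeo_onto_open {s \<in> S. d s \<in> U} (\<lambda>s. \<phi> (d s))"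
proof -
  note d' = smooth_open_embeddingD[OF d] and D' = smooth_diffeo_onto_openD[OF D]
  have im: "(\<lambda>s. \<phi> (d s)) ` {s \<in> S. d s \<in> U} = \<phi> ` (U \<inter> d ` S)" by auto
  show ?thesis
  proof (rule smooth_diffeo_onto_openI[where g = "\<lambda>y. e (inv_into U \<phi> y)"])
    show "smooth_on {s \<in> S. d s \<in> U} (\<lambda>s. \<phi> (d s))"
      by (rule smooth_on_compose[OF smooth_on_subset[OF d'(1)] D'(1)]) auto
    show "open ((\<lambda>s. \<phi> (d s)) ` {s \<in> S. d s \<in> U})"
      unfolding im by (rule is_chart_top_of_setD(7)[OF c d'(2)])
    show "smooth_on ((\<lambda>s. \<phi> (d s)) ` {s \<in> S. d s \<in> U}) (\<lambda>y. e (inv_into U \<phi> y))"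
      unfolding im by (rule smooth_on_compose[OF smooth_on_subset[OF D'(4)] d'(3)]) (use D'(2) in auto)
    show "e (inv_into U \<phi> (\<phi> (d s))) = s" if "s \<in> {s \<in> S. d s \<in> U}" for s
      using that D'(2) d'(4) by auto
  qed
qed

lemma smooth_diffeo_of_embedding:
  assumes d: "smooth_open_embedding S d N e"
    and D: "smooth_diffeo_onto_open {s \<in> S. d s \<in> U} (\<lambda>s. \<phi> (d s))"
  shows "smooth_diffeo_onto_open (U \<inter> d ` S) \<phi>"
proof -
  let ?S = "{s \<in> S. d s \<in> U}"
  note d' = smooth_open_embeddingD[OF d] and D' = smooth_diffeo_onto_openD[OF D]
  have im: "\<phi> ` (U \<inter> d ` S) = (\<lambda>s. \<phi> (d s)) ` ?S" by auto
  show ?thesis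
  proof (rule smooth_diffeo_onto_openI[where g = "\<lambda>y. d (inv_into ?S (\<lambda>s. \<phi> (d s)) y)"])
    have "smooth_on (U \<inter> d ` S) (\<lambda>q. (\<lambda>s. \<phi> (d s)) (e q))"
      by (rule smooth_on_compose[OF smooth_on_subset[OF d'(3)] D'(1)]) (use d'(4) in auto)
    then show "smooth_on (U \<inter> d ` S) \<phi>"
      by (rule smooth_on_cong) (use d'(4) in auto)
    show "open (\<phi> ` (U \<inter> d ` S))" unfolding im by (rule D'(3))
    show "smooth_on (\<phi> ` (U \<inter> d ` S)) (\<lambda>y. d (inv_into ?S (\<lambda>s. \<phi> (d s)) y))"
      unfolding im by (rule smooth_on_compose[OF D'(4) d'(1)]) (use inv_into_into[of _ "\<lambda>s. \<phi> (d s)" ?S] in blast)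
    show "d (inv_into ?S (\<lambda>s. \<phi> (d s)) (\<phi> q)) = q" if q: "q \<in> U \<inter> d ` S" for q
    proof -
      obtain s where s: "s \<in> ?S" "q = d s" using q by blast
      show ?thesis using inv_into_f_f[OF D'(2) s(1)] s(2) by simp
    qed
  qed
qed

text \<open>In the smooth coordinates \<xi> near q, the chart \<phi> becomes a smooth map F between
  open sets of the same dimension, with a continuous inverse. The curves make the differential of F
  surjective, and \<open>Ck_on_inverse_map\<close> then yields the smooth inverse.\<close>

lemma smooth_inverse_of_surjective_differential:
  fixes \<phi> :: "'b::euclidean_space \<Rightarrow> real^'m::finite"
  assumes c: "is_chart (top_of_set N) (U, \<phi>)" and sm: "smooth_on U \<phi>" and q: "q \<in> U"
    and W: "openin (top_of_set N) W" "q \<in> W" and \<xi>: "smooth_diffeo_onto_open W (\<xi> :: 'b \<Rightarrow> real^'m)"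
    and curves: "\<And>r v. r \<in> U \<Longrightarrow> \<exists>\<gamma> \<epsilon>. \<epsilon> > 0 \<and> smooth_on {-\<epsilon><..<\<epsilon>} \<gamma> \<and> \<gamma> ` {-\<epsilon><..<\<epsilon>} \<subseteq> U \<and>
        \<gamma> (0::real) = r \<and> ((\<phi> \<circ> \<gamma>) has_vector_derivative v) (at 0)"
  shows "smooth_diffeo_onto_open (U \<inter> W) \<phi>"
proof -
  note c' = is_chart_top_of_setD[OF c]
  have UW: "openin (top_of_set W) (U \<inter> W)"
    by (rule openin_Int_subset_trans(2)[OF c'(1) W(1)])
  note \<xi>' = smooth_diffeo_onto_openD[OF smooth_diffeo_onto_open_subset[OF \<xi> UW]]
  let ?\<beta> = "inv_into (U \<inter> W) \<xi>" and ?\<psi> = "inv_into U \<phi>"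
  let ?O = "\<xi> ` (U \<inter> W)" and ?V = "\<phi> ` (U \<inter> W)"
  have \<beta>\<xi>: "?\<beta> (\<xi> r) = r" if "r \<in> U \<inter> W" for r by (rule inv_into_f_f[OF \<xi>'(2) that])
  have \<psi>\<phi>: "?\<psi> (\<phi> r) = r" if "r \<in> U" for r by (rule inv_into_f_f[OF c'(4) that])
  have V: "open ?V" by (rule c'(7)[OF W(1)])
  define F where "F x = \<phi> (?\<beta> x)" for x
  define G where "G y = \<xi> (?\<psi> y)" for y
  have F: "smooth_on ?O F"
    unfolding F_def by (rule smooth_on_compose[OF \<xi>'(4) sm]) (use \<beta>\<xi> in auto)
  have Ck: "Ck_on k ?V G" for k
  proof (rule Ck_on_inverse_map[OF \<xi>'(3) V])
    show "continuous_on ?V G"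
      unfolding G_def
      by (rule continuous_on_compose2[OF smooth_on_imp_continuous_on[OF \<xi>'(1)] continuous_on_subset[OF c'(6)]])
        (use \<psi>\<phi> in auto)
    show "G ` ?V \<subseteq> ?O" using \<psi>\<phi> by (auto simp: G_def)
    show "F (G y) = y" if "y \<in> ?V" for y using that \<psi>\<phi> \<beta>\<xi> by (auto simp: F_def G_def)
    show "Ck_on j ?O F" for j by (rule smooth_on_imp_Ck[OF \<xi>'(3) F])
    then have dF: "(F has_derivative frechet_derivative F (at x)) (at x)" if "x \<in> ?O" for x
      using Ck_on_has_derivative that by blast
    fix x assume "x \<in> ?O"
    then obtain r where r: "r \<in> U \<inter> W" "x = \<xi> r" by blast
    show "surj (frechet_derivative F (at x))"
      unfolding surj_def
    proof
      fix v :: "real^'m"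
      obtain \<gamma> \<epsilon> where g: "\<epsilon> > 0" "smooth_on {-\<epsilon><..<\<epsilon>} \<gamma>" "\<gamma> ` {-\<epsilon><..<\<epsilon>} \<subseteq> U" "\<gamma> (0::real) = r"
        "((\<phi> \<circ> \<gamma>) has_vector_derivative v) (at 0)"
        using curves[of r v] r by blast
      \<comment> \<open>The curve is followed only while it stays in the domain of \<xi>; these
        times form an open set around 0.\<close>
      let ?I = "{-\<epsilon><..<\<epsilon>} \<inter> \<gamma> -` (U \<inter> W)"
      have "openin (top_of_set U) (U \<inter> W)"
        by (rule openin_Int_subset_trans(1)[OF c'(1) W(1)])
      then have "openin (top_of_set {-\<epsilon><..<\<epsilon>}) ?I"
        by (intro continuous_openin_preimage[OF smooth_on_imp_continuous_on[OF g(2)]]) (use g(3) in auto)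
      then have I: "open ?I" using openin_open_eq open_greaterThanLessThan by blast
      have 0: "0 \<in> ?I" using g r by auto
      have "smooth_on ?I (\<lambda>t. \<xi> (\<gamma> t))"
        by (rule smooth_on_compose[OF smooth_on_subset[OF g(2)] \<xi>'(1)]) auto
      then have "Ck_on (Suc 0) ?I (\<lambda>t. \<xi> (\<gamma> t))" by (rule smooth_on_imp_Ck[OF I])
      then obtain c where c: "((\<lambda>t. \<xi> (\<gamma> t)) has_derivative c) (at 0)"
        using Ck_on_has_derivative 0 by blast
      have "((\<lambda>t. F (\<xi> (\<gamma> t))) has_derivative (\<lambda>t. frechet_derivative F (at x) (c t))) (at 0)"
        using diff_chain_at[OF c, of F] dF[OF \<open>x \<in> ?O\<close>] g(4) r(2) by (simp add: o_def)
      then have "((\<phi> \<circ> \<gamma>) has_derivative (\<lambda>t. frechet_derivative F (at x) (c t))) (at 0)"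
        by (rule has_derivative_transform_within_open[OF _ I 0]) (use \<beta>\<xi> in \<open>auto simp: F_def\<close>)
      moreover have "((\<phi> \<circ> \<gamma>) has_derivative (\<lambda>t. t *\<^sub>R v)) (at 0)"
        using g(5) by (simp add: has_vector_derivative_def)
      ultimately have "(\<lambda>t. frechet_derivative F (at x) (c t)) = (\<lambda>t. t *\<^sub>R v)"
        by (rule has_derivative_unique)
      then have "frechet_derivative F (at x) (c 1) = v" by (metis scaleR_one)
      then show "\<exists>w. v = frechet_derivative F (at x) w" by metis
    qed
  qed
  show ?thesis
  proof (rule smooth_diffeo_onto_openI[where g = "\<lambda>y. ?\<beta> (G y)"])
    show "smooth_on (U \<inter> W) \<phi>" by (rule smooth_on_subset[OF sm]) auto
    show "open ?V" by (rule V)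
    show "smooth_on ?V (\<lambda>y. ?\<beta> (G y))"
      by (rule smooth_on_compose[OF smooth_onI_Ck[OF V Ck] \<xi>'(4)]) (use \<psi>\<phi> in \<open>auto simp: G_def\<close>)
    show "?\<beta> (G (\<phi> r)) = r" if "r \<in> U \<inter> W" for r
      using that \<psi>\<phi> \<beta>\<xi> by (auto simp: G_def)
  qed
qed

text \<open>The local sections \<sigma> carry all the content. Composing with \<sigma> turns
  smoothness of \<phi> after J into smoothness of \<phi>, and curves in M are pushed down by J to
  show that the differential of \<phi> is onto. Conversely, straight lines in the chart are lifted
  to M by \<sigma>.\<close>

lemma smooth_submersion_on_iff:
  fixes J :: "'a::euclidean_space \<Rightarrow> 'b::euclidean_space" and \<phi> :: "'b \<Rightarrow> real^'m::finite"
  assumes JM: "J ` M = N" and smJ: "smooth_on M J"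
    and sec: "\<And>p. p \<in> M \<Longrightarrow> \<exists>W \<sigma>. openin (top_of_set N) W \<and> J p \<in> W \<and> smooth_on W \<sigma> \<and>
        \<sigma> ` W \<subseteq> M \<and> (\<forall>q\<in>W. J (\<sigma> q) = q) \<and> \<sigma> (J p) = p"
    and ch: "\<And>q. q \<in> N \<Longrightarrow> \<exists>W \<xi>. openin (top_of_set N) W \<and> q \<in> W \<and>
        smooth_diffeo_onto_open W (\<xi> :: 'b \<Rightarrow> real^'m)"
    and c: "is_chart (top_of_set N) (U, \<phi>)"
  shows "smooth_submersion_on {p \<in> M. J p \<in> U} (\<phi> \<circ> J) \<longleftrightarrow> smooth_diffeo_onto_open U \<phi>"
proof
  note c' = is_chart_top_of_setD[OF c]
  assume D: "smooth_diffeo_onto_open U \<phi>"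
  note D' = smooth_diffeo_onto_openD[OF D]
  show "smooth_submersion_on {p \<in> M. J p \<in> U} (\<phi> \<circ> J)"
    unfolding smooth_submersion_on_def
  proof (intro conjI ballI allI)
    show "smooth_on {p \<in> M. J p \<in> U} (\<phi> \<circ> J)"
      unfolding o_def by (rule smooth_on_compose[OF smooth_on_subset[OF smJ] D'(1)]) auto
    fix p v assume "p \<in> {p \<in> M. J p \<in> U}"
    then have p: "p \<in> M" "J p \<in> U" by auto
    obtain W \<sigma> where W: "openin (top_of_set N) W" "J p \<in> W" "smooth_on W \<sigma>" "\<sigma> ` W \<subseteq> M"
      "\<And>q. q \<in> W \<Longrightarrow> J (\<sigma> q) = q" "\<sigma> (J p) = p"
      using sec[OF p(1)] by blast
    let ?V = "\<phi> ` (U \<inter> W)" and ?\<psi> = "inv_into U \<phi>" and ?l = "\<lambda>t. \<phi> (J p) + t *\<^sub>R v"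
    have "open ?V" "\<phi> (J p) \<in> ?V" using c'(7)[OF W(1)] p W(2) by auto
    then obtain \<delta> where \<delta>: "\<delta> > 0" "ball (\<phi> (J p)) \<delta> \<subseteq> ?V" using open_contains_ball by blast
    \<comment> \<open>The summand 1 keeps the denominator positive when v = 0; the line then stays
      in the ball of radius \<delta>.\<close>
    let ?\<epsilon> = "\<delta> / (norm v + 1)"
    have \<epsilon>: "?\<epsilon> > 0" using \<delta>(1) by (simp add: add_nonneg_pos)
    have l: "?l t \<in> ?V" if "t \<in> {-?\<epsilon><..<?\<epsilon>}" for t
    proof -
      have "\<bar>t\<bar> < ?\<epsilon>" using that by auto
      then have "\<bar>t\<bar> * (norm v + 1) < \<delta>" by (simp add: pos_less_divide_eq add_nonneg_pos)
      moreover have "\<bar>t\<bar> * norm v \<le> \<bar>t\<bar> * (norm v + 1)" by (intro mult_left_mono) auto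
      ultimately have "?l t \<in> ball (\<phi> (J p)) \<delta>" by (simp add: dist_norm)
      then show ?thesis using \<delta>(2) by blast
    qed
    have \<psi>: "?\<psi> y \<in> U \<inter> W" "\<phi> (?\<psi> y) = y" if "y \<in> ?V" for y
      using that inv_into_f_f[OF c'(4)] by auto
    \<comment> \<open>The line with velocity v in the chart, lifted by the section that passes
      through p, so that the curve starts at p and not merely in its fibre.\<close>
    define \<gamma> where "\<gamma> t = \<sigma> (?\<psi> (?l t))" for t
    have J\<gamma>: "J (\<gamma> t) = ?\<psi> (?l t)" if "t \<in> {-?\<epsilon><..<?\<epsilon>}" for t
      unfolding \<gamma>_def using W(5) \<psi>(1)[OF l[OF that]] by auto
    have "smooth_on {-?\<epsilon><..<?\<epsilon>} (\<lambda>t. ?\<psi> (?l t))"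
      by (rule smooth_on_compose[OF _ D'(4)]) (use l in \<open>auto intro!: smooth_intros\<close>)
    then have "smooth_on {-?\<epsilon><..<?\<epsilon>} \<gamma>"
      unfolding \<gamma>_def by (rule smooth_on_compose[OF _ W(3)]) (use \<psi>(1)[OF l] in auto)
    moreover have "\<gamma> ` {-?\<epsilon><..<?\<epsilon>} \<subseteq> {p \<in> M. J p \<in> U}"
    proof clarify
      fix t assume t: "t \<in> {-?\<epsilon><..<?\<epsilon>}"
      then show "\<gamma> t \<in> M \<and> J (\<gamma> t) \<in> U"
        using J\<gamma>[OF t] \<psi>(1)[OF l[OF t]] W(4) by (auto simp: \<gamma>_def)
    qed
    moreover have "\<gamma> 0 = p" using inv_into_f_f[OF c'(4) p(2)] W(6) by (simp add: \<gamma>_def)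
    moreover have "((\<phi> \<circ> J \<circ> \<gamma>) has_vector_derivative v) (at 0)"
    proof (rule has_vector_derivative_transform_within_open[of ?l])
      show "(?l has_vector_derivative v) (at 0)"
        by (auto intro!: derivative_eq_intros)
      show "open {-?\<epsilon><..<?\<epsilon>}" "0 \<in> {-?\<epsilon><..<?\<epsilon>}" using \<epsilon> by auto
      show "?l t = (\<phi> \<circ> J \<circ> \<gamma>) t" if "t \<in> {-?\<epsilon><..<?\<epsilon>}" for t
        using J\<gamma>[OF that] \<psi>(2)[OF l[OF that]] by simp
    qed
    ultimately show "\<exists>\<gamma> \<epsilon>. \<epsilon> > 0 \<and> smooth_on {-\<epsilon><..<\<epsilon>} \<gamma> \<and> \<gamma> ` {-\<epsilon><..<\<epsilon>} \<subseteq> {p \<in> M. J p \<in> U} \<and>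
        \<gamma> 0 = p \<and> ((\<phi> \<circ> J \<circ> \<gamma>) has_vector_derivative v) (at 0)"
      using \<epsilon> by (intro exI[of _ \<gamma>] exI[of _ ?\<epsilon>] conjI)
  qed
next
  note c' = is_chart_top_of_setD[OF c]
  assume S: "smooth_submersion_on {p \<in> M. J p \<in> U} (\<phi> \<circ> J)"
  have sm: "smooth_on U \<phi>"
  proof (rule smooth_on_local)
    fix q assume "q \<in> U"
    then obtain p where p: "p \<in> M" "q = J p" using c'(2) JM by blast
    obtain W \<sigma> where W: "openin (top_of_set N) W" "J p \<in> W" "smooth_on W \<sigma>" "\<sigma> ` W \<subseteq> M"
      "\<And>q. q \<in> W \<Longrightarrow> J (\<sigma> q) = q" "\<sigma> (J p) = p"
      using sec[OF p(1)] by blast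
    have op: "openin (top_of_set U) (U \<inter> W)"
      by (rule openin_Int_subset_trans(1)[OF c'(1) W(1)])
    have "smooth_on (U \<inter> W) (\<lambda>q. (\<phi> \<circ> J) (\<sigma> q))"
      by (rule smooth_on_compose[OF smooth_on_subset[OF W(3)] S[unfolded smooth_submersion_on_def, THEN conjunct1]])
        (use W(4,5) in auto)
    then have "smooth_on (U \<inter> W) \<phi>" by (rule smooth_on_cong) (use W(5) in auto)
    then show "\<exists>W. openin (top_of_set U) W \<and> q \<in> W \<and> smooth_on W \<phi>"
      using op p(2) \<open>q \<in> U\<close> W(2) by blast
  qed
  have curves: "\<exists>\<gamma> \<epsilon>. \<epsilon> > 0 \<and> smooth_on {-\<epsilon><..<\<epsilon>} \<gamma> \<and> \<gamma> ` {-\<epsilon><..<\<epsilon>} \<subseteq> U \<and>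
        \<gamma> (0::real) = r \<and> ((\<phi> \<circ> \<gamma>) has_vector_derivative v) (at 0)" if "r \<in> U" for r v
  proof -
    obtain p where p: "p \<in> M" "r = J p" using c'(2) JM \<open>r \<in> U\<close> by blast
    then have "p \<in> {p \<in> M. J p \<in> U}" using \<open>r \<in> U\<close> by simp
    then obtain \<gamma> and \<epsilon> :: real where g: "\<epsilon> > 0" "smooth_on {-\<epsilon><..<\<epsilon>} \<gamma>"
      "\<gamma> ` {-\<epsilon><..<\<epsilon>} \<subseteq> {p \<in> M. J p \<in> U}" "\<gamma> 0 = p" "((\<phi> \<circ> J \<circ> \<gamma>) has_vector_derivative v) (at 0)"
      using S[unfolded smooth_submersion_on_def, THEN conjunct2, rule_format, of p v] by blast
    have gM: "\<gamma> t \<in> M" "J (\<gamma> t) \<in> U" if "t \<in> {-\<epsilon><..<\<epsilon>}" for t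
      using subsetD[OF g(3) imageI[OF that]] by auto
    have "smooth_on {-\<epsilon><..<\<epsilon>} (\<lambda>t. J (\<gamma> t))"
      by (rule smooth_on_compose[OF g(2) smJ]) (rule gM(1))
    then show ?thesis
      using g(1,4,5) gM(2) p(2) by (intro exI[of _ "\<lambda>t. J (\<gamma> t)"] exI[of _ \<epsilon>] conjI) (auto simp: o_def)
  qed
  show "smooth_diffeo_onto_open U \<phi>"
  proof (rule smooth_diffeo_onto_open_local[OF c])
    fix q assume q: "q \<in> U"
    obtain W and \<xi> :: "'b \<Rightarrow> real^'m" where W: "openin (top_of_set N) W" "q \<in> W" "smooth_diffeo_onto_open W \<xi>"
      using ch[of q] q c'(2) by blast
    have "smooth_diffeo_onto_open (U \<inter> W) \<phi>"
      by (rule smooth_inverse_of_surjective_differential[OF c sm q W curves])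
    then show "\<exists>T. openin (top_of_set N) T \<and> q \<in> T \<and> smooth_diffeo_onto_open (U \<inter> T) \<phi>"
      using W(1,2) by (intro exI[of _ W] conjI)
  qed
qed

subsection \<open>Charts of spheres\<close>

text \<open>The chart is the orthogonal projection of the open hemisphere around z0 to the
  hyperplane orthogonal to z0, followed by a linear isometry to R^m. Its inverse restores the height
  sqrt(1 - |v|^2), which is smooth on the open ball.\<close>

lemma sphere_chart:
  fixes z0 :: "'a::euclidean_space"
  assumes z0: "norm z0 = 1" and dim: "DIM('a) = Suc CARD('m::finite)"
  obtains W \<xi> where "openin (top_of_set (sphere 0 1)) W" "z0 \<in> W"
    "smooth_diffeo_onto_open W (\<xi> :: 'a \<Rightarrow> real^'m)"
proof -
  have zz: "z0 \<bullet> z0 = 1" using z0 by (simp add: dot_square_norm)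
  let ?H = "{v. z0 \<bullet> v = 0}"
  have "z0 \<noteq> 0" using z0 by auto
  then have dimH: "dim ?H = dim (UNIV :: (real^'m) set)"
    using dim_hyperplane[of z0] dim by simp
  obtain f and g :: "real^'m \<Rightarrow> 'a" where fg: "linear f" "linear g" "f ` ?H = UNIV" "g ` UNIV = ?H"
    "\<And>x. x \<in> ?H \<Longrightarrow> norm (f x) = norm x" "\<And>x. x \<in> UNIV \<Longrightarrow> norm (g x) = norm x"
    "\<And>x. x \<in> ?H \<Longrightarrow> g (f x) = x" "\<And>x. x \<in> UNIV \<Longrightarrow> f (g x) = x"
  proof (rule isometries_subspaces[OF subspace_hyperplane[of z0] subspace_UNIV dimH], goal_cases)
    case (1 f g)
    show ?case by (rule 1(1)[of f g]) (fact 1)+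
  qed
  have bl: "bounded_linear f" "bounded_linear g" using fg(1,2) by (auto simp: linear_conv_bounded_linear)
  have gH: "z0 \<bullet> g v = 0" for v using fg(4) by blast
  define \<xi> where "\<xi> z = f (z - (z0 \<bullet> z) *\<^sub>R z0)" for z
  define \<zeta> where "\<zeta> v = g v + sqrt (1 - v \<bullet> v) *\<^sub>R z0" for v
  let ?W = "sphere 0 1 \<inter> {z. 0 < z0 \<bullet> z}"
  have H: "z - (z0 \<bullet> z) *\<^sub>R z0 \<in> ?H" for z by (simp add: inner_diff_right zz)
  have n\<xi>: "\<xi> z \<bullet> \<xi> z = z \<bullet> z - (z0 \<bullet> z)\<^sup>2" for z
  proof -
    have "\<xi> z \<bullet> \<xi> z = (z - (z0 \<bullet> z) *\<^sub>R z0) \<bullet> (z - (z0 \<bullet> z) *\<^sub>R z0)"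
      unfolding \<xi>_def dot_square_norm fg(5)[OF H] ..
    also have "\<dots> = z \<bullet> z - (z0 \<bullet> z)\<^sup>2"
      by (simp add: inner_diff_left inner_diff_right zz inner_commute power2_eq_square)
    finally show ?thesis .
  qed
  have \<zeta>\<xi>: "\<zeta> (\<xi> z) = z" if "z \<in> ?W" for z
  proof -
    have "z \<bullet> z = 1" using that by (simp add: dot_square_norm)
    then have "sqrt (1 - \<xi> z \<bullet> \<xi> z) = z0 \<bullet> z" using that by (simp add: n\<xi>)
    then show ?thesis using fg(7)[OF H, of z] by (simp add: \<zeta>_def \<xi>_def)
  qed
  have \<xi>\<zeta>: "\<xi> (\<zeta> v) = v" for v
    using fg(8) by (simp add: \<xi>_def \<zeta>_def inner_add_right gH zz)
  have im: "\<xi> ` ?W = ball 0 1"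
  proof
    show "\<xi> ` ?W \<subseteq> ball 0 1"
    proof clarify
      fix z assume "z \<in> sphere 0 1" "0 < z0 \<bullet> z"
      then have "z \<bullet> z = 1" "0 < (z0 \<bullet> z)\<^sup>2" by (simp_all add: norm_eq_1)
      then have "\<xi> z \<bullet> \<xi> z < 1" unfolding n\<xi> by simp
      then show "\<xi> z \<in> ball 0 1" by (simp add: dot_square_norm abs_square_less_1)
    qed
    show "ball 0 1 \<subseteq> \<xi> ` ?W"
    proof
      fix v :: "real^'m" assume v: "v \<in> ball 0 1"
      then have "v \<bullet> v < 1" by (simp add: dot_square_norm abs_square_less_1)
      moreover have "\<zeta> v \<bullet> \<zeta> v = 1"
      proof -
        have "g v \<bullet> g v = v \<bullet> v" using fg(6)[of v] by (simp add: dot_square_norm)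
        then show ?thesis using \<open>v \<bullet> v < 1\<close> gH
          by (simp add: \<zeta>_def inner_add_left inner_add_right zz inner_commute)
      qed
      ultimately have "\<zeta> v \<in> ?W"
        by (simp add: norm_eq_1) (simp add: \<zeta>_def inner_add_right gH zz)
      then show "v \<in> \<xi> ` ?W" using \<xi>\<zeta> by (metis imageI)
    qed
  qed
  have "smooth_diffeo_onto_open ?W \<xi>"
  proof (rule smooth_diffeo_onto_openI[where g = \<zeta>])
    show "smooth_on ?W \<xi>"
      unfolding \<xi>_def by (intro smooth_on_bounded_linear_comp[OF bl(1)] smooth_intros)
    show "open (\<xi> ` ?W)" unfolding im by simp
    have "0 < 1 - v \<bullet> v" if "v \<in> ball 0 1" for v :: "real^'m"
      using that by (simp add: dot_square_norm abs_square_less_1)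
    then show "smooth_on (\<xi> ` ?W) \<zeta>"
      unfolding im \<zeta>_def by (intro smooth_intros smooth_on_bounded_linear[OF bl(2)]) auto
  qed (rule \<zeta>\<xi>)
  moreover have "openin (top_of_set (sphere 0 1)) ?W"
    by (rule openin_open_Int) (rule open_halfspace_gt[of 0 z0, simplified])
  moreover have "z0 \<in> ?W" using z0 zz by simp
  ultimately show ?thesis using that by blast
qed

section \<open>Linear algebra\<close>

declare transpose_matrix_vector [simp del]

lemma sum_UNIV_option: "(\<Sum>i\<in>(UNIV :: 'n::finite option set). f i) = f None + (\<Sum>k\<in>UNIV. f (Some k))"
  by (simp add: UNIV_option_conv sum.reindex)

definition proj :: "real^('n::finite option) \<Rightarrow> real^'n" where
  "proj v = (\<chi> j. v $ Some j)"

lemma incl_nth [simp]: "incl v $ None = 0" "incl v $ Some j = v $ j"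
  by (simp_all add: incl_def)

lemma e0_nth [simp]: "e0 $ None = 1" "e0 $ Some j = 0"
  by (simp_all add: e0_def axis_def)

lemma inner_option: "u \<bullet> v = u $ None * v $ None + proj u \<bullet> proj v" for u v :: "real^('n::finite option)"
  by (simp add: inner_vec_def sum_UNIV_option proj_def)

lemma proj_incl [simp]: "proj (incl v) = v"
  by (simp add: proj_def vec_eq_iff)

lemma proj_e0 [simp]: "proj e0 = 0"
  by (simp add: proj_def vec_eq_iff)

lemma option_vec_eqI: "u $ None = v $ None \<Longrightarrow> proj u = proj v \<Longrightarrow> u = v"
  unfolding vec_eq_iff by (metis option.exhaust proj_def vec_lambda_beta)

lemma inner_e0_incl [simp]:
  "e0 \<bullet> (e0 :: real^('n::finite option)) = 1" "e0 \<bullet> incl v = 0" "incl v \<bullet> e0 = 0" "incl u \<bullet> incl v = u \<bullet> v"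
  by (simp_all add: inner_option)

lemma inner_e0: "v \<bullet> e0 = v $ None" "e0 \<bullet> v = v $ None"
  by (simp_all add: inner_option)

lemma linear_incl: "linear incl"
  by (rule linearI) (rule option_vec_eqI; simp add: proj_def vec_eq_iff)+

lemma linear_proj: "linear proj"
  by (rule linearI) (simp_all add: proj_def vec_eq_iff)

lemma smooth_on_incl [smooth_intros]: "smooth_on S f \<Longrightarrow> smooth_on S (\<lambda>x. incl (f x))"
  using smooth_on_bounded_linear_comp linear_incl linear_conv_bounded_linear by blast

lemma smooth_on_proj [smooth_intros]: "smooth_on S f \<Longrightarrow> smooth_on S (\<lambda>x. proj (f x))"
  using smooth_on_bounded_linear_comp linear_proj linear_conv_bounded_linear by blast

lemma inner_matrix_vector_left: "(A *v x) \<bullet> y = x \<bullet> (transpose A *v y)" for A :: "real^'n::finite^'m::finite"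
  by (metis dot_lmul_matrix inner_commute transpose_matrix_vector transpose_transpose)

section \<open>Orthogonal and block diagonal matrices\<close>

lemma orthogonal_matrixD:
  fixes A :: "real^'n::finite^'n"
  assumes "orthogonal_matrix A"
  shows "transpose A ** A = mat 1" "A ** transpose A = mat 1"
    "transpose A *v (A *v x) = x" "A *v (transpose A *v x) = x"
  using assms by (auto simp: orthogonal_matrix_def matrix_vector_mul_assoc)

lemma orthogonal_matrix_inner [simp]:
  fixes A :: "real^'n::finite^'n"
  assumes "orthogonal_matrix A"
  shows "(A *v x) \<bullet> (A *v y) = x \<bullet> y"
  by (simp add: inner_matrix_vector_left orthogonal_matrixD[OF assms])

lemma orthogonal_matrix_norm [simp]:
  fixes A :: "real^'n::finite^'n"
  assumes "orthogonal_matrix A"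
  shows "norm (A *v x) = norm x"
  by (simp add: norm_eq_sqrt_inner assms)

lemma orthogonal_matrix_transpose_iff [simp]:
  "orthogonal_matrix (transpose A) \<longleftrightarrow> orthogonal_matrix A" for A :: "real^'n::finite^'n"
  by (auto simp: orthogonal_matrix_def)

lemma column_None: "column None Q = Q *v e0" for Q :: "real^('n::finite option)^'m::finite"
  by (simp add: vec_eq_iff column_def matrix_vector_mult_def sum_UNIV_option)

lemma block_diag_nth [simp]:
  "block_diag g $ None $ None = 1" "block_diag g $ None $ Some l = 0"
  "block_diag g $ Some k $ None = 0" "block_diag g $ Some k $ Some l = g $ k $ l"
  by (simp_all add: block_diag_def)

lemma option_matrix_eqI:
  fixes A B :: "real^('n::finite option)^('n option)"
  assumes "A $ None $ None = B $ None $ None" "\<And>l. A $ None $ Some l = B $ None $ Some l"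
    "\<And>k. A $ Some k $ None = B $ Some k $ None" "\<And>k l. A $ Some k $ Some l = B $ Some k $ Some l"
  shows "A = B"
  unfolding vec_eq_iff using assms by (metis option.exhaust)

lemma block_diag_mult: "block_diag (g ** h) = block_diag g ** block_diag h"
  by (rule option_matrix_eqI) (simp_all add: matrix_matrix_mult_def sum_UNIV_option)

lemma block_diag_mat_1 [simp]: "block_diag (mat 1) = mat 1"
  by (rule option_matrix_eqI) (simp_all add: mat_def)

lemma block_diag_transpose: "block_diag (transpose g) = transpose (block_diag g)"
  by (rule option_matrix_eqI) (simp_all add: transpose_def)

lemma block_diag_inject: "block_diag g = block_diag h \<longleftrightarrow> g = h"
  by (metis block_diag_nth(4) vec_eq_iff)

lemma block_diag_incl [simp]: "block_diag g *v incl v = incl (g *v v)"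
  by (rule option_vec_eqI) (simp_all add: proj_def vec_eq_iff matrix_vector_mult_def sum_UNIV_option)

lemma block_diag_e0 [simp]: "block_diag g *v e0 = e0"
  by (rule option_vec_eqI) (simp_all add: proj_def vec_eq_iff matrix_vector_mult_def sum_UNIV_option)

lemma orthogonal_block_diag [simp]: "orthogonal_matrix (block_diag g) \<longleftrightarrow> orthogonal_matrix g"
  by (simp add: orthogonal_matrix_def block_diag_transpose[symmetric] block_diag_mult[symmetric]
      block_diag_inject[of _ "mat 1", simplified])

text \<open>An orthogonal matrix that fixes e0 has a transpose that fixes it too, so both the first
  column and the first row are those of the identity.\<close>

lemma orthogonal_fixing_e0:
  fixes H :: "real^('n::finite option)^('n option)"
  assumes "orthogonal_matrix H" "H *v e0 = e0"
  obtains g where "orthogonal_matrix g" "H = block_diag g"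
proof -
  have t: "transpose H *v e0 = e0"
    using orthogonal_matrixD(3)[OF assms(1), of e0] assms(2) by simp
  have c: "H $ i $ None = e0 $ i" for i
    using column_None[of H] assms(2) by (simp add: column_def vec_eq_iff)
  have r: "H $ None $ i = e0 $ i" for i
    using column_None[of "transpose H"] t by (simp add: column_def transpose_def vec_eq_iff)
  have "H = block_diag (\<chi> k l. H $ Some k $ Some l)"
    by (rule option_matrix_eqI) (simp_all add: c r)
  then show ?thesis using that assms(1) by (metis orthogonal_block_diag)
qed

text \<open>The rows of an orthogonal matrix are unit vectors, which bounds the group; the defining
  equations are closed conditions.\<close>

lemma compact_orthogonal_group: "compact (orthogonal_group :: (real^'n::finite^'n) set)"
proof -
  have "norm Q \<le> sqrt (CARD('n))" if "Q \<in> orthogonal_group" for Q :: "real^'n^'n"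
  proof -
    have "Q $ i \<bullet> Q $ i = 1" for i
    proof -
      have "(Q ** transpose Q) $ i $ i = 1"
        using that by (simp add: orthogonal_group_def orthogonal_matrixD mat_def)
      then show ?thesis by (simp add: matrix_matrix_mult_def transpose_def inner_vec_def)
    qed
    then have "Q \<bullet> Q = CARD('n)" by (simp add: inner_vec_def[of Q])
    then show ?thesis by (simp add: norm_eq_sqrt_inner)
  qed
  then have "bounded (orthogonal_group :: (real^'n^'n) set)" by (auto simp: bounded_iff)
  moreover have "closed (orthogonal_group :: (real^'n^'n) set)"
  proof -
    have "smooth_on UNIV (\<lambda>A::real^'n^'n. transpose A ** A)" "smooth_on UNIV (\<lambda>A::real^'n^'n. A ** transpose A)"
      by (intro smooth_intros)+
    from this[THEN smooth_on_imp_continuous_on]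
    have "closed {A::real^'n^'n. transpose A ** A = mat 1 \<and> A ** transpose A = mat 1}"
      by (intro closed_Collect_conj closed_Collect_eq continuous_on_const) auto
    then show ?thesis by (simp add: orthogonal_group_def orthogonal_matrix_def)
  qed
  ultimately show ?thesis by (simp add: compact_eq_bounded_closed)
qed

subsection \<open>Reflections\<close>

text \<open>The reflection in the hyperplane orthogonal to w. For w = 0 the quotient has the value 0
  and the matrix is the identity, so it is an involution for every w.\<close>

definition refl_matrix :: "real^'k::finite \<Rightarrow> real^'k^'k" where
  "refl_matrix w = (\<chi> i j. (if i = j then 1 else 0) - 2 * (w $ i * w $ j) / (w \<bullet> w))"

lemma refl_matrix_mult: "refl_matrix w *v v = v - (2 * (w \<bullet> v) / (w \<bullet> w)) *\<^sub>R w"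
proof -
  have "(refl_matrix w *v v) $ i = (v - (2 * (w \<bullet> v) / (w \<bullet> w)) *\<^sub>R w) $ i" for i
  proof -
    have "(\<Sum>j\<in>UNIV. ((if i = j then 1 else 0) - 2 * (w $ i * w $ j) / (w \<bullet> w)) * v $ j) =
      (\<Sum>j\<in>UNIV. (if i = j then v $ j else 0) - (2 * w $ i / (w \<bullet> w)) * (w $ j * v $ j))"
      by (rule sum.cong) (auto simp: left_diff_distrib)
    also have "\<dots> = v $ i - (\<Sum>j\<in>UNIV. (2 * w $ i / (w \<bullet> w)) * (w $ j * v $ j))"
      by (simp add: sum_subtractf)
    also have "\<dots> = v $ i - (2 * w $ i / (w \<bullet> w)) * (w \<bullet> v)"
      by (simp only: sum_distrib_left[symmetric]) (simp add: inner_vec_def[of w v])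
    finally show ?thesis by (simp add: matrix_vector_mult_def refl_matrix_def)
  qed
  then show ?thesis by (simp add: vec_eq_iff)
qed

lemma transpose_refl_matrix [simp]: "transpose (refl_matrix w) = refl_matrix w"
  by (auto simp: transpose_def refl_matrix_def vec_eq_iff)

lemma refl_matrix_involution: "refl_matrix w ** refl_matrix w = mat 1"
proof -
  have "refl_matrix w *v (refl_matrix w *v v) = v" for v
  proof (cases "w = 0")
    case False
    define c where "c = 2 * (w \<bullet> v) / (w \<bullet> w)"
    have "2 * (w \<bullet> (v - c *\<^sub>R w)) / (w \<bullet> w) = - c"
      using False by (simp add: inner_diff_right c_def diff_divide_distrib)
    then show ?thesis unfolding refl_matrix_mult c_def[symmetric] by simp
  qed (simp add: refl_matrix_mult)
  then show ?thesis by (simp add: matrix_eq matrix_vector_mul_assoc[symmetric])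
qed

text \<open>\<open>frame_plus\<close> and \<open>frame_minus\<close> are local sections of \<open>O(n+1) \<rightarrow> S\<^sup>n\<close> off \<open>- e\<^sub>0\<close> and off
  \<open>e\<^sub>0\<close>. That their values are symmetric makes \<open>Q\<^sup>T = Q\<close> along the slices.\<close>

definition frame_at :: "real^('n::finite option)^('n option) \<Rightarrow> real^('n option) \<Rightarrow> bool" where
  "frame_at R a \<longleftrightarrow> transpose R = R \<and> R ** R = mat 1 \<and> R *v e0 = a"

definition frame_plus :: "real^('n::finite option) \<Rightarrow> real^('n option)^('n option)" where
  "frame_plus a = - refl_matrix (e0 + a)"

definition frame_minus :: "real^('n::finite option) \<Rightarrow> real^('n option)^('n option)" where
  "frame_minus a = refl_matrix (e0 - a)"

lemma frame_atD:
  assumes "frame_at R a"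
  shows "orthogonal_matrix R" "transpose R = R" "R *v e0 = a" "R *v a = e0" "R *v (R *v v) = v"
  using assms by (auto simp: frame_at_def orthogonal_matrix_def matrix_vector_mul_assoc)

lemma frame_plus_mult:
  fixes a :: "real^('n::finite option)"
  shows "frame_plus a *v v = (2 * ((e0 + a) \<bullet> v) / ((e0 + a) \<bullet> (e0 + a))) *\<^sub>R (e0 + a) - v"
proof -
  have "(- A) *v v = - (A *v v)" for A :: "real^('n option)^('n option)"
    by (simp add: vec_eq_iff matrix_vector_mult_def sum_negf)
  then show ?thesis unfolding frame_plus_def by (simp add: refl_matrix_mult)
qed

lemma frame_minus_mult:
  "frame_minus a *v v = v - (2 * ((e0 - a) \<bullet> v) / ((e0 - a) \<bullet> (e0 - a))) *\<^sub>R (e0 - a)"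
  unfolding frame_minus_def by (simp add: refl_matrix_mult)

text \<open>The matrix fixes the line through e0 + a and negates its orthogonal complement. This
  line bisects the unit vectors e0 and a, so they are exchanged; it degenerates exactly at a = -
  e0.\<close>

lemma frame_at_plus:
  assumes "norm a = 1" "a \<noteq> - e0"
  shows "frame_at (frame_plus a) a"
proof -
  have aa: "a \<bullet> a = 1" using assms by (simp add: dot_square_norm)
  have "e0 + a \<noteq> 0" using assms(2) by (metis add_eq_0_iff)
  then have "(e0 + a) \<bullet> (e0 + a) \<noteq> 0" by simp
  moreover have eq: "(e0 + a) \<bullet> (e0 + a) = 2 * ((e0 + a) \<bullet> e0)"
    by (simp add: inner_add_left inner_add_right aa inner_commute)
  ultimately have "frame_plus a *v e0 = a"
    unfolding frame_plus_mult eq by simp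
  moreover have "transpose (frame_plus a) = frame_plus a"
    using transpose_refl_matrix[of "e0 + a"] by (simp add: frame_plus_def transpose_def vec_eq_iff)
  moreover have "frame_plus a ** frame_plus a = refl_matrix (e0 + a) ** refl_matrix (e0 + a)"
    by (simp add: frame_plus_def matrix_matrix_mult_def vec_eq_iff)
  ultimately show ?thesis by (simp add: frame_at_def refl_matrix_involution)
qed

text \<open>The hyperplane orthogonal to e0 - a is the mirror that exchanges the unit vectors e0 and
  a; it degenerates exactly at a = e0.\<close>

lemma frame_at_minus:
  assumes "norm a = 1" "a \<noteq> e0"
  shows "frame_at (frame_minus a) a"
proof -
  have aa: "a \<bullet> a = 1" using assms by (simp add: dot_square_norm)
  have "e0 - a \<noteq> 0" using assms(2) by auto
  then have "(e0 - a) \<bullet> (e0 - a) \<noteq> 0" by simp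
  moreover have eq: "(e0 - a) \<bullet> (e0 - a) = 2 * ((e0 - a) \<bullet> e0)"
    by (simp add: inner_diff_left inner_diff_right aa inner_commute)
  ultimately have "frame_minus a *v e0 = a"
    unfolding frame_minus_mult eq by simp
  then show ?thesis by (simp add: frame_at_def refl_matrix_involution frame_minus_def)
qed

lemma smooth_on_refl_matrix [smooth_intros]:
  assumes "smooth_on S f" "\<And>x. x \<in> S \<Longrightarrow> f x \<noteq> 0"
  shows "smooth_on S (\<lambda>x. refl_matrix (f x))"
  unfolding refl_matrix_def using assms by (intro smooth_intros) auto

lemma smooth_on_frame_plus: "smooth_on (sphere 0 1 - {- e0}) frame_plus"
  unfolding frame_plus_def by (intro smooth_intros) (auto simp: add_eq_0_iff)

lemma smooth_on_frame_minus: "smooth_on (sphere 0 1 - {e0}) frame_minus"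
  unfolding frame_minus_def by (intro smooth_intros) auto

lemma unit_eq_e0_iff:
  fixes a :: "real^('n::finite option)"
  assumes "norm a = 1"
  shows "a = e0 \<longleftrightarrow> a $ None = 1" "a = - e0 \<longleftrightarrow> a $ None = -1"
proof -
  have *: "a $ None * a $ None + proj a \<bullet> proj a = 1"
    using assms by (metis inner_option norm_eq_1)
  have "a = e0" if "a $ None = 1"
    using * that by (intro option_vec_eqI) auto
  then show "a = e0 \<longleftrightarrow> a $ None = 1" by auto
  have "proj (- e0) = 0" by (simp add: proj_def vec_eq_iff)
  then have "a = - e0" if "a $ None = -1"
    using * that by (intro option_vec_eqI) auto
  then show "a = - e0 \<longleftrightarrow> a $ None = -1" by auto
qed

subsection \<open>The map \<open>\<tau>\<close>\<close>

lemma tau_tau: "norm x = 1 \<Longrightarrow> tau x (tau x v) = v"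
  by (simp add: tau_def inner_diff_right norm_eq_1 algebra_simps)

lemma tau_inner: "norm x = 1 \<Longrightarrow> tau x u \<bullet> tau x v = u \<bullet> v"
  by (simp add: tau_def inner_diff_right inner_diff_left norm_eq_1 inner_commute algebra_simps)

lemma tau_norm: "norm x = 1 \<Longrightarrow> norm (tau x v) = norm v"
  by (simp add: norm_eq_sqrt_inner tau_inner norm_eq_1)

lemma tau_self [simp]: "norm x = 1 \<Longrightarrow> tau x x = x"
  by (simp add: tau_def norm_eq_1 scaleR_2)

lemma tau_zero [simp]: "tau x 0 = 0"
  by (simp add: tau_def)

lemma tau_scaleR [simp]: "tau x (c *\<^sub>R v) = c *\<^sub>R tau x v"
  by (simp add: tau_def algebra_simps)

lemma tau_sgn_norm: "y \<noteq> 0 \<Longrightarrow> norm (tau (sgn y) v) = norm v"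
  by (simp add: tau_norm norm_sgn)

lemma tau_orthogonal:
  fixes g :: "real^'n::finite^'n"
  assumes "orthogonal_matrix g"
  shows "tau (g *v x) (g *v v) = g *v tau x v"
  by (simp add: tau_def assms matrix_vector_mult_diff_distrib matrix_vector_mult_scaleR)

text \<open>The conjugation rule tau(g y) = g tau(y) g^{-1} for g = tau(x), which is its own
  inverse. It solves the gluing equation and locates f on the second piece.\<close>

lemma tau_tau_conj:
  fixes x y :: "real^'n::finite"
  assumes "norm x = 1"
  shows "tau (tau x y) v = tau x (tau y (tau x v))"
proof -
  have xx: "x \<bullet> x = 1" using assms by (simp add: norm_eq_1)
  have 1: "tau x y \<bullet> v = y \<bullet> tau x v"
    by (simp add: tau_def inner_diff_left inner_diff_right inner_commute)
  have 2: "tau x (u - w) = tau x u - tau x w" for u w :: "real^'n"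
    by (simp add: tau_def inner_diff_right algebra_simps)
  show ?thesis
    unfolding tau_def[of "tau x y"] tau_def[of y] 1 2 tau_scaleR tau_tau[OF assms] by simp
qed

lemma smooth_on_tau [smooth_intros]:
  assumes "smooth_on S f" "smooth_on S g"
  shows "smooth_on S (\<lambda>x. tau (f x) (g x))"
  unfolding tau_def using assms by (intro smooth_intros) auto

section \<open>The map \<open>f\<close>\<close>

lemma norm_Pair_eq_1: "norm (x, y) = 1 \<longleftrightarrow> (norm x)\<^sup>2 + (norm y)\<^sup>2 = 1"
  by (simp add: norm_Pair)

lemma norm_le_1_of_Pair: "norm (x, y) = 1 \<Longrightarrow> norm x \<le> 1 \<and> norm y \<le> 1"
  by (metis norm_fst_le norm_snd_le fst_conv snd_conv)

text \<open>The exceptional value at y = 0 is included: there |x| = 1, so the cosine is -1 and the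
  sine removes the undefined direction.\<close>

lemma f_map_polar:
  fixes x y :: "real^'n::finite"
  assumes "norm (x, y) = 1"
  shows "f_map (x, y) = cos (pi * norm x) *\<^sub>R e0 + sin (pi * norm x) *\<^sub>R incl (sgn (tau (sgn y) x))"
proof (cases "y = 0")
  case True
  then have "norm x = 1" using assms by (simp add: norm_Pair)
  then show ?thesis using True by (simp add: f_map_def)
next
  case False
  have "sgn (pi *\<^sub>R v) = sgn v" for v :: "real^'n" by (simp add: sgn_scaleR)
  then show ?thesis using False by (simp add: f_map_def exp_e0_def tau_sgn_norm)
qed

lemma f_map_None:
  assumes "norm (x, y) = 1"
  shows "f_map (x, y) $ None = cos (pi * norm x)"
  by (simp add: f_map_polar[OF assms])

lemma norm_f_map:
  fixes x y :: "real^'n::finite"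
  assumes "norm (x, y) = 1"
  shows "norm (f_map (x, y)) = 1"
proof -
  have "f_map (x, y) \<bullet> f_map (x, y) = 1"
  \<comment> \<open>In this case the sine vanishes, so the direction, which need not be a unit
    vector here, does not enter.\<close>
  proof (cases "x = 0 \<or> y = 0")
    case True
    then have "x = 0 \<or> norm x = 1"
      using assms norm_ge_zero[of x] by (auto simp: norm_Pair_eq_1 power2_eq_1_iff simp del: norm_ge_zero)
    then have "sin (pi * norm x) = 0" "\<bar>cos (pi * norm x)\<bar> = 1" by auto
    then show ?thesis unfolding f_map_polar[OF assms] by (auto simp: abs_if split: if_splits)
  next
    case False
    then have "tau (sgn y) x \<noteq> 0" using tau_sgn_norm[of y x] by auto
    then have "sgn (tau (sgn y) x) \<bullet> sgn (tau (sgn y) x) = 1"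
      by (metis norm_eq_1 norm_sgn)
    then show ?thesis unfolding f_map_polar[OF assms]
      by (simp add: inner_add_left inner_add_right power2_eq_square[symmetric])
  qed
  then show ?thesis by (simp add: norm_eq_1)
qed

text \<open>The cosine is injective on [0, pi], which contains pi |x|. Hence the poles of S^n, where
  one of the frames breaks down, are reached only along x = 0 and y = 0.\<close>

lemma f_map_eq_e0_iff:
  fixes x y :: "real^'n::finite"
  assumes "norm (x, y) = 1"
  shows "f_map (x, y) = e0 \<longleftrightarrow> x = 0" "f_map (x, y) = - e0 \<longleftrightarrow> y = 0"
proof -
  have r: "0 \<le> pi * norm x" "pi * norm x \<le> pi"
    using norm_le_1_of_Pair[OF assms] by auto
  have "cos (pi * norm x) = 1 \<longleftrightarrow> pi * norm x = 0"
    using cos_inj_pi[OF r, of 0] by auto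
  then show "f_map (x, y) = e0 \<longleftrightarrow> x = 0"
    using unit_eq_e0_iff(1)[OF norm_f_map[OF assms]] by (simp add: f_map_None[OF assms])
  have "cos (pi * norm x) = -1 \<longleftrightarrow> pi * norm x = pi"
    using cos_inj_pi[OF r, of pi] by auto
  moreover have "norm x = 1 \<longleftrightarrow> y = 0"
  proof
    assume "norm x = 1" then show "y = 0" using assms by (simp add: norm_Pair_eq_1)
  next
    assume "y = 0" then show "norm x = 1" using assms by (simp add: norm_Pair)
  qed
  ultimately show "f_map (x, y) = - e0 \<longleftrightarrow> y = 0"
    using unit_eq_e0_iff(2)[OF norm_f_map[OF assms]] by (simp add: f_map_None[OF assms])
qed

lemma f_map_equivariant:
  fixes g :: "real^'n::finite^'n"
  assumes g: "orthogonal_matrix g"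
  shows "f_map (g *v x, g *v y) = block_diag g *v f_map (x, y)"
proof -
  have s: "sgn (g *v v) = g *v sgn v" for v
    by (simp add: sgn_div_norm g matrix_vector_mult_scaleR)
  have e: "exp_e0 (g *v w) = block_diag g *v exp_e0 w" for w
    by (simp add: exp_e0_def g s matrix_vector_right_distrib matrix_vector_mult_scaleR)
  have "g *v y = 0 \<longleftrightarrow> y = 0" using orthogonal_matrix_norm[OF g, of y] by (metis norm_eq_zero)
  moreover have "block_diag g *v (- e0) = - e0"
    using matrix_vector_mult_scaleR[of "block_diag g" "-1" e0] by simp
  ultimately show ?thesis
    unfolding f_map_def split_conv s tau_orthogonal[OF g] using e[of "pi *\<^sub>R tau (sgn y) x"]
    by (simp add: matrix_vector_mult_scaleR)
qed

text \<open>The apparent singularity at x = 0 is removed by sin(pi |x|) / |x| = pi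
  \<open>sincr\<close> (pi^2 |x|^2), where the right side depends smoothly on the squared
  norm.\<close>

lemma smooth_on_f_map_right:
  "smooth_on {z \<in> \<S>. snd z \<noteq> 0} (f_map :: (real^'n::finite) \<times> (real^'n) \<Rightarrow> _)"
proof (rule smooth_on_cong)
  let ?F = "\<lambda>z::(real^'n) \<times> (real^'n). cosr (pi * pi * (fst z \<bullet> fst z)) *\<^sub>R e0 +
    incl ((pi * sincr (pi * pi * (fst z \<bullet> fst z))) *\<^sub>R tau (sgn (snd z)) (fst z))"
  show "smooth_on {z \<in> \<S>. snd z \<noteq> 0} ?F"
    by (intro smooth_intros) auto
  fix z :: "(real^'n) \<times> (real^'n)" assume z: "z \<in> {z \<in> \<S>. snd z \<noteq> 0}"
  obtain x y where xy: "z = (x, y)" by (cases z)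
  have n: "norm (x, y) = 1" "y \<noteq> 0" using z xy by auto
  have p: "pi * pi * (x \<bullet> x) = (pi * norm x)\<^sup>2" by (simp add: power2_eq_square dot_square_norm algebra_simps)
  have "sin (pi * norm x) *\<^sub>R sgn (tau (sgn y) x) = (pi * sincr ((pi * norm x)\<^sup>2)) *\<^sub>R tau (sgn y) x"
  proof (cases "x = 0")
    case False
    then have "(sin (pi * norm x) / norm x) = pi * sincr ((pi * norm x)\<^sup>2)"
      by (simp add: sincr_power2[symmetric])
    moreover have "sgn (tau (sgn y) x) = tau (sgn y) x /\<^sub>R norm x"
      by (simp only: sgn_div_norm[of "tau (sgn y) x"] tau_sgn_norm[OF n(2)])
    ultimately show ?thesis by (simp add: divide_inverse)
  qed simp
  then show "f_map z = ?F z"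
    unfolding xy fst_conv snd_conv p cosr_power2 f_map_polar[OF n(1)]
    by (simp add: linear_scale[OF linear_incl, symmetric])
qed

text \<open>Near y = 0 the angle is measured from the other pole. From |y|^2 = (1 + |x|)(1 - |x|)
  one gets pi - pi |x| = |y|^2 pi / (1 + |x|), which explains \<open>?u\<close>; the sine of this
  angle has a factor |y|^2 that compensates the singular direction y / |y| in tau.\<close>

lemma smooth_on_f_map_left:
  "smooth_on {z \<in> \<S>. fst z \<noteq> 0} (f_map :: (real^'n::finite) \<times> (real^'n) \<Rightarrow> _)"
proof (rule smooth_on_cong)
  let ?u = "\<lambda>z::(real^'n) \<times> (real^'n). pi / (1 + norm (fst z))"
  let ?F = "\<lambda>z::(real^'n) \<times> (real^'n). cosr (pi * pi * (fst z \<bullet> fst z)) *\<^sub>R e0 +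
    incl ((?u z * sincr ((?u z * (snd z \<bullet> snd z)) * (?u z * (snd z \<bullet> snd z))) / norm (fst z)) *\<^sub>R
      ((2 * (snd z \<bullet> fst z)) *\<^sub>R snd z - (snd z \<bullet> snd z) *\<^sub>R fst z))"
  have nz: "1 + norm x \<noteq> 0" for x :: "real^'n" by (smt (verit) norm_ge_zero)
  show "smooth_on {z \<in> \<S>. fst z \<noteq> 0} ?F"
    by (intro smooth_intros) (auto simp: nz)
  fix z :: "(real^'n) \<times> (real^'n)" assume z: "z \<in> {z \<in> \<S>. fst z \<noteq> 0}"
  obtain x y where xy: "z = (x, y)" by (cases z)
  have n: "norm (x, y) = 1" "x \<noteq> 0" using z xy by auto
  have p: "pi * pi * (x \<bullet> x) = (pi * norm x)\<^sup>2" by (simp add: power2_eq_square dot_square_norm algebra_simps)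
  have "y \<bullet> y = (1 + norm x) * (1 - norm x)"
    using n(1) by (simp add: norm_Pair_eq_1 dot_square_norm power2_eq_square algebra_simps)
  then have u: "pi / (1 + norm x) * (y \<bullet> y) = pi - pi * norm x"
    using nz[of x] by (simp add: right_diff_distrib)
  let ?c = "pi / (1 + norm x) * sincr ((pi - pi * norm x)\<^sup>2) / norm x"
  have "sin (pi * norm x) *\<^sub>R sgn (tau (sgn y) x) = ?c *\<^sub>R ((2 * (y \<bullet> x)) *\<^sub>R y - (y \<bullet> y) *\<^sub>R x)"
  proof (cases "y = 0")
    case True
    then have "norm x = 1" using n by (simp add: norm_Pair)
    then show ?thesis using True by simp
  next
    case False
    have "sin (pi * norm x) = sin (pi - pi * norm x)" by simp
    also have "\<dots> = (pi / (1 + norm x) * (y \<bullet> y)) * sincr ((pi - pi * norm x)\<^sup>2)"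
      unfolding u by (rule sincr_power2[symmetric])
    finally have s: "sin (pi * norm x) / norm x = ?c * (y \<bullet> y)" by simp
    \<comment> \<open>tau is quadratic in its first argument up to the term - x, so the factor |y|^2
      clears both denominators and leaves a polynomial in x and y.\<close>
    have "(y \<bullet> y) *\<^sub>R tau (sgn y) x = (2 * (y \<bullet> x)) *\<^sub>R y - (y \<bullet> y) *\<^sub>R x"
      using False by (simp add: tau_def sgn_div_norm scaleR_diff_right dot_square_norm power2_eq_square field_simps)
    then have "(sin (pi * norm x) / norm x) *\<^sub>R tau (sgn y) x = ?c *\<^sub>R ((2 * (y \<bullet> x)) *\<^sub>R y - (y \<bullet> y) *\<^sub>R x)"
      unfolding s by (metis scaleR_scaleR)
    moreover have "sgn (tau (sgn y) x) = tau (sgn y) x /\<^sub>R norm x"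
      by (simp only: sgn_div_norm[of "tau (sgn y) x"] tau_sgn_norm[OF False])
    ultimately show ?thesis by (simp add: divide_inverse)
  qed
  then show "f_map z = ?F z"
    unfolding xy fst_conv snd_conv p cosr_power2 u f_map_polar[OF n(1)]
    unfolding power2_eq_square[symmetric]
    by (simp add: linear_scale[OF linear_incl, symmetric])
qed

lemma openin_unit_sphere_nonzero:
  "openin (top_of_set \<S>) {z :: (real^'n::finite) \<times> (real^'n). z \<in> \<S> \<and> snd z \<noteq> 0}"
  "openin (top_of_set \<S>) {z :: (real^'n::finite) \<times> (real^'n). z \<in> \<S> \<and> fst z \<noteq> 0}"
proof -
  have "open {z :: (real^'n) \<times> (real^'n). snd z \<noteq> 0}" "open {z :: (real^'n) \<times> (real^'n). fst z \<noteq> 0}"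
    by (intro open_Collect_neq continuous_intros)+
  then show "openin (top_of_set \<S>) {z :: (real^'n::finite) \<times> (real^'n). z \<in> \<S> \<and> snd z \<noteq> 0}"
    "openin (top_of_set \<S>) {z :: (real^'n::finite) \<times> (real^'n). z \<in> \<S> \<and> fst z \<noteq> 0}"
    by (auto simp: openin_open)
qed

lemma smooth_on_f_map: "smooth_on \<S> (f_map :: (real^'n::finite) \<times> (real^'n) \<Rightarrow> _)"
proof (rule smooth_on_local)
  fix z :: "(real^'n) \<times> (real^'n)" assume z: "z \<in> \<S>"
  then have "z \<noteq> 0" by auto
  then have "fst z \<noteq> 0 \<or> snd z \<noteq> 0" by (auto simp: prod_eq_iff)
  then show "\<exists>W. openin (top_of_set \<S>) W \<and> z \<in> W \<and> smooth_on W f_map"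
  proof
    assume "fst z \<noteq> 0"
    then show ?thesis using z openin_unit_sphere_nonzero(2) smooth_on_f_map_left
      by (intro exI[of _ "{z \<in> \<S>. fst z \<noteq> 0}"] conjI) auto
  next
    assume "snd z \<noteq> 0"
    then show ?thesis using z openin_unit_sphere_nonzero(1) smooth_on_f_map_right
      by (intro exI[of _ "{z \<in> \<S>. snd z \<noteq> 0}"] conjI) auto
  qed
qed

section \<open>The quotient of the pullback bundle\<close>

lemma star_action_simp [simp]:
  "star_action g ((x, y), Q) = ((g *v x, g *v y), block_diag g ** Q)"
  by (simp add: star_action_def)

lemma mem_pullback_bundle:
  "((x, y), Q) \<in> pullback_bundle \<longleftrightarrow> norm (x, y) = 1 \<and> orthogonal_matrix Q \<and> f_map (x, y) = Q *v e0"
  by (simp add: pullback_bundle_def orthogonal_group_def column_None)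

lemma orthogonal_groupD [simp]: "g \<in> orthogonal_group \<longleftrightarrow> orthogonal_matrix g"
  by (simp add: orthogonal_group_def)

lemma orthogonal_norm_Pair:
  "orthogonal_matrix g \<Longrightarrow> norm (g *v x, g *v y) = norm (x, y)" for g :: "real^'n::finite^'n"
  by (simp add: norm_Pair)

lemma star_action_mem:
  "orthogonal_matrix g \<Longrightarrow> p \<in> pullback_bundle \<Longrightarrow> star_action g p \<in> pullback_bundle"
  by (cases p; cases "fst p")
    (simp add: mem_pullback_bundle f_map_equivariant orthogonal_norm_Pair orthogonal_matrix_mul
      matrix_vector_mul_assoc)

lemma star_action_mult: "star_action (g ** h) p = star_action g (star_action h p)"
  by (cases p; cases "fst p")
    (simp add: matrix_vector_mul_assoc block_diag_mult matrix_mul_assoc)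

lemma star_action_mat_1: "star_action (mat 1) p = p"
  by (cases p; cases "fst p") simp

lemma free_star_action: "free_action star_action (pullback_bundle :: ('n::finite) pullback_ambient set)"
  unfolding free_action_def
proof (intro conjI ballI impI)
  fix g :: "real^'n^'n" and p :: "'n pullback_ambient"
  assume "g \<in> orthogonal_group" and p: "p \<in> pullback_bundle" and fixed: "star_action g p = p"
  obtain x y Q where pe: "p = ((x, y), Q)" by (metis surj_pair)
  have Q: "Q ** transpose Q = mat 1" "block_diag g ** Q = Q"
    using p fixed by (auto simp: pe mem_pullback_bundle orthogonal_matrixD)
  then have "block_diag g = mat 1" by (metis matrix_mul_assoc matrix_mul_rid)
  then show "g = mat 1" by (metis block_diag_inject block_diag_mat_1)
qed (simp_all add: star_action_mem star_action_mult star_action_mat_1)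

section \<open>Complete invariants of the star action\<close>

type_synonym 'n invariants = "(real^('n option)) \<times> (real^('n option)) \<times> (real^('n option))"

definition star_invariants :: "('n::finite) pullback_ambient \<Rightarrow> 'n invariants" where
  "star_invariants = (\<lambda>((x, y), Q). (transpose Q *v e0, transpose Q *v incl x, transpose Q *v incl y))"

definition invariant_set :: "('n::finite) invariants set" where
  "invariant_set = star_invariants ` pullback_bundle"

lemma star_invariants_simp [simp]:
  "star_invariants ((x, y), Q) = (transpose Q *v e0, transpose Q *v incl x, transpose Q *v incl y)"
  by (simp add: star_invariants_def)

lemma star_invariants_act:
  assumes "orthogonal_matrix g"
  shows "star_invariants (star_action g p) = star_invariants p"
proof -
  obtain x y Q where pe: "p = ((x, y), Q)" by (metis surj_pair)
  have "transpose (block_diag g) *v incl (g *v v) = incl v" for v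
    using orthogonal_matrixD(3)[of "block_diag g" "incl v"] assms by simp
  moreover have "transpose (block_diag g) *v e0 = e0"
    using orthogonal_matrixD(3)[of "block_diag g" e0] assms by simp
  ultimately show ?thesis
    by (simp add: pe matrix_transpose_mul matrix_vector_mul_assoc[symmetric])
qed

text \<open>The matrix R Q^T fixes e0, hence is block diagonal, and its block is the group element
  that moves Q to R. So an orbit can be normalised to any frame R with the same first
  invariant.\<close>

lemma star_action_to_frame:
  fixes x y :: "real^'n::finite"
  assumes "orthogonal_matrix Q" "orthogonal_matrix R" "transpose R *v e0 = transpose Q *v e0"
  obtains g where "orthogonal_matrix g"
    "star_action g ((x, y), Q) =
      ((proj (R *v (transpose Q *v incl x)), proj (R *v (transpose Q *v incl y))), R)"
proof -
  have "orthogonal_matrix (R ** transpose Q)" using assms by (simp add: orthogonal_matrix_mul)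
  moreover have "(R ** transpose Q) *v e0 = e0"
    by (simp add: matrix_vector_mul_assoc[symmetric] assms(3)[symmetric] orthogonal_matrixD[OF assms(2)])
  ultimately obtain g where g: "orthogonal_matrix g" "R ** transpose Q = block_diag g"
    using orthogonal_fixing_e0 by metis
  have "proj (R *v (transpose Q *v incl v)) = g *v v" for v
    by (simp add: matrix_vector_mul_assoc g)
  moreover have "block_diag g ** Q = R"
    by (simp add: g(2)[symmetric] matrix_mul_assoc[symmetric] orthogonal_matrixD[OF assms(1)])
  ultimately show ?thesis using that[OF g(1)] by simp
qed

text \<open>For the converse, p is normalised to the frame R of p'. Its vectors become R Q^T x = R
  R^T x' = x' and likewise for y, so the normalised point is p' itself.\<close>

lemma star_invariants_eq_iff:
  fixes p p' :: "('n::finite) pullback_ambient"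
  assumes "p \<in> pullback_bundle" "p' \<in> pullback_bundle"
  shows "orbit star_action p = orbit star_action p' \<longleftrightarrow> star_invariants p = star_invariants p'"
proof
  assume "orbit star_action p = orbit star_action p'"
  moreover have "p \<in> orbit star_action p"
    unfolding orbit_def by (rule image_eqI[of _ _ "mat 1"])
      (simp_all add: star_action_mat_1 orthogonal_matrix_id)
  ultimately obtain g where "orthogonal_matrix g" "p = star_action g p'" by (auto simp: orbit_def)
  then show "star_invariants p = star_invariants p'" by (simp add: star_invariants_act)
next
  assume eq: "star_invariants p = star_invariants p'"
  obtain x y Q where pe: "p = ((x, y), Q)" by (metis surj_pair)
  obtain x' y' R where pe': "p' = ((x', y'), R)" by (metis surj_pair)
  have QR: "orthogonal_matrix Q" "orthogonal_matrix R"
    using assms by (auto simp: pe pe' mem_pullback_bundle)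
  have t: "transpose R *v e0 = transpose Q *v e0" "transpose Q *v incl x = transpose R *v incl x'"
    "transpose Q *v incl y = transpose R *v incl y'"
    using eq by (auto simp: pe pe')
  obtain g where g': "orthogonal_matrix g" "star_action g ((x, y), Q) =
      ((proj (R *v (transpose Q *v incl x)), proj (R *v (transpose Q *v incl y))), R)"
    by (rule star_action_to_frame[OF QR t(1)])
  have g: "orthogonal_matrix g" "star_action g p = p'"
    using g' unfolding pe pe' t(2,3) by (simp_all only: orthogonal_matrixD[OF QR(2)] proj_incl)
  have gt: "orthogonal_matrix (transpose g)" using g by simp
  have p: "p = star_action (transpose g) p'"
    using g orthogonal_matrixD(1)[OF g(1)] star_action_mat_1 by (metis star_action_mult)
  show "orbit star_action p = orbit star_action p'"
    unfolding orbit_def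
  proof (intro equalityI image_subsetI)
    fix h :: "real^'n^'n" assume "h \<in> orthogonal_group"
    then show "star_action h p \<in> (\<lambda>g. star_action g p') ` orthogonal_group"
      unfolding p star_action_mult[symmetric] using gt by (intro imageI) (simp add: orthogonal_matrix_mul)
  next
    fix h :: "real^'n^'n" assume "h \<in> orthogonal_group"
    then show "star_action h p' \<in> (\<lambda>g. star_action g p) ` orthogonal_group"
      unfolding g(2)[symmetric] star_action_mult[symmetric] using g(1)
      by (intro imageI) (simp add: orthogonal_matrix_mul)
  qed
qed

lemma smooth_on_star_invariants: "smooth_on S star_invariants"
  unfolding star_invariants_def split_beta by (intro smooth_intros)

lemma compact_pullback_bundle: "compact (pullback_bundle :: ('n::finite) pullback_ambient set)"
proof -
  have c: "compact (\<S> \<times> orthogonal_group :: 'n pullback_ambient set)"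
    by (intro compact_Times compact_sphere compact_orthogonal_group)
  have "smooth_on (\<S> \<times> orthogonal_group) (\<lambda>p::'n pullback_ambient. f_map (fst p) - snd p *v e0)"
    by (intro smooth_intros smooth_on_compose[OF _ smooth_on_f_map]) auto
  then have cl: "closedin (top_of_set (\<S> \<times> orthogonal_group))
      ((\<S> \<times> orthogonal_group) \<inter> (\<lambda>p::'n pullback_ambient. f_map (fst p) - snd p *v e0) -` {0})"
    by (intro continuous_closedin_preimage smooth_on_imp_continuous_on) auto
  have eq: "(\<S> \<times> orthogonal_group) \<inter> (\<lambda>p::'n pullback_ambient. f_map (fst p) - snd p *v e0) -` {0}
      = pullback_bundle"
    by (auto simp: pullback_bundle_def column_None orthogonal_group_def)
  show ?thesis using closedin_compact[OF c cl] unfolding eq .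
qed

text \<open>Q^T e0 and Q e0 are the first row and the first column of Q. They share one entry, which
  for a unit vector decides whether it is e0 or - e0; so the domains of the two frames can be read
  off the first invariant.\<close>

lemma invariant_first_component:
  fixes x y :: "real^'n::finite"
  assumes p: "((x, y), Q) \<in> pullback_bundle" and B: "e = e0 \<or> e = - e0"
  shows "transpose Q *v e0 = e \<longleftrightarrow> f_map (x, y) = e" "norm (transpose Q *v e0) = 1"
proof -
  have Q: "orthogonal_matrix Q" "f_map (x, y) = Q *v e0" "norm (x, y) = 1"
    using p by (auto simp: mem_pullback_bundle)
  show n: "norm (transpose Q *v e0) = 1"
    using orthogonal_matrix_norm[of "transpose Q" e0] Q(1) by (simp add: norm_eq_1)
  have "(transpose Q *v e0) $ None = (Q *v e0) $ None"
    using inner_matrix_vector_left[of Q e0 e0] by (simp add: inner_e0)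
  then show "transpose Q *v e0 = e \<longleftrightarrow> f_map (x, y) = e"
    using B unit_eq_e0_iff[OF n] unit_eq_e0_iff[OF norm_f_map[OF Q(3)]] Q(2) by auto
qed

text \<open>Since R is symmetric, its first invariant is again a; the orbit of p therefore contains
  a point whose matrix is R, and the invariants give its coordinates.\<close>

lemma star_section:
  assumes p: "p \<in> pullback_bundle" and a: "star_invariants p = (a, b, c)" and R: "frame_at R a"
  obtains g where "orthogonal_matrix g" "star_action g p = ((proj (R *v b), proj (R *v c)), R)"
proof -
  obtain x y Q where pe: "p = ((x, y), Q)" by (metis surj_pair)
  have Q: "orthogonal_matrix Q" using p by (simp add: pe mem_pullback_bundle)
  have t: "transpose R *v e0 = transpose Q *v e0" "b = transpose Q *v incl x" "c = transpose Q *v incl y"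
    using a frame_atD[OF R] by (auto simp: pe)
  show ?thesis
    using star_action_to_frame[OF Q frame_atD(1)[OF R] t(1)] that unfolding pe t(2,3) by metis
qed

section \<open>Local slices obtained from frames\<close>

definition frame_section ::
  "(real^('n::finite option) \<Rightarrow> real^('n option)^('n option)) \<Rightarrow> 'n invariants \<Rightarrow> 'n pullback_ambient" where
  "frame_section T = (\<lambda>(a, b, c). ((proj (T a *v b), proj (T a *v c)), T a))"

lemma smooth_on_frame_section:
  assumes "smooth_on B T"
  shows "smooth_on {q \<in> invariant_set. fst q \<in> B} (frame_section T)"
proof -
  have "smooth_on {q \<in> invariant_set. fst q \<in> B} (\<lambda>q. T (fst q))"
    by (rule smooth_on_compose[OF _ assms]) (auto intro!: smooth_intros)
  then show ?thesis unfolding frame_section_def split_beta by (intro smooth_intros)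
qed

definition slice_map ::
  "(real^('n::finite option) \<Rightarrow> real^('n option)^('n option)) \<Rightarrow> (real^'n) \<times> (real^'n) \<Rightarrow> 'n invariants" where
  "slice_map T z = star_invariants (z, T (f_map z))"

text \<open>Because \<open>T a\<close> is symmetric, the first invariant on the slice over z is f(z)
  itself, so the image is cut out by a condition on the first component alone. As \<open>T a\<close>
  is an involution, applying it once more to the other two components recovers z.\<close>

lemma slice_embedding:
  fixes T :: "real^('n::finite option) \<Rightarrow> real^('n option)^('n option)"
  assumes T: "\<And>a. a \<in> B \<Longrightarrow> frame_at (T a) a" "smooth_on B T"
    and AB: "\<And>z. z \<in> \<S> \<Longrightarrow> z \<in> A \<longleftrightarrow> f_map z \<in> B" and A: "A \<subseteq> \<S>"
    and B: "openin (top_of_set invariant_set) {q \<in> invariant_set. fst q \<in> B}"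
  shows "slice_map T ` A = {q \<in> invariant_set. fst q \<in> B}"
    "smooth_open_embedding A (slice_map T) invariant_set (\<lambda>q. fst (frame_section T q))"
proof -
  have fr: "frame_at (T (f_map z)) (f_map z)" if "z \<in> A" for z
    using that AB[of z] A T(1)[of "f_map z"] by blast
  have M: "(z, T (f_map z)) \<in> pullback_bundle" if "z \<in> A" for z
  proof -
    obtain x y where "z = (x, y)" by (cases z)
    then show ?thesis
      using frame_atD[OF fr[OF that]] subsetD[OF A that] by (simp add: mem_pullback_bundle)
  qed
  have sl: "slice_map T (x, y) = (f_map (x, y), T (f_map (x, y)) *v incl x, T (f_map (x, y)) *v incl y)"
    if "(x, y) \<in> A" for x y
    using frame_atD[OF fr[OF that]] by (simp add: slice_map_def)
  show im: "slice_map T ` A = {q \<in> invariant_set. fst q \<in> B}"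
  proof (intro equalityI subsetI)
    fix q assume "q \<in> slice_map T ` A"
    then obtain x y where xy: "(x, y) \<in> A" "q = slice_map T (x, y)" by auto
    then show "q \<in> {q \<in> invariant_set. fst q \<in> B}"
      using imageI[OF M[OF xy(1)], of star_invariants, folded invariant_set_def slice_map_def]
        sl[OF xy(1)] AB[of "(x, y)"] subsetD[OF A xy(1)] xy(1) by auto
  next
    fix q assume q: "q \<in> {q \<in> invariant_set. fst q \<in> B}"
    obtain a b c where abc: "q = (a, b, c)" by (metis surj_pair)
    have aB: "a \<in> B" using q abc by simp
    obtain p where p: "p \<in> pullback_bundle" "star_invariants p = (a, b, c)"
      using q abc by (auto simp: invariant_set_def)
    let ?z = "(proj (T a *v b), proj (T a *v c))"
    obtain g where g: "orthogonal_matrix g" "star_action g p = (?z, T a)"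
      using star_section[OF p T(1)[OF aB]] by metis
    then have m: "(?z, T a) \<in> pullback_bundle" "star_invariants (?z, T a) = q"
      using star_action_mem[OF g(1) p(1)] star_invariants_act[OF g(1), of p] p(2) abc by auto
    then have f: "f_map ?z = a" "?z \<in> \<S>"
      using frame_atD(3)[OF T(1)[OF aB]] by (auto simp: mem_pullback_bundle)
    have "q = slice_map T ?z" using m(2) f(1) by (simp add: slice_map_def)
    then show "q \<in> slice_map T ` A" by (rule image_eqI) (simp add: AB[OF f(2)] f(1) aB)
  qed
  show "smooth_open_embedding A (slice_map T) invariant_set (\<lambda>q. fst (frame_section T q))"
    unfolding smooth_open_embedding_def im
  proof (intro conjI ballI)
    have f: "smooth_on A f_map" by (rule smooth_on_subset[OF smooth_on_f_map A])
    have "smooth_on A (\<lambda>z. T (f_map z))"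
      by (rule smooth_on_compose[OF f T(2)]) (use AB A in auto)
    then show "smooth_on A (slice_map T)"
      unfolding slice_map_def
      by (intro smooth_on_compose[OF _ smooth_on_star_invariants[of UNIV]] smooth_intros) auto
    show "smooth_on {q \<in> invariant_set. fst q \<in> B} (\<lambda>q. fst (frame_section T q))"
      by (intro smooth_intros smooth_on_frame_section T(2))
    fix z assume z: "z \<in> A"
    obtain x y where xy: "z = (x, y)" by (cases z)
    show "fst (frame_section T (slice_map T z)) = z"
      using z fr[OF z] by (simp add: xy sl frame_section_def frame_atD(5))
  qed (rule B)
qed

lemma openin_invariant_set_fst:
  "openin (top_of_set invariant_set) {q \<in> invariant_set. fst q \<in> sphere 0 1 - {e}}"
  if "e = e0 \<or> e = - e0" for e :: "real^('n::finite option)"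
proof -
  have eq: "{q \<in> invariant_set. fst q \<in> sphere 0 1 - {e}} = invariant_set \<inter> fst -` (- {e})"
    using invariant_first_component(2)[OF _ that] by (auto simp: invariant_set_def)
  have "open (fst -` (- {e}) :: 'n invariants set)"
    by (intro open_vimage_fst) auto
  then show ?thesis unfolding eq by (rule openin_open_Int)
qed

lemma slice_plus:
  "slice_map frame_plus ` {z \<in> \<S>. snd z \<noteq> 0} = {q \<in> (invariant_set :: ('n::finite) invariants set). fst q \<in> sphere 0 1 - {- e0}}"
  "smooth_open_embedding {z \<in> \<S>. snd z \<noteq> 0} (slice_map frame_plus)
    (invariant_set :: ('n::finite) invariants set) (\<lambda>q. fst (frame_section frame_plus q))"
proof -
  have 1: "z \<in> {z \<in> \<S>. snd z \<noteq> 0} \<longleftrightarrow> f_map z \<in> sphere 0 1 - {- e0}" if "z \<in> \<S>"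
    for z :: "(real^'n) \<times> (real^'n)"
    using that f_map_eq_e0_iff(2)[of "fst z" "snd z"] norm_f_map[of "fst z" "snd z"] by auto
  have 2: "frame_at (frame_plus a) a" if "a \<in> sphere 0 1 - {- e0}" for a :: "real^('n option)"
    using frame_at_plus that by auto
  have 3: "{z :: (real^'n) \<times> (real^'n). z \<in> \<S> \<and> snd z \<noteq> 0} \<subseteq> \<S>" by auto
  have op: "openin (top_of_set invariant_set) {q :: 'n invariants. q \<in> invariant_set \<and> fst q \<in> sphere 0 1 - {- e0}}"
    by (rule openin_invariant_set_fst) simp
  show "slice_map frame_plus ` {z \<in> \<S>. snd z \<noteq> 0} = {q \<in> (invariant_set :: 'n invariants set). fst q \<in> sphere 0 1 - {- e0}}"
    by (rule slice_embedding(1)[OF 2 smooth_on_frame_plus 1 3 op])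
  show "smooth_open_embedding {z \<in> \<S>. snd z \<noteq> 0} (slice_map frame_plus)
      (invariant_set :: 'n invariants set) (\<lambda>q. fst (frame_section frame_plus q))"
    by (rule slice_embedding(2)[OF 2 smooth_on_frame_plus 1 3 op])
qed

lemma slice_minus:
  "slice_map frame_minus ` {z \<in> \<S>. fst z \<noteq> 0} = {q \<in> (invariant_set :: ('n::finite) invariants set). fst q \<in> sphere 0 1 - {e0}}"
  "smooth_open_embedding {z \<in> \<S>. fst z \<noteq> 0} (slice_map frame_minus)
    (invariant_set :: ('n::finite) invariants set) (\<lambda>q. fst (frame_section frame_minus q))"
proof -
  have 1: "z \<in> {z \<in> \<S>. fst z \<noteq> 0} \<longleftrightarrow> f_map z \<in> sphere 0 1 - {e0}" if "z \<in> \<S>"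
    for z :: "(real^'n) \<times> (real^'n)"
    using that f_map_eq_e0_iff(1)[of "fst z" "snd z"] norm_f_map[of "fst z" "snd z"] by auto
  have 2: "frame_at (frame_minus a) a" if "a \<in> sphere 0 1 - {e0}" for a :: "real^('n option)"
    using frame_at_minus that by auto
  have 3: "{z :: (real^'n) \<times> (real^'n). z \<in> \<S> \<and> fst z \<noteq> 0} \<subseteq> \<S>" by auto
  have op: "openin (top_of_set invariant_set) {q :: 'n invariants. q \<in> invariant_set \<and> fst q \<in> sphere 0 1 - {e0}}"
    by (rule openin_invariant_set_fst) simp
  show "slice_map frame_minus ` {z \<in> \<S>. fst z \<noteq> 0} = {q \<in> (invariant_set :: 'n invariants set). fst q \<in> sphere 0 1 - {e0}}"
    by (rule slice_embedding(1)[OF 2 smooth_on_frame_minus 1 3 op])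
  show "smooth_open_embedding {z \<in> \<S>. fst z \<noteq> 0} (slice_map frame_minus)
      (invariant_set :: 'n invariants set) (\<lambda>q. fst (frame_section frame_minus q))"
    by (rule slice_embedding(2)[OF 2 smooth_on_frame_minus 1 3 op])
qed

section \<open>Charts and local sections of the invariant set\<close>

lemma e0_neq: "(e0 :: real^('n::finite option)) \<noteq> - e0"
proof
  assume "(e0 :: real^('n option)) = - e0"
  then have "(e0 :: real^('n option)) $ None = (- (e0 :: real^('n option))) $ None"
    by (rule arg_cong[where f = "\<lambda>v. v $ None"])
  then show False by simp
qed

lemma invariant_set_cover:
  assumes "q \<in> (invariant_set :: ('n::finite) invariants set)"
  shows "q \<in> {q \<in> invariant_set. fst q \<in> sphere 0 1 - {- e0}} \<or> q \<in> {q \<in> invariant_set. fst q \<in> sphere 0 1 - {e0}}"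
proof -
  obtain x y Q where p: "((x, y), Q) \<in> pullback_bundle" "q = star_invariants ((x, y), Q)"
    using assms by (auto simp: invariant_set_def)
  then show ?thesis
    using assms e0_neq invariant_first_component(2)[OF p(1), of e0] by auto
qed

text \<open>The two slices cover the invariant set, and each transports the hemisphere charts of
  S^{2n-1}. The assumption on the cardinality is the dimension count for that sphere.\<close>

lemma invariant_set_chart:
  fixes q :: "('n::finite) invariants"
  assumes "q \<in> invariant_set" "CARD('m::finite) = 2 * CARD('n) - 1"
  shows "\<exists>W \<xi>. openin (top_of_set invariant_set) W \<and> q \<in> W \<and>
    smooth_diffeo_onto_open W (\<xi> :: 'n invariants \<Rightarrow> real^'m)"
proof -
  have dim: "DIM((real^'n) \<times> (real^'n)) = Suc CARD('m)" using assms(2) by simp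
  have *: "\<exists>W \<xi>. openin (top_of_set invariant_set) W \<and> q \<in> W \<and>
      smooth_diffeo_onto_open W (\<xi> :: 'n invariants \<Rightarrow> real^'m)"
    if d: "smooth_open_embedding A d invariant_set e" and A: "openin (top_of_set \<S>) A" and q: "q \<in> d ` A"
    for A and d :: "(real^'n) \<times> (real^'n) \<Rightarrow> 'n invariants" and e
  proof -
    obtain z where z: "z \<in> A" "q = d z" using q by blast
    then have "norm z = 1" using A openin_imp_subset by fastforce
    then obtain W and \<xi> :: "(real^'n) \<times> (real^'n) \<Rightarrow> real^'m" where
      W: "openin (top_of_set \<S>) W" "z \<in> W" "smooth_diffeo_onto_open W \<xi>"
      using sphere_chart[OF _ dim] by metis
    have "openin (top_of_set A) (A \<inter> W)" "openin (top_of_set W) (A \<inter> W)"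
      using A W(1) by (rule openin_Int_subset_trans)+
    then have "openin (top_of_set invariant_set) (d ` (A \<inter> W))" "smooth_diffeo_onto_open (d ` (A \<inter> W)) (\<xi> \<circ> e)"
      using smooth_open_embedding_chart[OF smooth_open_embedding_subset[OF d]
          smooth_diffeo_onto_open_subset[OF W(3)]] by auto
    then show ?thesis using z W(2) by (intro exI[of _ "d ` (A \<inter> W)"] exI[of _ "\<xi> \<circ> e"] conjI) auto
  qed
  show ?thesis
    using invariant_set_cover[OF assms(1)] *[OF slice_plus(2) openin_unit_sphere_nonzero(1)]
      *[OF slice_minus(2) openin_unit_sphere_nonzero(2)]
    unfolding slice_plus(1) slice_minus(1) by blast
qed

lemma invariant_section:
  fixes p :: "('n::finite) pullback_ambient"
  assumes p: "p \<in> pullback_bundle"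
  shows "\<exists>W \<sigma>. openin (top_of_set invariant_set) W \<and> star_invariants p \<in> W \<and> smooth_on W \<sigma> \<and>
    \<sigma> ` W \<subseteq> pullback_bundle \<and> (\<forall>q\<in>W. star_invariants (\<sigma> q) = q) \<and> \<sigma> (star_invariants p) = p"
proof -
  have *: ?thesis if W: "openin (top_of_set invariant_set) {q \<in> invariant_set. fst q \<in> B}"
    and T: "\<And>a. a \<in> B \<Longrightarrow> frame_at (T a) a" "smooth_on B T"
    and pW: "star_invariants p \<in> {q \<in> invariant_set. fst q \<in> B}" for B T
  proof -
    let ?W = "{q \<in> invariant_set. fst q \<in> B}"
    have sec: "\<exists>g. orthogonal_matrix g \<and> frame_section T q = star_action g r"
      if "r \<in> pullback_bundle" "star_invariants r = q" "q \<in> ?W" for q r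
    proof -
      obtain a b c where abc: "q = (a, b, c)" by (metis surj_pair)
      then show ?thesis
        using star_section[OF that(1) that(2)[unfolded abc] T(1)] that(3)
        by (metis (no_types, lifting) frame_section_def fst_conv mem_Collect_eq split_conv)
    qed
    obtain g where g: "orthogonal_matrix g" "frame_section T (star_invariants p) = star_action g p"
      using sec[OF p refl pW] by blast
    \<comment> \<open>\<open>frame_section\<close> meets the orbit of p at a translate of p by g;
      acting with the inverse of g makes the section pass through p without changing the
      invariants.\<close>
    define \<sigma> where "\<sigma> q = star_action (transpose g) (frame_section T q)" for q
    have gt: "orthogonal_matrix (transpose g)" using g by simp
    have s: "\<sigma> q \<in> pullback_bundle \<and> star_invariants (\<sigma> q) = q" if q: "q \<in> ?W" for q
    proof -
      obtain r where r: "r \<in> pullback_bundle" "star_invariants r = q"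
        using q by (auto simp: invariant_set_def)
      then obtain h where h: "orthogonal_matrix h" "frame_section T q = star_action h r"
        using sec q by blast
      show ?thesis
        unfolding \<sigma>_def h(2) using r(2) star_action_mem[OF gt star_action_mem[OF h(1) r(1)]]
        by (simp add: star_invariants_act[OF gt] star_invariants_act[OF h(1)])
    qed
    have "\<sigma> (star_invariants p) = p"
      unfolding \<sigma>_def g(2) star_action_mult[symmetric] orthogonal_matrixD(1)[OF g(1)] by (rule star_action_mat_1)
    moreover have "smooth_on ?W \<sigma>"
    proof -
      have "smooth_on UNIV (star_action (transpose g))"
        unfolding star_action_def split_beta by (intro smooth_intros)
      then show ?thesis
        unfolding \<sigma>_def by (rule smooth_on_compose[OF smooth_on_frame_section[OF T(2)]]) simp
    qed
    ultimately show ?thesis using W pW s by (intro exI[of _ ?W] exI[of _ \<sigma>] conjI) auto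
  qed
  have "star_invariants p \<in> invariant_set" using p by (simp add: invariant_set_def)
  from invariant_set_cover[OF this] show ?thesis
  proof
    assume "star_invariants p \<in> {q \<in> invariant_set. fst q \<in> sphere 0 1 - {- e0}}"
    then show ?thesis
      by (rule *[OF openin_invariant_set_fst _ smooth_on_frame_plus, rotated 2]) (auto simp: frame_at_plus)
  next
    assume "star_invariants p \<in> {q \<in> invariant_set. fst q \<in> sphere 0 1 - {e0}}"
    then show ?thesis
      by (rule *[OF openin_invariant_set_fst _ smooth_on_frame_minus, rotated 2]) (auto simp: frame_at_minus)
  qed
qed

section \<open>The orbit space as the invariant set\<close>

lemma orbit_space_homeomorphic:
  obtains h where "homeomorphic_map (orbit_space star_action (pullback_bundle :: ('n::finite) pullback_ambient set))
      (top_of_set (invariant_set :: 'n invariants set)) h"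
    "\<And>p. p \<in> pullback_bundle \<Longrightarrow> h (orbit star_action p) = star_invariants p"
proof -
  have 1: "compact_space (top_of_set (pullback_bundle :: 'n pullback_ambient set))"
    using compact_pullback_bundle by (intro compact_space_subtopology) simp
  have 2: "Hausdorff_space (top_of_set (invariant_set :: 'n invariants set))"
    by (simp add: Hausdorff_space_subtopology)
  have 3: "continuous_map (top_of_set (pullback_bundle :: 'n pullback_ambient set))
      (top_of_set (invariant_set :: 'n invariants set)) star_invariants"
    using smooth_on_imp_continuous_on[OF smooth_on_star_invariants] by (auto simp: invariant_set_def)
  have 4: "star_invariants ` topspace (top_of_set (pullback_bundle :: 'n pullback_ambient set)) =
      topspace (top_of_set (invariant_set :: 'n invariants set))"
    by (simp add: invariant_set_def)
  have 5: "orbit star_action a = orbit star_action b \<longleftrightarrow> star_invariants a = star_invariants b"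
    if "a \<in> topspace (top_of_set pullback_bundle)" "b \<in> topspace (top_of_set pullback_bundle)"
    for a b :: "'n pullback_ambient"
    using that star_invariants_eq_iff by simp
  obtain h where h: "homeomorphic_map (quotient_topology (top_of_set (pullback_bundle :: 'n pullback_ambient set))
      (orbit star_action)) (top_of_set (invariant_set :: 'n invariants set)) h"
    "\<And>a. a \<in> topspace (top_of_set pullback_bundle) \<Longrightarrow> h (orbit star_action a) = star_invariants a"
    using quotient_topology_homeomorphic[OF 1 2 3 4 5] by blast
  show ?thesis by (rule that[of h]) (use h in \<open>simp_all add: orbit_space_def\<close>)
qed

text \<open>Under h the orbit projection becomes \<open>star_invariants\<close>, which has smooth
  local sections through every point; \<open>smooth_submersion_on_iff\<close> then converts the
  defining condition of \<open>orbit_charts\<close>.\<close>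

lemma orbit_charts_eq_induced_charts:
  fixes h :: "('n::finite) pullback_ambient set \<Rightarrow> 'n invariants"
  assumes h: "homeomorphic_map (orbit_space star_action (pullback_bundle :: 'n pullback_ambient set))
      (top_of_set (invariant_set :: 'n invariants set)) h"
    and hp: "\<And>p. p \<in> pullback_bundle \<Longrightarrow> h (orbit star_action p) = star_invariants p"
    and card: "CARD('m::finite) = 2 * CARD('n) - 1"
  shows "(orbit_charts star_action pullback_bundle :: ('n pullback_ambient set, real^'m) chart set) =
    induced_charts (orbit_space star_action pullback_bundle) h"
proof -
  let ?X = "orbit_space star_action (pullback_bundle :: 'n pullback_ambient set)"
  let ?k = "inv_into (topspace ?X) h"
  have top: "topspace ?X = orbit star_action ` pullback_bundle"
    by (simp add: orbit_space_def topspace_quotient_topology)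
  have "smooth_submersion_on {p \<in> pullback_bundle. orbit star_action p \<in> U} (\<phi> \<circ> orbit star_action) \<longleftrightarrow>
      smooth_diffeo_onto_open (h ` U) (\<phi> \<circ> ?k)"
    if c: "is_chart ?X (U, \<phi>)" for U and \<phi> :: "'n pullback_ambient set \<Rightarrow> real^'m"
  proof -
    have U: "U \<subseteq> topspace ?X" using c openin_subset by (auto simp: is_chart_def)
    have k: "?k (h u) = u" if "u \<in> topspace ?X" for u
      using homeomorphic_map_inv_into_f(1)[OF h that] .
    have mem: "star_invariants p \<in> h ` U \<longleftrightarrow> orbit star_action p \<in> U" if "p \<in> pullback_bundle" for p
    proof -
      have "orbit star_action p \<in> topspace ?X" unfolding top using that by (rule imageI)
      then have kp: "?k (star_invariants p) = orbit star_action p" using k hp[OF that] by metis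
      show ?thesis
      proof
        assume "star_invariants p \<in> h ` U"
        then obtain u where "u \<in> U" "star_invariants p = h u" by blast
        then show "orbit star_action p \<in> U" using kp k[of u] U by auto
      next
        assume "orbit star_action p \<in> U"
        then show "star_invariants p \<in> h ` U" using hp[OF that] by (metis imageI)
      qed
    qed
    have S: "{p \<in> pullback_bundle. orbit star_action p \<in> U} = {p \<in> pullback_bundle. star_invariants p \<in> h ` U}"
      using mem by blast
    have eq: "(\<phi> \<circ> ?k \<circ> star_invariants) p = (\<phi> \<circ> orbit star_action) p" if "p \<in> pullback_bundle" for p
      using k[of "orbit star_action p"] hp[OF that] that top by simp
    \<comment> \<open>The two maps compared below agree on the bundle but may differ outside it; the
      submersion condition depends only on the values there.\<close>
    have sub: "smooth_submersion_on {p \<in> pullback_bundle. orbit star_action p \<in> U} f"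
      if f: "smooth_submersion_on {p \<in> pullback_bundle. orbit star_action p \<in> U} g"
        and fg: "\<And>p. p \<in> pullback_bundle \<Longrightarrow> f p = g p" for f g :: "'n pullback_ambient \<Rightarrow> real^'m"
      unfolding smooth_submersion_on_def
    proof (intro conjI ballI allI)
      let ?S = "{p \<in> pullback_bundle. orbit star_action p \<in> U}"
      show "smooth_on ?S f"
        by (rule smooth_on_cong[OF f[unfolded smooth_submersion_on_def, THEN conjunct1]]) (use fg in auto)
      fix p v assume "p \<in> ?S"
      then obtain \<gamma> and \<epsilon> :: real where g: "\<epsilon> > 0" "smooth_on {-\<epsilon><..<\<epsilon>} \<gamma>" "\<gamma> ` {-\<epsilon><..<\<epsilon>} \<subseteq> ?S"
          "\<gamma> 0 = p" "((g \<circ> \<gamma>) has_vector_derivative v) (at 0)"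
        using f[unfolded smooth_submersion_on_def, THEN conjunct2, rule_format, of p v] by blast
      have "((f \<circ> \<gamma>) has_vector_derivative v) (at 0)"
        by (rule has_vector_derivative_transform_within_open[OF g(5), of "{-\<epsilon><..<\<epsilon>}"])
          (use g(1) fg subsetD[OF g(3) imageI] in auto)
      then show "\<exists>\<gamma> \<epsilon>. \<epsilon> > 0 \<and> smooth_on {-\<epsilon><..<\<epsilon>} \<gamma> \<and> \<gamma> ` {-\<epsilon><..<\<epsilon>} \<subseteq> ?S \<and>
          \<gamma> 0 = p \<and> ((f \<circ> \<gamma>) has_vector_derivative v) (at 0)"
        using g by (intro exI[of _ \<gamma>] exI[of _ \<epsilon>] conjI)
    qed
    have "smooth_submersion_on {p \<in> pullback_bundle. orbit star_action p \<in> U} (\<phi> \<circ> orbit star_action) \<longleftrightarrow>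
      smooth_submersion_on {p \<in> pullback_bundle. orbit star_action p \<in> U} (\<phi> \<circ> ?k \<circ> star_invariants)"
      using eq by (auto elim!: sub)
    also have "\<dots> \<longleftrightarrow> smooth_diffeo_onto_open (h ` U) (\<phi> \<circ> ?k)"
      unfolding S
      by (rule smooth_submersion_on_iff[OF invariant_set_def[symmetric] smooth_on_star_invariants
            invariant_section invariant_set_chart[OF _ card] is_chart_pushforward[OF h c]])
    finally show ?thesis .
  qed
  then have "(U, \<phi>) \<in> orbit_charts star_action pullback_bundle \<longleftrightarrow> (U, \<phi>) \<in> induced_charts ?X h"
    for U and \<phi> :: "'n pullback_ambient set \<Rightarrow> real^'m"
    unfolding orbit_charts_def induced_charts_def mem_Collect_eq split_conv by (rule conj_cong[OF refl])
  then show ?thesis by (intro set_eqI) (simp only: split_paired_all)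
qed

section \<open>Polar coordinates on the sphere\<close>

text \<open>For r = s^2 this is sin(pi s / 4) / s, continued by pi / 4 at s = 0.\<close>

definition quarter_sinc :: "real \<Rightarrow> real" where "quarter_sinc r = pi / 4 * sincr ((pi / 4)\<^sup>2 * r)"
definition quarter_cos :: "real \<Rightarrow> real" where "quarter_cos r = cosr ((pi / 4)\<^sup>2 * r)"

lemma quarter_sinc_power2: "s * quarter_sinc (s\<^sup>2) = sin (pi / 4 * s)"
  using sincr_power2[of "pi / 4 * s"] by (simp only: quarter_sinc_def power_mult_distrib mult_ac)

lemma quarter_cos_power2: "quarter_cos (s\<^sup>2) = cos (pi / 4 * s)"
  using cosr_power2[of "pi / 4 * s"] by (simp only: quarter_cos_def power_mult_distrib)

lemma smooth_on_quarter_sinc [smooth_intros]: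
  "smooth_on S f \<Longrightarrow> (\<And>x. x \<in> S \<Longrightarrow> 0 \<le> f x) \<Longrightarrow> smooth_on S (\<lambda>x. quarter_sinc (f x))"
  unfolding quarter_sinc_def by (intro smooth_intros) auto

lemma smooth_on_quarter_cos [smooth_intros]:
  "smooth_on S f \<Longrightarrow> (\<And>x. x \<in> S \<Longrightarrow> 0 \<le> f x) \<Longrightarrow> smooth_on S (\<lambda>x. quarter_cos (f x))"
  unfolding quarter_cos_def by (intro smooth_intros) auto

text \<open>For unit w this is (sin(pi r / 4) u / r, cos(pi r / 4) w) with r = |u|, written so that
  it is smooth at u = 0.\<close>

definition polar :: "'a::euclidean_space \<Rightarrow> 'a \<Rightarrow> 'a \<times> 'a" where
  "polar u w = (quarter_sinc (u \<bullet> u) *\<^sub>R u, quarter_cos (u \<bullet> u) *\<^sub>R w)"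

text \<open>The factor by which x must be multiplied to become a vector of length (4 / pi)
  arctan(|x| / |y|), that is, to undo the angle pi r / 4. The form with \<open>arctanr\<close>
  avoids a division by |x|.\<close>

definition polar_radius :: "'a::euclidean_space \<Rightarrow> 'a \<Rightarrow> real" where
  "polar_radius x y = 4 / pi * arctanr ((x \<bullet> x) / (y \<bullet> y)) / norm y"

text \<open>For r in [0, 1] the angle lies in [0, pi / 4], where the sine is at most the cosine,
  with equality only at r = 1. This is why each piece covers one half of the sphere and its boundary
  is the locus |x| = |y|.\<close>

lemma quarter_range:
  assumes "0 \<le> s" "s \<le> 1"
  shows "0 \<le> sin (pi / 4 * s)" "0 < cos (pi / 4 * s)"
    "sin (pi / 4 * s) \<le> cos (pi / 4 * s)" "sin (pi / 4 * s) < cos (pi / 4 * s) \<longleftrightarrow> s < 1"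
proof -
  have r: "0 \<le> pi / 4 * s" "pi / 4 * s \<le> pi / 4"
    using assms by (auto intro: mult_left_le)
  have pi: "0 < pi" by simp
  show "0 \<le> sin (pi / 4 * s)" by (rule sin_ge_zero) (use r pi in linarith)+
  show "0 < cos (pi / 4 * s)" by (rule cos_gt_zero_pi) (use r pi in linarith)+
  have c: "cos (pi / 4 * s) = sin (pi / 2 - pi / 4 * s)" by (simp add: sin_cos_eq)
  have "sin (pi / 4 * s) \<le> sin (pi / 2 - pi / 4 * s)"
    by (rule sin_monotone_2pi_le) (use r pi in linarith)+
  then show "sin (pi / 4 * s) \<le> cos (pi / 4 * s)" using c by simp
  show "sin (pi / 4 * s) < cos (pi / 4 * s) \<longleftrightarrow> s < 1"
  proof
    assume "s < 1"
    then have "pi / 4 * s < pi / 4" using pi by simp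
    then have "sin (pi / 4 * s) < sin (pi / 2 - pi / 4 * s)"
      by (intro sin_monotone_2pi) (use r pi in linarith)+
    then show "sin (pi / 4 * s) < cos (pi / 4 * s)" using c by simp
  next
    assume "sin (pi / 4 * s) < cos (pi / 4 * s)"
    moreover have "sin (pi / 4) = cos (pi / 4)" by (simp add: sin_45 cos_45)
    ultimately have "s \<noteq> 1" by auto
    then show "s < 1" using assms by simp
  qed
qed

lemma polar_norms:
  assumes "norm u \<le> 1" "norm w = 1"
  shows "norm (fst (polar u w)) = sin (pi / 4 * norm u)" "norm (snd (polar u w)) = cos (pi / 4 * norm u)"
    "norm (polar u w) = 1" "snd (polar u w) \<noteq> 0" "norm (fst (polar u w)) \<le> norm (snd (polar u w))"
    "norm (fst (polar u w)) < norm (snd (polar u w)) \<longleftrightarrow> norm u < 1"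
proof -
  note q = quarter_range[OF norm_ge_zero assms(1)]
  have "norm (fst (polar u w)) = \<bar>norm u * quarter_sinc ((norm u)\<^sup>2)\<bar>"
    by (simp add: polar_def dot_square_norm abs_mult mult.commute)
  then show 1: "norm (fst (polar u w)) = sin (pi / 4 * norm u)"
    using q(1) by (simp only: quarter_sinc_power2 abs_of_nonneg)
  have "norm (snd (polar u w)) = \<bar>quarter_cos ((norm u)\<^sup>2)\<bar>"
    by (simp add: polar_def dot_square_norm assms(2))
  then show 2: "norm (snd (polar u w)) = cos (pi / 4 * norm u)"
    using q(2) by (simp only: quarter_cos_power2 abs_of_pos)
  have "norm (polar u w) = norm (fst (polar u w), snd (polar u w))" by simp
  also have "\<dots> = 1" unfolding norm_Pair 1 2 by simp
  finally show "norm (polar u w) = 1" .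
  show "snd (polar u w) \<noteq> 0" using 2 q(2) by auto
  show "norm (fst (polar u w)) \<le> norm (snd (polar u w))" unfolding 1 2 by (rule q(3))
  show "norm (fst (polar u w)) < norm (snd (polar u w)) \<longleftrightarrow> norm u < 1" unfolding 1 2 by (rule q(4))
qed

lemma polar_inverse_left:
  assumes "norm u \<le> 1" "norm w = 1"
  shows "polar_radius (fst (polar u w)) (snd (polar u w)) *\<^sub>R fst (polar u w) = u" "sgn (snd (polar u w)) = w"
proof -
  note q = quarter_range[OF norm_ge_zero assms(1)] and n = polar_norms[OF assms]
  let ?t = "pi / 4 * norm u"
  have c: "quarter_cos (u \<bullet> u) = cos ?t" by (simp only: dot_square_norm quarter_cos_power2)
  have "sgn (snd (polar u w)) = sgn (cos ?t) *\<^sub>R sgn w" by (simp add: polar_def c sgn_scaleR)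
  then show "sgn (snd (polar u w)) = w" using q(2) assms(2) by (simp add: sgn_div_norm)
  show "polar_radius (fst (polar u w)) (snd (polar u w)) *\<^sub>R fst (polar u w) = u"
  proof (cases "u = 0")
    case True
    then show ?thesis by (simp add: polar_def)
  next
    case False
    have "?t < pi / 2" "- (pi / 2) < ?t"
      using assms(1) mult_left_mono[of "norm u" 1 "pi / 4"] pi_gt_zero norm_ge_zero[of u]
      by (auto intro: order_less_le_trans[of _ 0] order_le_less_trans[of _ "pi / 4"])
    then have at: "arctan (tan ?t) = ?t" by (intro arctan_tan)
    have pr: "polar_radius (fst (polar u w)) (snd (polar u w)) = 4 / pi * arctanr ((tan ?t)\<^sup>2) / cos ?t"
      unfolding polar_radius_def dot_square_norm n(1,2) by (simp add: tan_def power_divide)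
    have fp: "fst (polar u w) = (sin ?t / norm u) *\<^sub>R u"
    proof -
      have "quarter_sinc (u \<bullet> u) = sin ?t / norm u"
        using quarter_sinc_power2[of "norm u"] False by (simp add: dot_square_norm field_simps)
      then show ?thesis by (simp add: polar_def)
    qed
    have one: "4 / pi * arctanr ((tan ?t)\<^sup>2) / cos ?t * (sin ?t / norm u) = 1"
    proof -
      have "4 / pi * arctanr ((tan ?t)\<^sup>2) / cos ?t * (sin ?t / norm u) =
          4 / pi * (tan ?t * arctanr ((tan ?t)\<^sup>2)) / norm u"
        by (simp add: tan_def)
      also have "\<dots> = 4 / pi * ?t / norm u" unfolding arctanr_power2 at ..
      also have "\<dots> = 1" using False by simp
      finally show ?thesis .
    qed
    have "polar_radius (fst (polar u w)) (snd (polar u w)) *\<^sub>R fst (polar u w) =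
        (4 / pi * arctanr ((tan ?t)\<^sup>2) / cos ?t) *\<^sub>R fst (polar u w)"
      by (simp only: pr)
    also have "\<dots> = u" by (simp only: fp scaleR_scaleR one scaleR_one)
    finally show ?thesis .
  qed
qed

text \<open>On the unit sphere the angle arctan(|x| / |y|) has cosine |y| and sine |x|, so the polar
  map with this angle returns x and y.\<close>

lemma polar_inverse_right:
  assumes "norm (x, y) = 1" "norm x \<le> norm y"
  shows "polar (polar_radius x y *\<^sub>R x) (sgn y) = (x, y)" "norm (polar_radius x y *\<^sub>R x) \<le> 1" "y \<noteq> 0"
proof -
  have xy: "(norm x)\<^sup>2 + (norm y)\<^sup>2 = 1" using assms(1) by (simp add: norm_Pair)
  show y: "y \<noteq> 0"
  proof
    assume "y = 0"
    then have "norm x = 0" using assms(2) by simp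
    then show False using xy \<open>y = 0\<close> by simp
  qed
  then have ny: "norm y > 0" by simp
  define \<rho> where "\<rho> = norm x / norm y"
  have \<rho>: "0 \<le> \<rho>" "\<rho> \<le> 1" using assms(2) ny by (auto simp: \<rho>_def)
  have r: "polar_radius x y * norm x = 4 / pi * arctan \<rho>"
  proof -
    have "polar_radius x y * norm x = 4 / pi * (\<rho> * arctanr (\<rho>\<^sup>2))"
      by (simp add: polar_radius_def dot_square_norm \<rho>_def power_divide)
    then show ?thesis by (simp only: arctanr_power2)
  qed
  have a: "0 \<le> arctan \<rho>" "arctan \<rho> \<le> pi / 4"
    using \<rho> arctan_le_iff[of \<rho> 1] by (auto simp: arctan_one)
  have nu: "norm (polar_radius x y *\<^sub>R x) = 4 / pi * arctan \<rho>"
  proof -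
    have "norm (polar_radius x y *\<^sub>R x) = \<bar>polar_radius x y * norm x\<bar>" by (simp add: abs_mult)
    then show ?thesis unfolding r using a by simp
  qed
  then have nu': "pi / 4 * norm (polar_radius x y *\<^sub>R x) = arctan \<rho>" by simp
  show "norm (polar_radius x y *\<^sub>R x) \<le> 1" unfolding nu using a(2) by (simp add: field_simps)
  have sq: "sqrt (1 + \<rho>\<^sup>2) = 1 / norm y"
  proof -
    have "1 + \<rho>\<^sup>2 = ((norm x)\<^sup>2 + (norm y)\<^sup>2) / (norm y)\<^sup>2"
      using ny by (simp add: \<rho>_def power_divide add_divide_distrib)
    then show ?thesis using xy ny by (simp add: real_sqrt_divide)
  qed
  have co: "cos (arctan \<rho>) = norm y" by (simp add: cos_arctan sq)
  have si: "sin (arctan \<rho>) = norm x" unfolding sin_arctan sq using ny by (simp add: \<rho>_def)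
  let ?u = "polar_radius x y *\<^sub>R x"
  have "quarter_cos (?u \<bullet> ?u) = norm y"
    by (simp only: dot_square_norm quarter_cos_power2 nu' co)
  moreover have "quarter_sinc (?u \<bullet> ?u) *\<^sub>R ?u = x"
  proof (cases "x = 0")
    case False
    have "norm ?u * quarter_sinc (?u \<bullet> ?u) = norm x"
      by (simp only: dot_square_norm quarter_sinc_power2 nu' si)
    then have "(polar_radius x y * quarter_sinc (?u \<bullet> ?u)) * norm x = norm x"
      unfolding nu r[symmetric] by (simp add: mult_ac)
    then have "polar_radius x y * quarter_sinc (?u \<bullet> ?u) = 1" using False by simp
    then show ?thesis by (metis mult.commute scaleR_one scaleR_scaleR)
  qed simp
  ultimately show "polar ?u (sgn y) = (x, y)"
    using y by (simp add: polar_def sgn_div_norm)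
qed

lemma smooth_on_polar [smooth_intros]:
  "smooth_on S f \<Longrightarrow> smooth_on S g \<Longrightarrow> smooth_on S (\<lambda>x. polar (f x) (g x))"
  unfolding polar_def by (intro smooth_intros) auto

text \<open>The strict inequality keeps the argument of \<open>arctanr\<close> inside the disc of
  convergence of its series.\<close>

lemma smooth_on_polar_radius [smooth_intros]:
  assumes "smooth_on S f" "smooth_on S g" "\<And>x. x \<in> S \<Longrightarrow> norm (f x) < norm (g x)"
  shows "smooth_on S (\<lambda>x. polar_radius (f x) (g x))"
proof -
  have "g x \<noteq> 0" "(f x \<bullet> f x) / (g x \<bullet> g x) < 1" if "x \<in> S" for x
  proof -
    show "g x \<noteq> 0" using assms(3)[OF that] by auto
    then show "(f x \<bullet> f x) / (g x \<bullet> g x) < 1"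
      using assms(3)[OF that] by (simp add: dot_square_norm power_strict_mono)
  qed
  then show ?thesis
    unfolding polar_radius_def using assms(1,2) by (intro smooth_intros) auto
qed

section \<open>Embedding the pieces of the Kervaire manifold\<close>

text \<open>The twist by tau(w) cancels the factor tau(y / |y|) in f: on the image of (u, w) the map
  f points in the direction of u.\<close>

definition left_polar :: "(real^'n::finite) \<times> (real^'n) \<Rightarrow> (real^'n) \<times> (real^'n)" where
  "left_polar = (\<lambda>(u, w). polar (tau w u) w)"

definition right_polar :: "(real^'n::finite) \<times> (real^'n) \<Rightarrow> (real^'n) \<times> (real^'n)" where
  "right_polar = (\<lambda>(w, u). prod.swap (polar u w))"

definition left_polar_inv :: "(real^'n::finite) \<times> (real^'n) \<Rightarrow> (real^'n) \<times> (real^'n)" where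
  "left_polar_inv = (\<lambda>(x, y). (tau (sgn y) (polar_radius x y *\<^sub>R x), sgn y))"

definition right_polar_inv :: "(real^'n::finite) \<times> (real^'n) \<Rightarrow> (real^'n) \<times> (real^'n)" where
  "right_polar_inv = (\<lambda>(x, y). (sgn x, polar_radius y x *\<^sub>R y))"

text \<open>\<open>left_polar\<close> in the coordinate t = r - 1, continued past r = 1: for -1 < t
  < 1 the angle runs through (0, pi / 2), so a single formula covers both sides of the common
  boundary.\<close>

definition collar_polar :: "real \<times> (real^'n::finite) \<times> (real^'n) \<Rightarrow> (real^'n) \<times> (real^'n)" where
  "collar_polar = (\<lambda>(t, x, y). (sin (pi / 4 * (1 + t)) *\<^sub>R tau y x, cos (pi / 4 * (1 + t)) *\<^sub>R y))"

definition collar_polar_inv :: "(real^'n::finite) \<times> (real^'n) \<Rightarrow> real \<times> (real^'n) \<times> (real^'n)" where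
  "collar_polar_inv = (\<lambda>(x, y). (4 / pi * arctan (norm x / norm y) - 1, tau (sgn y) (sgn x), sgn y))"

lemma left_polar_mem:
  assumes "p \<in> \<D> \<times> \<S>"
  shows "left_polar p \<in> {z \<in> \<S>. snd z \<noteq> 0}" "norm (fst (left_polar p)) \<le> norm (snd (left_polar p))"
    "norm (fst (left_polar p)) < norm (snd (left_polar p)) \<longleftrightarrow> p \<in> ball 0 1 \<times> \<S>"
    "left_polar_inv (left_polar p) = p"
proof -
  obtain u w where p: "p = (u, w)" "norm (tau w u) \<le> 1" "norm w = 1" "norm (tau w u) = norm u"
    using assms by (cases p) (auto simp: tau_norm)
  note n = polar_norms[OF p(2,3)] and i = polar_inverse_left[OF p(2,3)]
  show "left_polar p \<in> {z \<in> \<S>. snd z \<noteq> 0}" "norm (fst (left_polar p)) \<le> norm (snd (left_polar p))"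
    "norm (fst (left_polar p)) < norm (snd (left_polar p)) \<longleftrightarrow> p \<in> ball 0 1 \<times> \<S>"
    using n p(3,4) by (simp_all add: left_polar_def p(1))
  show "left_polar_inv (left_polar p) = p"
    using i by (simp add: left_polar_inv_def left_polar_def p(1) split_beta tau_tau[OF p(3)] del: tau_scaleR)
qed

lemma right_polar_mem:
  assumes "p \<in> \<S> \<times> \<D>"
  shows "right_polar p \<in> {z \<in> \<S>. fst z \<noteq> 0}" "norm (snd (right_polar p)) \<le> norm (fst (right_polar p))"
    "norm (snd (right_polar p)) < norm (fst (right_polar p)) \<longleftrightarrow> p \<in> \<S> \<times> ball 0 1"
    "right_polar_inv (right_polar p) = p"
proof -
  obtain u w where p: "p = (w, u)" "norm u \<le> 1" "norm w = 1"
    using assms by (cases p) auto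
  note n = polar_norms[OF p(2,3)] and i = polar_inverse_left[OF p(2,3)]
  have sw: "norm (prod.swap z) = norm z" for z :: "(real^'n) \<times> (real^'n)"
    by (cases z) (simp add: norm_Pair add.commute)
  show "right_polar p \<in> {z \<in> \<S>. fst z \<noteq> 0}" "norm (snd (right_polar p)) \<le> norm (fst (right_polar p))"
    "norm (snd (right_polar p)) < norm (fst (right_polar p)) \<longleftrightarrow> p \<in> \<S> \<times> ball 0 1"
    using n p(3) by (simp_all add: right_polar_def p(1) sw)
  show "right_polar_inv (right_polar p) = p"
    using i by (simp add: right_polar_inv_def right_polar_def p(1) split_beta)
qed

lemma left_polar_surj:
  assumes "z \<in> \<S>" "norm (fst z) \<le> norm (snd z)"
  shows "left_polar_inv z \<in> \<D> \<times> \<S>" "left_polar (left_polar_inv z) = z"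
proof -
  obtain x y where z: "z = (x, y)" by (cases z)
  have "norm (x, y) = 1" "norm x \<le> norm y" using assms z by auto
  note r = polar_inverse_right[OF this]
  have n: "norm (sgn y) = 1" using r(3) by (simp add: norm_sgn)
  show "left_polar_inv z \<in> \<D> \<times> \<S>"
    using r(2) n by (simp add: z left_polar_inv_def tau_norm del: tau_scaleR)
  show "left_polar (left_polar_inv z) = z"
    using r(1) by (simp add: z left_polar_inv_def left_polar_def tau_tau[OF n] del: tau_scaleR)
qed

lemma right_polar_surj:
  assumes "z \<in> \<S>" "norm (snd z) \<le> norm (fst z)"
  shows "right_polar_inv z \<in> \<S> \<times> \<D>" "right_polar (right_polar_inv z) = z"
proof -
  obtain x y where z: "z = (x, y)" by (cases z)
  have "norm (y, x) = 1" "norm y \<le> norm x" using assms z by (auto simp: norm_Pair add.commute)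
  note r = polar_inverse_right[OF this]
  have n: "norm (sgn x) = 1" using r(3) by (simp add: norm_sgn)
  show "right_polar_inv z \<in> \<S> \<times> \<D>"
    using r(2) n by (simp add: z right_polar_inv_def)
  show "right_polar (right_polar_inv z) = z"
    using r(1) by (simp add: z right_polar_inv_def right_polar_def)
qed

lemma openin_subset_sphere:
  assumes "open {z :: (real^'n::finite) \<times> (real^'n). P z}" "\<And>z. P z \<Longrightarrow> Q z"
  shows "openin (top_of_set {z \<in> \<S>. Q z}) {z \<in> \<S>. P z}"
proof -
  have eq: "{z \<in> \<S>. P z} = {z \<in> \<S>. Q z} \<inter> {z. P z}" using assms(2) by auto
  show ?thesis unfolding eq by (rule openin_open_Int[OF assms(1)])
qed

text \<open>Only the open disc is used here, which corresponds to |x| < |y|, the region where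
  \<open>arctanr\<close> is known to be smooth. A neighbourhood of the boundary is parametrised by
  the collar instead.\<close>

lemma left_polar_embedding:
  "left_polar ` (ball 0 1 \<times> \<S>) = {z :: (real^'n::finite) \<times> (real^'n). z \<in> \<S> \<and> norm (fst z) < norm (snd z)}"
  "smooth_open_embedding (ball 0 1 \<times> \<S>) left_polar {z \<in> \<S>. snd z \<noteq> 0}
     (left_polar_inv :: (real^'n::finite) \<times> (real^'n) \<Rightarrow> _)"
proof -
  have sub: "p \<in> \<D> \<times> \<S>" if "p \<in> ball 0 1 \<times> \<S>" for p :: "(real^'n) \<times> (real^'n)" using that by auto
  have im: "left_polar ` (ball 0 1 \<times> \<S>) = {z :: (real^'n) \<times> (real^'n). z \<in> \<S> \<and> norm (fst z) < norm (snd z)}"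
  proof (intro equalityI subsetI)
    fix z :: "(real^'n) \<times> (real^'n)" assume "z \<in> left_polar ` (ball 0 1 \<times> \<S>)"
    then obtain p where p: "p \<in> ball 0 1 \<times> \<S>" "z = left_polar p" by blast
    show "z \<in> {z. z \<in> \<S> \<and> norm (fst z) < norm (snd z)}"
      using left_polar_mem(1,3)[OF sub[OF p(1)]] p by simp
  next
    fix z :: "(real^'n) \<times> (real^'n)" assume z: "z \<in> {z. z \<in> \<S> \<and> norm (fst z) < norm (snd z)}"
    then have z': "z \<in> \<S>" "norm (fst z) \<le> norm (snd z)" by auto
    note s = left_polar_surj[OF z']
    have "left_polar_inv z \<in> ball 0 1 \<times> \<S>"
      using left_polar_mem(3)[OF s(1)] z by (simp only: s(2) mem_Collect_eq)
    then have "left_polar (left_polar_inv z) \<in> left_polar ` (ball 0 1 \<times> \<S>)" by (rule imageI)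
    then show "z \<in> left_polar ` (ball 0 1 \<times> \<S>)" by (simp only: s(2))
  qed
  show "left_polar ` (ball 0 1 \<times> \<S>) = {z :: (real^'n) \<times> (real^'n). z \<in> \<S> \<and> norm (fst z) < norm (snd z)}" by (rule im)
  show "smooth_open_embedding (ball 0 1 \<times> \<S>) left_polar {z \<in> \<S>. snd z \<noteq> 0}
     (left_polar_inv :: (real^'n) \<times> (real^'n) \<Rightarrow> _)"
    unfolding smooth_open_embedding_def im
  proof (intro conjI ballI)
    show "smooth_on (ball 0 1 \<times> \<S>) (left_polar :: (real^'n) \<times> (real^'n) \<Rightarrow> _)"
      unfolding left_polar_def split_beta by (intro smooth_intros)
    show "openin (top_of_set {z \<in> \<S>. snd z \<noteq> 0}) {z :: (real^'n) \<times> (real^'n). z \<in> \<S> \<and> norm (fst z) < norm (snd z)}"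
      by (intro openin_subset_sphere open_Collect_less continuous_intros) auto
    show "smooth_on {z \<in> \<S>. norm (fst z) < norm (snd z)} (left_polar_inv :: (real^'n) \<times> (real^'n) \<Rightarrow> _)"
      unfolding left_polar_inv_def split_beta by (intro smooth_intros) auto
    show "left_polar_inv (left_polar s) = s" if "s \<in> ball 0 1 \<times> \<S>" for s :: "(real^'n) \<times> (real^'n)"
      using left_polar_mem(4)[OF sub[OF that]] .
  qed
qed

lemma right_polar_embedding:
  "right_polar ` (\<S> \<times> ball 0 1) = {z :: (real^'n::finite) \<times> (real^'n). z \<in> \<S> \<and> norm (snd z) < norm (fst z)}"
  "smooth_open_embedding (\<S> \<times> ball 0 1) right_polar {z \<in> \<S>. fst z \<noteq> 0}
     (right_polar_inv :: (real^'n::finite) \<times> (real^'n) \<Rightarrow> _)"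
proof -
  have sub: "p \<in> \<S> \<times> \<D>" if "p \<in> \<S> \<times> ball 0 1" for p :: "(real^'n) \<times> (real^'n)" using that by auto
  have im: "right_polar ` (\<S> \<times> ball 0 1) = {z :: (real^'n) \<times> (real^'n). z \<in> \<S> \<and> norm (snd z) < norm (fst z)}"
  proof (intro equalityI subsetI)
    fix z :: "(real^'n) \<times> (real^'n)" assume "z \<in> right_polar ` (\<S> \<times> ball 0 1)"
    then obtain p where p: "p \<in> \<S> \<times> ball 0 1" "z = right_polar p" by blast
    show "z \<in> {z. z \<in> \<S> \<and> norm (snd z) < norm (fst z)}"
      using right_polar_mem(1,3)[OF sub[OF p(1)]] p by simp
  next
    fix z :: "(real^'n) \<times> (real^'n)" assume z: "z \<in> {z. z \<in> \<S> \<and> norm (snd z) < norm (fst z)}"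
    then have z': "z \<in> \<S>" "norm (snd z) \<le> norm (fst z)" by auto
    note s = right_polar_surj[OF z']
    have "right_polar_inv z \<in> \<S> \<times> ball 0 1"
      using right_polar_mem(3)[OF s(1)] z by (simp only: s(2) mem_Collect_eq)
    then have "right_polar (right_polar_inv z) \<in> right_polar ` (\<S> \<times> ball 0 1)" by (rule imageI)
    then show "z \<in> right_polar ` (\<S> \<times> ball 0 1)" by (simp only: s(2))
  qed
  show "right_polar ` (\<S> \<times> ball 0 1) = {z :: (real^'n) \<times> (real^'n). z \<in> \<S> \<and> norm (snd z) < norm (fst z)}" by (rule im)
  show "smooth_open_embedding (\<S> \<times> ball 0 1) right_polar {z \<in> \<S>. fst z \<noteq> 0}
     (right_polar_inv :: (real^'n) \<times> (real^'n) \<Rightarrow> _)"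
    unfolding smooth_open_embedding_def im
  proof (intro conjI ballI)
    show "smooth_on (\<S> \<times> ball 0 1) (right_polar :: (real^'n) \<times> (real^'n) \<Rightarrow> _)"
      unfolding right_polar_def split_beta prod.swap_def by (intro smooth_intros)
    show "openin (top_of_set {z \<in> \<S>. fst z \<noteq> 0}) {z :: (real^'n) \<times> (real^'n). z \<in> \<S> \<and> norm (snd z) < norm (fst z)}"
      by (intro openin_subset_sphere open_Collect_less continuous_intros) auto
    show "smooth_on {z \<in> \<S>. norm (snd z) < norm (fst z)} (right_polar_inv :: (real^'n) \<times> (real^'n) \<Rightarrow> _)"
      unfolding right_polar_inv_def split_beta by (intro smooth_intros) auto
    show "right_polar_inv (right_polar s) = s" if "s \<in> \<S> \<times> ball 0 1" for s :: "(real^'n) \<times> (real^'n)"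
      using right_polar_mem(4)[OF sub[OF that]] .
  qed
qed

lemma collar_angle:
  fixes t :: real
  assumes "t \<in> {-1<..<1}"
  shows "0 < sin (pi / 4 * (1 + t))" "0 < cos (pi / 4 * (1 + t))"
    "arctan (sin (pi / 4 * (1 + t)) / cos (pi / 4 * (1 + t))) = pi / 4 * (1 + t)"
proof -
  have r: "0 < pi / 4 * (1 + t)" "pi / 4 * (1 + t) < pi / 2" 
    using assms mult_strict_left_mono[of "1 + t" 2 "pi / 4"] by auto
  have pi: "0 < pi" by simp
  show "0 < sin (pi / 4 * (1 + t))" by (rule sin_gt_zero) (use r pi in linarith)+
  show "0 < cos (pi / 4 * (1 + t))" by (rule cos_gt_zero_pi) (use r pi in linarith)+
  have "arctan (tan (pi / 4 * (1 + t))) = pi / 4 * (1 + t)" by (rule arctan_tan) (use r pi in linarith)+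
  then show "arctan (sin (pi / 4 * (1 + t)) / cos (pi / 4 * (1 + t))) = pi / 4 * (1 + t)"
    by (simp only: tan_def)
qed

lemma collar_polar_embedding:
  "collar_polar ` ({-1<..<1} \<times> \<S> \<times> \<S>) = {z :: (real^'n::finite) \<times> (real^'n). z \<in> \<S> \<and> fst z \<noteq> 0 \<and> snd z \<noteq> 0}"
  "smooth_open_embedding ({-1<..<1} \<times> \<S> \<times> \<S>) collar_polar {z \<in> \<S>. snd z \<noteq> 0}
     (collar_polar_inv :: (real^'n::finite) \<times> (real^'n) \<Rightarrow> _)"
proof -
  let ?C = "{-1<..<1} \<times> \<S> \<times> \<S> :: (real \<times> (real^'n) \<times> (real^'n)) set"
  have mem: "collar_polar s \<in> {z \<in> \<S>. fst z \<noteq> 0 \<and> snd z \<noteq> 0} \<and> collar_polar_inv (collar_polar s) = s"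
    if s: "s \<in> ?C" for s
  proof -
    obtain t x y where txy: "s = (t, x, y)" "t \<in> {-1<..<1}" "norm x = 1" "norm y = 1"
      using s by (cases s) auto
    note a = collar_angle[OF txy(2)]
    let ?s = "sin (pi / 4 * (1 + t))" and ?c = "cos (pi / 4 * (1 + t))"
    have nt: "norm (tau y x) = 1" using txy(3,4) by (simp add: tau_norm)
    have n: "norm (?s *\<^sub>R tau y x) = ?s" "norm (?c *\<^sub>R y) = ?c"
      using a nt txy(4) by simp_all
    have "norm (?s *\<^sub>R tau y x, ?c *\<^sub>R y) = 1" unfolding norm_Pair n by simp
    moreover have "?s *\<^sub>R tau y x \<noteq> 0" "?c *\<^sub>R y \<noteq> 0" using n a(1,2) by (metis norm_zero less_irrefl)+
    moreover have sg: "sgn (?s *\<^sub>R tau y x) = tau y x" "sgn (?c *\<^sub>R y) = y"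
      using a(1,2) nt txy(4) by (simp_all only: sgn_scaleR sgn_pos scaleR_one) (simp_all add: sgn_div_norm)
    moreover have "collar_polar_inv (?s *\<^sub>R tau y x, ?c *\<^sub>R y) = (t, x, y)"
      unfolding collar_polar_inv_def split_conv n sg a(3) tau_tau[OF txy(4)] by (simp add: add_divide_distrib)
    ultimately show ?thesis by (simp add: txy(1) collar_polar_def)
  qed
  have im: "collar_polar ` ?C = {z \<in> \<S>. fst z \<noteq> 0 \<and> snd z \<noteq> 0}"
  proof (intro equalityI subsetI)
    fix z :: "(real^'n) \<times> (real^'n)" assume "z \<in> collar_polar ` ?C"
    then show "z \<in> {z \<in> \<S>. fst z \<noteq> 0 \<and> snd z \<noteq> 0}" using mem by blast
  next
    fix z :: "(real^'n) \<times> (real^'n)" assume z: "z \<in> {z \<in> \<S>. fst z \<noteq> 0 \<and> snd z \<noteq> 0}"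
    obtain x y where xy: "z = (x, y)" by (cases z)
    have n: "(norm x)\<^sup>2 + (norm y)\<^sup>2 = 1" "x \<noteq> 0" "y \<noteq> 0" using z xy by (auto simp: norm_Pair)
    then have pos: "norm x > 0" "norm y > 0" by auto
    define \<rho> where "\<rho> = norm x / norm y"
    have \<rho>: "\<rho> > 0" using pos by (simp add: \<rho>_def)
    have sq: "sqrt (1 + \<rho>\<^sup>2) = 1 / norm y"
    proof -
      have "1 + \<rho>\<^sup>2 = ((norm x)\<^sup>2 + (norm y)\<^sup>2) / (norm y)\<^sup>2"
        using pos by (simp add: \<rho>_def power_divide add_divide_distrib)
      then show ?thesis using n(1) pos by (simp add: real_sqrt_divide)
    qed
    have co: "cos (arctan \<rho>) = norm y" by (simp add: cos_arctan sq)
    have si: "sin (arctan \<rho>) = norm x" unfolding sin_arctan sq using pos by (simp add: \<rho>_def)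
    have ang: "pi / 4 * (1 + (4 / pi * arctan \<rho> - 1)) = arctan \<rho>" by simp
    have ns: "norm (sgn x) = 1" "norm (sgn y) = 1" using n(2,3) by (simp_all add: norm_sgn)
    have "collar_polar (collar_polar_inv z) = z"
      unfolding xy collar_polar_inv_def collar_polar_def split_conv \<rho>_def[symmetric] ang co si tau_tau[OF ns(2)]
      using n(2,3) by (simp add: sgn_div_norm)
    moreover have "collar_polar_inv z \<in> ?C"
    proof -
      have "0 < arctan \<rho>" "arctan \<rho> < pi / 2" using \<rho> arctan_ubound by auto
      then have "4 / pi * arctan \<rho> - 1 \<in> {-1<..<1}" by (auto simp: field_simps)
      then show ?thesis
        unfolding xy collar_polar_inv_def split_conv \<rho>_def[symmetric]
        using ns by (simp add: tau_norm)
    qed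
    ultimately show "z \<in> collar_polar ` ?C" by (metis imageI)
  qed
  show "collar_polar ` ?C = {z \<in> \<S>. fst z \<noteq> 0 \<and> snd z \<noteq> 0}" by (rule im)
  show "smooth_open_embedding ?C collar_polar {z \<in> \<S>. snd z \<noteq> 0} (collar_polar_inv :: (real^'n) \<times> (real^'n) \<Rightarrow> _)"
    unfolding smooth_open_embedding_def im
  proof (intro conjI ballI)
    \<comment> \<open>Sine and cosine of any angle in terms of the even power series functions,
      whose smoothness has been established.\<close>
    have trig: "cos a = quarter_cos ((4 / pi * a)\<^sup>2)" "sin a = (4 / pi * a) * quarter_sinc ((4 / pi * a)\<^sup>2)" for a
      unfolding quarter_cos_power2 quarter_sinc_power2 by simp_all
    show "smooth_on ?C collar_polar"
      unfolding collar_polar_def split_beta trig power2_eq_square divide_inverse by (intro smooth_intros) auto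
    show "openin (top_of_set {z \<in> \<S>. snd z \<noteq> 0}) {z :: (real^'n) \<times> (real^'n). z \<in> \<S> \<and> fst z \<noteq> 0 \<and> snd z \<noteq> 0}"
      by (intro openin_subset_sphere open_Collect_conj open_Collect_neq continuous_intros) auto
    show "smooth_on {z \<in> \<S>. fst z \<noteq> 0 \<and> snd z \<noteq> 0} (collar_polar_inv :: (real^'n) \<times> (real^'n) \<Rightarrow> _)"
      unfolding collar_polar_inv_def split_beta by (intro smooth_intros) auto
    show "collar_polar_inv (collar_polar s) = s" if "s \<in> ?C" for s using mem[OF that] by blast
  qed
qed

lemma smooth_open_embedding_compose:
  assumes d: "smooth_open_embedding S d A e" and g: "smooth_open_embedding A g N k"
  shows "smooth_open_embedding S (\<lambda>s. g (d s)) N (\<lambda>q. e (k q))"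
proof -
  note d' = smooth_open_embeddingD[OF d]
  have dA: "d ` S \<subseteq> A" using d'(2) openin_imp_subset by blast
  note g' = smooth_open_embeddingD[OF smooth_open_embedding_subset[OF g d'(2)]]
  have im: "(\<lambda>s. g (d s)) ` S = g ` d ` S" by (rule image_image[symmetric])
  show ?thesis
    unfolding smooth_open_embedding_def im
  proof (intro conjI ballI)
    show "smooth_on S (\<lambda>s. g (d s))" by (rule smooth_on_compose[OF d'(1) g'(1)]) (rule imageI)
    show "openin (top_of_set N) (g ` d ` S)" by (rule g'(2))
    show "smooth_on (g ` d ` S) (\<lambda>q. e (k q))"
      by (rule smooth_on_compose[OF g'(3) d'(3)]) (use g'(4) in auto)
    show "e (k (g (d s))) = s" if "s \<in> S" for s using g'(4)[of "d s"] d'(4) that by simp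
  qed
qed

text \<open>In the plane of e0 and x both frames are the same reflection, the one exchanging e0 and
  a. On the orthogonal complement \<open>frame_plus\<close> is -1 and \<open>frame_minus\<close> is
  +1. The discrepancy is +1 on x and -1 on the vectors orthogonal to x, which is tau(x).\<close>

lemma frame_transition:
  fixes x v :: "real^'n::finite"
  assumes a: "a = C *\<^sub>R e0 + S *\<^sub>R incl x" and x: "norm x = 1" and CS: "C\<^sup>2 + S\<^sup>2 = 1" "S \<noteq> 0"
  shows "frame_plus a *v incl v = frame_minus a *v incl (tau x v)"
proof -
  have xx: "x \<bullet> x = 1" using x by (simp add: norm_eq_1)
  \<comment> \<open>This factorisation shows that both denominators are nonzero, and it later
    cancels them in the coefficients of x.\<close>
  have S2: "S * S = (1 + C) * (1 - C)" using CS(1) by (simp add: power2_eq_square algebra_simps)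
  then have nz: "1 + C \<noteq> 0" "1 - C \<noteq> 0" using CS(2) by auto
  have aN: "a $ None = C" "proj a = S *\<^sub>R x"
    by (simp_all add: a linear_add[OF linear_proj] linear_scale[OF linear_proj])
  have xt: "x \<bullet> tau x v = x \<bullet> v" by (simp add: tau_def inner_diff_right xx)
  have pp: "(e0 + a) \<bullet> (e0 + a) = 2 * (1 + C)" "(e0 - a) \<bullet> (e0 - a) = 2 * (1 - C)"
    using S2 by (simp_all add: inner_option aN linear_add[OF linear_proj] linear_diff[OF linear_proj] xx algebra_simps)
  have pv: "(e0 + a) \<bullet> incl v = S * (x \<bullet> v)" "(e0 - a) \<bullet> incl (tau x v) = - (S * (x \<bullet> v))"
    by (simp_all add: inner_option aN linear_add[OF linear_proj] linear_diff[OF linear_proj] xt)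
  define k where "k = x \<bullet> v"
  have c1: "2 * (S * k) / (2 * (1 + C)) = S * k / (1 + C)" "2 * - (S * k) / (2 * (1 - C)) = - (S * k / (1 - C))"
    using nz by (simp_all add: field_simps)
  have p: "frame_plus a *v incl v = (S * k / (1 + C)) *\<^sub>R (e0 + a) - incl v"
    unfolding frame_plus_mult pp pv k_def[symmetric] c1 ..
  have m: "frame_minus a *v incl (tau x v) = incl (tau x v) + (S * k / (1 - C)) *\<^sub>R (e0 - a)"
    unfolding frame_minus_mult pp pv k_def[symmetric] c1 by simp
  show ?thesis
  proof (rule option_vec_eqI)
    show "(frame_plus a *v incl v) $ None = (frame_minus a *v incl (tau x v)) $ None"
      unfolding p m using nz by (simp add: aN)
    have "S * k / (1 + C) * S = k * (S * S) / (1 + C)" "S * k / (1 - C) * S = k * (S * S) / (1 - C)"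
      by (simp_all add: mult_ac)
    then have "S * k / (1 + C) * S = k * (1 - C)" "S * k / (1 - C) * S = k * (1 + C)"
      unfolding S2 using nz by simp_all
    moreover have "proj (frame_plus a *v incl v) = (S * k / (1 + C) * S) *\<^sub>R x - v"
      unfolding p by (simp add: linear_add[OF linear_proj] linear_diff[OF linear_proj] linear_scale[OF linear_proj] aN)
    moreover have "proj (frame_minus a *v incl (tau x v)) = (2 * k) *\<^sub>R x - v - (S * k / (1 - C) * S) *\<^sub>R x"
      unfolding m by (simp add: linear_add[OF linear_proj] linear_diff[OF linear_proj] linear_scale[OF linear_proj] aN tau_def k_def)
    moreover have "(k * (1 - C)) *\<^sub>R x - v = (2 * k) *\<^sub>R x - v - (k * (1 + C)) *\<^sub>R x"
    proof -
      have kC: "k * (1 - C) = 2 * k - k * (1 + C)" by (simp add: algebra_simps)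
      show ?thesis unfolding kC scaleR_left_diff_distrib by simp
    qed
    ultimately show "proj (frame_plus a *v incl v) = proj (frame_minus a *v incl (tau x v))" by simp
  qed
qed

lemma slice_plus_simp:
  fixes x y :: "real^'n::finite"
  assumes "norm (x, y) = 1" "y \<noteq> 0"
  shows "slice_map frame_plus (x, y) =
    (f_map (x, y), frame_plus (f_map (x, y)) *v incl x, frame_plus (f_map (x, y)) *v incl y)"
  using frame_atD[OF frame_at_plus[OF norm_f_map[OF assms(1)]]] f_map_eq_e0_iff(2)[OF assms(1)] assms(2)
  by (simp add: slice_map_def)

lemma slice_minus_simp:
  fixes x y :: "real^'n::finite"
  assumes "norm (x, y) = 1" "x \<noteq> 0"
  shows "slice_map frame_minus (x, y) =
    (f_map (x, y), frame_minus (f_map (x, y)) *v incl x, frame_minus (f_map (x, y)) *v incl y)"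
  using frame_atD[OF frame_at_minus[OF norm_f_map[OF assms(1)]]] f_map_eq_e0_iff(1)[OF assms(1)] assms(2)
  by (simp add: slice_map_def)

lemma norm_incl: "norm (incl v) = norm v"
  by (simp add: norm_eq_sqrt_inner)

lemma slice_plus_norms:
  fixes z :: "(real^'n::finite) \<times> (real^'n)"
  assumes "z \<in> {z \<in> \<S>. snd z \<noteq> 0}"
  shows "norm (fst (snd (slice_map frame_plus z))) = norm (fst z)"
    "norm (snd (snd (slice_map frame_plus z))) = norm (snd z)"
proof -
  obtain x y where z: "z = (x, y)" "norm (x, y) = 1" "y \<noteq> 0" using assms by (cases z) auto
  have "orthogonal_matrix (frame_plus (f_map (x, y)))"
    using frame_atD(1)[OF frame_at_plus[OF norm_f_map[OF z(2)]]] f_map_eq_e0_iff(2)[OF z(2)] z(3) by blast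
  then show "norm (fst (snd (slice_map frame_plus z))) = norm (fst z)"
    "norm (snd (snd (slice_map frame_plus z))) = norm (snd z)"
    by (simp_all add: z(1) slice_plus_simp[OF z(2,3)] norm_incl)
qed

lemma slice_minus_norms:
  fixes z :: "(real^'n::finite) \<times> (real^'n)"
  assumes "z \<in> {z \<in> \<S>. fst z \<noteq> 0}"
  shows "norm (fst (snd (slice_map frame_minus z))) = norm (fst z)"
    "norm (snd (snd (slice_map frame_minus z))) = norm (snd z)"
proof -
  obtain x y where z: "z = (x, y)" "norm (x, y) = 1" "x \<noteq> 0" using assms by (cases z) auto
  have "orthogonal_matrix (frame_minus (f_map (x, y)))"
    using frame_atD(1)[OF frame_at_minus[OF norm_f_map[OF z(2)]]] f_map_eq_e0_iff(1)[OF z(2)] z(3) by blast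
  then show "norm (fst (snd (slice_map frame_minus z))) = norm (fst z)"
    "norm (snd (snd (slice_map frame_minus z))) = norm (snd z)"
    by (simp_all add: z(1) slice_minus_simp[OF z(2,3)] norm_incl)
qed

text \<open>Both points have the same value a under f, of direction x: on the left the twist
  cancels, on the right the conjugation rule for tau applies. Then \<open>frame_transition\<close>
  compares the two frames at a.\<close>

lemma slice_transition:
  fixes x y :: "real^'n::finite"
  assumes x: "norm x = 1" and y: "norm y = 1" and r: "r\<^sup>2 + s\<^sup>2 = 1" "0 < r" "0 < s"
  shows "slice_map frame_plus (r *\<^sub>R tau y x, s *\<^sub>R y) =
    slice_map frame_minus (r *\<^sub>R tau x (tau y x), s *\<^sub>R tau x y)"
proof -
  have n: "norm (tau y x) = 1" "norm (tau x (tau y x)) = 1" "norm (tau x y) = 1"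
    using x y by (simp_all add: tau_norm)
  have 1: "norm (r *\<^sub>R tau y x, s *\<^sub>R y) = 1" "norm (r *\<^sub>R tau x (tau y x), s *\<^sub>R tau x y) = 1"
    using r n x y by (simp_all add: norm_Pair)
  have s1: "sgn (s *\<^sub>R w) = w" if "norm w = 1" for w :: "real^'n"
    using that r by (simp add: sgn_scaleR sgn_div_norm)
  have r1: "sgn (r *\<^sub>R x) = x" using x r by (simp add: sgn_scaleR sgn_div_norm)
  have nr: "norm (r *\<^sub>R w) = r" if "norm w = 1" for w :: "real^'n" using that r by simp
  have t1: "tau y (r *\<^sub>R tau y x) = r *\<^sub>R x" by (simp add: tau_tau[OF y])
  have t2: "tau (tau x y) (r *\<^sub>R tau x (tau y x)) = r *\<^sub>R x"
    by (simp add: tau_tau_conj[OF x] tau_tau[OF x] tau_tau[OF y] x)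
  define a where "a = cos (pi * r) *\<^sub>R e0 + sin (pi * r) *\<^sub>R incl x"
  have f1: "f_map (r *\<^sub>R tau y x, s *\<^sub>R y) = a"
    unfolding f_map_polar[OF 1(1)] s1[OF y] t1 r1 nr[OF n(1)] a_def ..
  have f2: "f_map (r *\<^sub>R tau x (tau y x), s *\<^sub>R tau x y) = a"
    unfolding f_map_polar[OF 1(2)] s1[OF n(3)] t2 r1 nr[OF n(2)] a_def ..
  \<comment> \<open>Since s > 0, the value a is neither pole, so sin(pi r) is nonzero and both
    frames are defined at a.\<close>
  have "r < 1"
  proof -
    have "0 < s\<^sup>2" using r(3) by simp
    then have "r\<^sup>2 < 1" using r(1) by linarith
    then show ?thesis by (simp add: abs_square_less_1)
  qed
  then have "pi * r < pi" "0 < pi * r" using r(2) by simp_all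
  then have "sin (pi * r) \<noteq> 0" using sin_gt_zero by force
  note tr = frame_transition[OF a_def x _ this]
  have "(cos (pi * r))\<^sup>2 + (sin (pi * r))\<^sup>2 = 1" by simp
  note tr = tr[OF this]
  have nz: "s *\<^sub>R y \<noteq> 0" "r *\<^sub>R tau x (tau y x) \<noteq> 0"
    using r(2,3) n(2) y by auto
  show ?thesis
    unfolding slice_plus_simp[OF 1(1) nz(1)] slice_minus_simp[OF 1(2) nz(2)] f1 f2 tr tau_scaleR ..
qed

text \<open>Solving \<open>g_tau\<close> (a, b) = (x, tau(x) y) gives b = tau(x) y and a = tau(b) x,
  which the conjugation rule turns into tau(x) tau(y) x because tau(x) fixes x.\<close>

lemma kervaire_gluing_eq:
  fixes x y :: "real^'n::finite"
  assumes "norm x = 1" "norm y = 1"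
  shows "kervaire_gluing (x, y) = (tau x (tau y x), tau x y)"
proof -
  have inj: "inj_on g_tau (\<S> \<times> \<S> :: ((real^'n) \<times> (real^'n)) set)"
  proof (rule inj_onI, clarify)
    fix a b c d :: "real^'n"
    assume ab: "a \<in> \<S>" "b \<in> \<S>" and cd: "c \<in> \<S>" "d \<in> \<S>" and eq: "g_tau (a, b) = g_tau (c, d)"
    then have "b = d" "tau b a = tau b c" by (auto simp: g_tau_def)
    then have "tau b (tau b a) = tau b (tau b c)" by simp
    then show "a = c \<and> b = d" using ab(2) \<open>b = d\<close> by (simp add: tau_tau)
  qed
  have n: "norm (tau x y) = 1" "norm (tau x (tau y x)) = 1" using assms by (simp_all add: tau_norm)
  have t: "tau (tau x y) (tau x (tau y x)) = x"
    by (simp add: tau_tau_conj[OF assms(1)] tau_tau[OF assms(1)] tau_tau[OF assms(2)] assms)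
  have "g_tau (tau x (tau y x), tau x y) = f_tau (x, y)" by (simp add: g_tau_def f_tau_def t)
  then have "inv_into (\<S> \<times> \<S>) g_tau (f_tau (x, y)) = (tau x (tau y x), tau x y)"
    using inv_into_f_f[OF inj, of "(tau x (tau y x), tau x y)"] n by simp
  then show ?thesis by (simp add: kervaire_gluing_def)
qed

section \<open>The two pieces and the bicollar inside the invariant set\<close>

definition kervaire_invariants :: "bool \<times> (real^'n::finite) \<times> (real^'n) \<Rightarrow> 'n invariants" where
  "kervaire_invariants a =
     (if fst a then slice_map frame_minus (right_polar (snd a)) else slice_map frame_plus (left_polar (snd a)))"

definition collar_invariants :: "real \<times> (real^'n::finite) \<times> (real^'n) \<Rightarrow> 'n invariants" where
  "collar_invariants q = slice_map frame_plus (collar_polar q)"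

lemma left_polar_collar:
  fixes x y :: "real^'n::finite"
  assumes "norm x = 1" "norm y = 1"
  shows "left_polar ((1 + t) *\<^sub>R x, y) = collar_polar (t, x, y)"
proof -
  have "((1 + t) *\<^sub>R tau y x) \<bullet> ((1 + t) *\<^sub>R tau y x) = (1 + t)\<^sup>2"
    using tau_inner[OF assms(2), of x x] assms(1) by (simp add: norm_eq_1 power2_eq_square)
  moreover have "quarter_sinc ((1 + t)\<^sup>2) * (1 + t) = sin (pi / 4 * (1 + t))"
    using quarter_sinc_power2[of "1 + t"] by (simp only: mult.commute)
  ultimately show ?thesis
    unfolding left_polar_def collar_polar_def polar_def split_conv tau_scaleR
    by (simp only: scaleR_scaleR quarter_cos_power2)
qed

text \<open>The angles pi (1 - t) / 4 and pi (1 + t) / 4 add up to pi / 2, so sine and cosine are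
  interchanged; the swap of factors in \<open>right_polar\<close> restores their order. After it, t
  enters exactly as in the first collar.\<close>

lemma right_polar_collar:
  fixes x y :: "real^'n::finite"
  assumes "norm x = 1" "norm y = 1"
  shows "right_polar (x, (1 - t) *\<^sub>R y) = (sin (pi / 4 * (1 + t)) *\<^sub>R x, cos (pi / 4 * (1 + t)) *\<^sub>R y)"
proof -
  have yy: "((1 - t) *\<^sub>R y) \<bullet> ((1 - t) *\<^sub>R y) = (1 - t)\<^sup>2"
    using assms(2) by (simp add: norm_eq_1 power2_eq_square)
  have qs: "quarter_sinc ((1 - t)\<^sup>2) * (1 - t) = sin (pi / 4 * (1 - t))"
    using quarter_sinc_power2[of "1 - t"] by (simp only: mult.commute)
  have "pi / 4 * (1 - t) + pi / 4 * (1 + t) = pi / 4 * 2"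
    by (simp only: distrib_left[symmetric]) simp
  then have "pi / 4 * (1 - t) = pi / 2 - pi / 4 * (1 + t)" by simp
  moreover have "cos (pi / 2 - u) = sin u" "sin (pi / 2 - u) = cos u" for u :: real
    by (simp_all add: cos_diff sin_diff)
  ultimately have "sin (pi / 4 * (1 - t)) = cos (pi / 4 * (1 + t))" "cos (pi / 4 * (1 - t)) = sin (pi / 4 * (1 + t))"
    by (simp_all only:)
  then show ?thesis
    unfolding right_polar_def polar_def split_conv prod.swap_def fst_conv snd_conv
    by (simp only: yy qs scaleR_scaleR quarter_cos_power2)
qed

text \<open>This is \<open>slice_transition\<close> with the sine and cosine of the collar angle as
  radii. Together with \<open>left_piece_collar\<close> it presents both collars as restrictions of
  the single map \<open>collar_invariants\<close>.\<close>

lemma right_piece_collar: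
  fixes x y :: "real^'n::finite"
  assumes "norm x = 1" "norm y = 1" "t \<in> {-1<..<1}" "kervaire_gluing (x, y) = (x', y')"
  shows "kervaire_invariants (True, (x', (1 - t) *\<^sub>R y')) = collar_invariants (t, x, y)"
    "norm x' = 1" "norm y' = 1"
proof -
  have xy': "x' = tau x (tau y x)" "y' = tau x y" using assms(4) kervaire_gluing_eq[OF assms(1,2)] by auto
  show n: "norm x' = 1" "norm y' = 1" using assms(1,2) by (simp_all add: xy' tau_norm)
  show "kervaire_invariants (True, (x', (1 - t) *\<^sub>R y')) = collar_invariants (t, x, y)"
    unfolding kervaire_invariants_def collar_invariants_def fst_conv snd_conv if_True
      right_polar_collar[OF n] collar_polar_def split_conv
    unfolding xy'
    by (rule slice_transition[OF assms(1,2) _ collar_angle(1,2)[OF assms(3)], symmetric]) simp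
qed

lemma left_piece_collar:
  fixes x y :: "real^'n::finite"
  assumes "norm x = 1" "norm y = 1"
  shows "kervaire_invariants (False, ((1 + t) *\<^sub>R x, y)) = collar_invariants (t, x, y)"
  by (simp add: kervaire_invariants_def collar_invariants_def left_polar_collar[OF assms])

section \<open>The Kervaire manifold\<close>

lemma mem_kervaire_pieces:
  "(i, p) \<in> topspace kervaire_pieces \<longleftrightarrow> p \<in> (if i then \<S> \<times> \<D> else \<D> \<times> \<S>)"
  by (simp add: kervaire_pieces_def)

text \<open>The case t = 0 of the two collar formulas.\<close>

lemma kervaire_identified_invariants:
  fixes a b :: "bool \<times> (real^'n::finite) \<times> (real^'n)"
  assumes "kervaire_identified a b"
  shows "kervaire_invariants a = kervaire_invariants b"
proof -
  obtain x y where xy: "norm x = 1" "norm y = 1" "a = (False, (x, y))" "b = (True, kervaire_gluing (x, y))"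
    using assms by (auto simp: kervaire_identified_def)
  obtain x' y' where g: "kervaire_gluing (x, y) = (x', y')" by (cases "kervaire_gluing (x, y)")
  show ?thesis
    using left_piece_collar[OF xy(1,2), of 0] right_piece_collar(1)[OF xy(1,2) _ g, of 0]
    by (simp add: xy(3,4) g)
qed

lemma slice_plus_inj: "inj_on (slice_map frame_plus) {z :: (real^'n::finite) \<times> (real^'n). z \<in> \<S> \<and> snd z \<noteq> 0}"
  using smooth_open_embeddingD(4)[OF slice_plus(2)] by (rule inj_on_inverseI)

lemma slice_minus_inj: "inj_on (slice_map frame_minus) {z :: (real^'n::finite) \<times> (real^'n). z \<in> \<S> \<and> fst z \<noteq> 0}"
  using smooth_open_embeddingD(4)[OF slice_minus(2)] by (rule inj_on_inverseI)

text \<open>The frames preserve norms, so the comparison of |x| with |y| on the sphere survives in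
  the second and third invariants. It tells the two pieces apart, and equality marks the common
  boundary.\<close>

lemma kervaire_invariants_left:
  fixes p :: "(real^'n::finite) \<times> (real^'n)"
  assumes p: "p \<in> \<D> \<times> \<S>"
  shows "kervaire_invariants (False, p) \<in> invariant_set"
    "norm (fst (snd (kervaire_invariants (False, p)))) \<le> norm (snd (snd (kervaire_invariants (False, p))))"
    "norm (fst (snd (kervaire_invariants (False, p)))) < norm (snd (snd (kervaire_invariants (False, p)))) \<longleftrightarrow>
      p \<in> ball 0 1 \<times> \<S>"
proof -
  note m = left_polar_mem[OF p]
  have eq: "kervaire_invariants (False, p) = slice_map frame_plus (left_polar p)"
    by (simp add: kervaire_invariants_def)
  have "slice_map frame_plus (left_polar p) \<in> slice_map frame_plus ` {z \<in> \<S>. snd z \<noteq> 0}"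
    using m(1) by (rule imageI)
  then show "kervaire_invariants (False, p) \<in> invariant_set" unfolding slice_plus(1) eq by blast
  show "norm (fst (snd (kervaire_invariants (False, p)))) \<le> norm (snd (snd (kervaire_invariants (False, p))))"
    "norm (fst (snd (kervaire_invariants (False, p)))) < norm (snd (snd (kervaire_invariants (False, p)))) \<longleftrightarrow>
      p \<in> ball 0 1 \<times> \<S>"
    unfolding eq slice_plus_norms[OF m(1)] by (rule m(2), rule m(3))
qed

lemma kervaire_invariants_right:
  fixes p :: "(real^'n::finite) \<times> (real^'n)"
  assumes p: "p \<in> \<S> \<times> \<D>"
  shows "kervaire_invariants (True, p) \<in> invariant_set"
    "norm (snd (snd (kervaire_invariants (True, p)))) \<le> norm (fst (snd (kervaire_invariants (True, p))))"
    "norm (snd (snd (kervaire_invariants (True, p)))) < norm (fst (snd (kervaire_invariants (True, p)))) \<longleftrightarrow>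
      p \<in> \<S> \<times> ball 0 1"
proof -
  note m = right_polar_mem[OF p]
  have eq: "kervaire_invariants (True, p) = slice_map frame_minus (right_polar p)"
    by (simp add: kervaire_invariants_def)
  have "slice_map frame_minus (right_polar p) \<in> slice_map frame_minus ` {z \<in> \<S>. fst z \<noteq> 0}"
    using m(1) by (rule imageI)
  then show "kervaire_invariants (True, p) \<in> invariant_set" unfolding slice_minus(1) eq by blast
  show "norm (snd (snd (kervaire_invariants (True, p)))) \<le> norm (fst (snd (kervaire_invariants (True, p))))"
    "norm (snd (snd (kervaire_invariants (True, p)))) < norm (fst (snd (kervaire_invariants (True, p)))) \<longleftrightarrow>
      p \<in> \<S> \<times> ball 0 1"
    unfolding eq slice_minus_norms[OF m(1)] by (rule m(2), rule m(3))
qed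

lemma kervaire_invariants_inj_left:
  assumes "p \<in> \<D> \<times> \<S>" "p' \<in> \<D> \<times> \<S>" "kervaire_invariants (False, p) = kervaire_invariants (False, p')"
  shows "p = p'"
proof -
  have "slice_map frame_plus (left_polar p) = slice_map frame_plus (left_polar p')"
    using assms(3) by (simp add: kervaire_invariants_def)
  from inj_onD[OF slice_plus_inj this left_polar_mem(1)[OF assms(1)] left_polar_mem(1)[OF assms(2)]]
  have "left_polar p = left_polar p'" .
  from arg_cong[OF this, of left_polar_inv] show ?thesis
    unfolding left_polar_mem(4)[OF assms(1)] left_polar_mem(4)[OF assms(2)] .
qed

lemma kervaire_invariants_inj_right:
  assumes "p \<in> \<S> \<times> \<D>" "p' \<in> \<S> \<times> \<D>" "kervaire_invariants (True, p) = kervaire_invariants (True, p')"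
  shows "p = p'"
proof -
  have "slice_map frame_minus (right_polar p) = slice_map frame_minus (right_polar p')"
    using assms(3) by (simp add: kervaire_invariants_def)
  from inj_onD[OF slice_minus_inj this right_polar_mem(1)[OF assms(1)] right_polar_mem(1)[OF assms(2)]]
  have "right_polar p = right_polar p'" .
  from arg_cong[OF this, of right_polar_inv] show ?thesis
    unfolding right_polar_mem(4)[OF assms(1)] right_polar_mem(4)[OF assms(2)] .
qed

text \<open>The two pieces give opposite inequalities between the norms, so both are equalities and
  p is a boundary point. The point glued to p has the same invariants as p', and injectivity on the
  second piece identifies them.\<close>

lemma kervaire_identified_iff:
  fixes p p' :: "(real^'n::finite) \<times> (real^'n)"
  assumes p: "p \<in> \<D> \<times> \<S>" and p': "p' \<in> \<S> \<times> \<D>"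
    and eq: "kervaire_invariants (False, p) = kervaire_invariants (True, p')"
  shows "kervaire_identified (False, p) (True, p')"
proof -
  have "\<not> p \<in> ball 0 1 \<times> \<S>"
    using kervaire_invariants_left(3)[OF p] kervaire_invariants_right(2)[OF p'] eq by simp
  then have pS: "p \<in> \<S> \<times> \<S>" using p by (cases p) auto
  then have id: "kervaire_identified (False, p) (True, kervaire_gluing p)"
    by (auto simp: kervaire_identified_def)
  obtain x y where xy: "p = (x, y)" "norm x = 1" "norm y = 1" using pS by (cases p) auto
  have "kervaire_gluing p \<in> \<S> \<times> \<D>"
    using xy by (simp add: kervaire_gluing_eq tau_norm)
  then have "kervaire_gluing p = p'"
    using kervaire_identified_invariants[OF id] eq p' by (intro kervaire_invariants_inj_right) auto
  then show ?thesis using id by simp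
qed

text \<open>Invariance along the generated equivalence reduces to a single identification.
  Conversely, points with equal invariants are equal when they lie in the same piece and are related
  by one identification otherwise.\<close>

lemma kervaire_class_eq_iff:
  fixes a b :: "bool \<times> (real^'n::finite) \<times> (real^'n)"
  assumes a: "a \<in> topspace kervaire_pieces" and b: "b \<in> topspace kervaire_pieces"
  shows "kervaire_class a = kervaire_class b \<longleftrightarrow> kervaire_invariants a = kervaire_invariants b"
proof
  assume "kervaire_class a = kervaire_class b"
  moreover have "b \<in> kervaire_class b" by (simp add: kervaire_class_def)
  ultimately have "b \<in> kervaire_class a" by simp
  then have "equivclp kervaire_identified a b" by (simp add: kervaire_class_def)
  then show "kervaire_invariants a = kervaire_invariants b"
    by (induction rule: equivclp_induct) (auto dest: kervaire_identified_invariants)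
next
  assume eq: "kervaire_invariants a = kervaire_invariants b"
  have "equivclp kervaire_identified a b"
  proof -
    obtain i p where ip: "a = (i, p)" by (cases a)
    obtain j q where jq: "b = (j, q)" by (cases b)
    show ?thesis
    proof (cases i; cases j)
      assume ij: "i" "j"
      then have "p = q" using a b eq kervaire_invariants_inj_right[of p q]
        by (simp add: ip jq mem_kervaire_pieces del: mem_Times_iff)
      then show ?thesis by (simp add: ip jq ij)
    next
      assume ij: "\<not> i" "\<not> j"
      then have "p = q" using a b eq kervaire_invariants_inj_left[of p q]
        by (simp add: ip jq mem_kervaire_pieces del: mem_Times_iff)
      then show ?thesis by (simp add: ip jq ij)
    next
      assume ij: "\<not> i" "j"
      then have "kervaire_identified a b" using a b eq kervaire_identified_iff[of p q]
        by (simp add: ip jq mem_kervaire_pieces del: mem_Times_iff)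
      then show ?thesis by (rule r_into_equivclp)
    next
      assume ij: "i" "\<not> j"
      then have "kervaire_identified b a" using a b eq kervaire_identified_iff[of q p]
        by (simp add: ip jq mem_kervaire_pieces del: mem_Times_iff)
      then show ?thesis by (rule equivclp_sym[OF r_into_equivclp])
    qed
  qed
  then have "equivclp kervaire_identified a c \<longleftrightarrow> equivclp kervaire_identified b c" for c
    using equivclp_sym equivclp_trans by metis
  then show "kervaire_class a = kervaire_class b" by (simp add: kervaire_class_def)
qed

section \<open>Surjectivity onto the invariant set and the Kervaire space\<close>

lemma invariant_components:
  assumes q: "q \<in> (invariant_set :: ('n::finite) invariants set)"
  shows "norm (fst q) = 1" "fst q = - e0 \<longleftrightarrow> snd (snd q) = 0" "fst q = e0 \<longleftrightarrow> fst (snd q) = 0"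
proof -
  obtain x y Q where p: "((x, y), Q) \<in> pullback_bundle" "q = star_invariants ((x, y), Q)"
    using q by (auto simp: invariant_set_def)
  have Q: "orthogonal_matrix (transpose Q)" "norm (x, y) = 1" using p(1) by (auto simp: mem_pullback_bundle)
  have z: "transpose Q *v incl v = 0 \<longleftrightarrow> v = 0" for v
    using orthogonal_matrix_norm[OF Q(1), of "incl v"] norm_incl[of v] by (metis norm_eq_zero)
  show "norm (fst q) = 1" using invariant_first_component(2)[OF p(1), of e0] p(2) by simp
  show "fst q = - e0 \<longleftrightarrow> snd (snd q) = 0"
    using invariant_first_component(1)[OF p(1), of "- e0"] f_map_eq_e0_iff(2)[OF Q(2)] z[of y] p(2) by simp
  show "fst q = e0 \<longleftrightarrow> fst (snd q) = 0"
    using invariant_first_component(1)[OF p(1), of e0] f_map_eq_e0_iff(1)[OF Q(2)] z[of x] p(2) by simp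
qed

lemma slice_images:
  "slice_map frame_plus ` {z \<in> \<S>. snd z \<noteq> 0} = {q \<in> (invariant_set :: ('n::finite) invariants set). snd (snd q) \<noteq> 0}"
  "slice_map frame_minus ` {z \<in> \<S>. fst z \<noteq> 0} = {q \<in> (invariant_set :: ('n::finite) invariants set). fst (snd q) \<noteq> 0}"
proof -
  have *: "fst q \<in> sphere 0 1 - {- e0} \<longleftrightarrow> snd (snd q) \<noteq> 0" "fst q \<in> sphere 0 1 - {e0} \<longleftrightarrow> fst (snd q) \<noteq> 0"
    if "q \<in> invariant_set" for q :: "'n invariants"
    using invariant_components[OF that] by simp_all
  show "slice_map frame_plus ` {z \<in> \<S>. snd z \<noteq> 0} = {q \<in> (invariant_set :: 'n invariants set). snd (snd q) \<noteq> 0}"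
    unfolding slice_plus(1) by (intro Collect_cong conj_cong refl *(1))
  show "slice_map frame_minus ` {z \<in> \<S>. fst z \<noteq> 0} = {q \<in> (invariant_set :: 'n invariants set). fst (snd q) \<noteq> 0}"
    unfolding slice_minus(1) by (intro Collect_cong conj_cong refl *(2))
qed

lemma invariant_second_components:
  assumes q: "q \<in> (invariant_set :: ('n::finite) invariants set)"
  shows "fst (snd q) \<noteq> 0 \<or> snd (snd q) \<noteq> 0"
  using invariant_components(2,3)[OF q] e0_neq by metis

text \<open>The second and third components never vanish together, so the inequality forces the
  third to be nonzero. The point then lies on the plus slice, where the inequality holds for z as
  well.\<close>

lemma invariant_le_image:
  assumes q: "q \<in> (invariant_set :: ('n::finite) invariants set)"
    and le: "norm (fst (snd q)) \<le> norm (snd (snd q))"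
  shows "\<exists>p \<in> \<D> \<times> \<S>. kervaire_invariants (False, p) = q"
proof -
  have "snd (snd q) \<noteq> 0" using invariant_second_components[OF q] le by auto
  then have "q \<in> slice_map frame_plus ` {z \<in> \<S>. snd z \<noteq> 0}" unfolding slice_images(1) using q by simp
  then obtain z where z: "z \<in> {z \<in> \<S>. snd z \<noteq> 0}" "q = slice_map frame_plus z" by blast
  have "z \<in> \<S>" "norm (fst z) \<le> norm (snd z)"
    using z(1) le unfolding z(2) slice_plus_norms[OF z(1)] by simp_all
  note s = left_polar_surj[OF this]
  show ?thesis by (rule bexI[OF _ s(1)]) (simp add: kervaire_invariants_def s(2) z(2))
qed

lemma invariant_ge_image:
  assumes q: "q \<in> (invariant_set :: ('n::finite) invariants set)"
    and le: "norm (snd (snd q)) \<le> norm (fst (snd q))"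
  shows "\<exists>p \<in> \<S> \<times> \<D>. kervaire_invariants (True, p) = q"
proof -
  have "fst (snd q) \<noteq> 0" using invariant_second_components[OF q] le by auto
  then have "q \<in> slice_map frame_minus ` {z \<in> \<S>. fst z \<noteq> 0}" unfolding slice_images(2) using q by simp
  then obtain z where z: "z \<in> {z \<in> \<S>. fst z \<noteq> 0}" "q = slice_map frame_minus z" by blast
  have "z \<in> \<S>" "norm (snd z) \<le> norm (fst z)"
    using z(1) le unfolding z(2) slice_minus_norms[OF z(1)] by simp_all
  note s = right_polar_surj[OF this]
  show ?thesis by (rule bexI[OF _ s(1)]) (simp add: kervaire_invariants_def s(2) z(2))
qed

lemma kervaire_invariants_image:
  "kervaire_invariants ` topspace kervaire_pieces = (invariant_set :: ('n::finite) invariants set)"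
proof (intro equalityI subsetI)
  fix q :: "'n invariants" assume "q \<in> kervaire_invariants ` topspace kervaire_pieces"
  then obtain i p where ip: "q = kervaire_invariants (i, p)" "(i, p) \<in> topspace kervaire_pieces" by auto
  show "q \<in> invariant_set"
  proof (cases i)
    case True
    then have "p \<in> \<S> \<times> \<D>" using ip(2) unfolding mem_kervaire_pieces by simp
    from kervaire_invariants_right(1)[OF this] show ?thesis using ip(1) True by simp
  next
    case False
    then have "p \<in> \<D> \<times> \<S>" using ip(2) unfolding mem_kervaire_pieces by simp
    from kervaire_invariants_left(1)[OF this] show ?thesis using ip(1) False by simp
  qed
next
  fix q :: "'n invariants" assume q: "q \<in> invariant_set"
  show "q \<in> kervaire_invariants ` topspace kervaire_pieces"
  proof (cases "norm (fst (snd q)) \<le> norm (snd (snd q))")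
    case True
    then obtain p where p: "p \<in> \<D> \<times> \<S>" "kervaire_invariants (False, p) = q" using invariant_le_image[OF q] by blast
    have "(False, p) \<in> topspace kervaire_pieces" unfolding mem_kervaire_pieces using p(1) by simp
    from imageI[OF this, of kervaire_invariants] show ?thesis unfolding p(2) .
  next
    case False
    then obtain p where p: "p \<in> \<S> \<times> \<D>" "kervaire_invariants (True, p) = q" using invariant_ge_image[OF q] by auto
    have "(True, p) \<in> topspace kervaire_pieces" unfolding mem_kervaire_pieces using p(1) by simp
    from imageI[OF this, of kervaire_invariants] show ?thesis unfolding p(2) .
  qed
qed

lemma compact_kervaire_pieces: "compact_space (kervaire_pieces :: (bool \<times> (real^'n::finite) \<times> (real^'n)) topology)"
proof -
  let ?X = "\<lambda>i. top_of_set (if i then \<S> \<times> \<D> else \<D> \<times> \<S>) :: ((real^'n) \<times> (real^'n)) topology"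
  have "compactin (kervaire_pieces) (Pair i ` topspace (?X i))" for i
  proof (rule image_compactin)
    have "compact (if i then \<S> \<times> \<D> else \<D> \<times> \<S> :: ((real^'n) \<times> (real^'n)) set)"
      by (cases i) (auto intro!: compact_Times)
    then show "compactin (?X i) (topspace (?X i))"
      by (simp add: compactin_subtopology)
    show "continuous_map (?X i) kervaire_pieces (Pair i)"
      unfolding kervaire_pieces_def by (rule continuous_map_component_injection) simp
  qed
  then have "compactin kervaire_pieces (Pair True ` topspace (?X True) \<union> Pair False ` topspace (?X False))"
    by (intro compactin_Un)
  moreover have "Pair True ` topspace (?X True) \<union> Pair False ` topspace (?X False) = topspace kervaire_pieces"
    by (auto simp: kervaire_pieces_def split: if_splits)
  ultimately show ?thesis by (simp add: compact_space_def)
qed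

lemma continuous_kervaire_invariants:
  "continuous_map kervaire_pieces (top_of_set (invariant_set :: ('n::finite) invariants set)) kervaire_invariants"
  unfolding continuous_map_def
proof (intro conjI allI impI)
  show "kervaire_invariants \<in> topspace kervaire_pieces \<rightarrow> topspace (top_of_set (invariant_set :: 'n invariants set))"
    using kervaire_invariants_image by (auto simp: Pi_iff)
  fix U :: "'n invariants set" assume U: "openin (top_of_set invariant_set) U"
  let ?V = "{a \<in> topspace kervaire_pieces. kervaire_invariants a \<in> U}"
  have l: "continuous_on (\<D> \<times> \<S>) (left_polar :: (real^'n) \<times> (real^'n) \<Rightarrow> _)"
    by (rule smooth_on_imp_continuous_on) (unfold left_polar_def split_beta, intro smooth_intros)
  have r: "continuous_on (\<S> \<times> \<D>) (right_polar :: (real^'n) \<times> (real^'n) \<Rightarrow> _)"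
    by (rule smooth_on_imp_continuous_on) (unfold right_polar_def split_beta prod.swap_def, intro smooth_intros)
  have "continuous_on (\<D> \<times> \<S>) (\<lambda>p. slice_map frame_plus (left_polar p :: (real^'n) \<times> (real^'n)))"
    by (rule continuous_on_compose2[OF smooth_on_imp_continuous_on[OF smooth_open_embeddingD(1)[OF slice_plus(2)]] l])
      (use left_polar_mem(1) in blast)
  then have cl: "continuous_on (\<D> \<times> \<S>) (\<lambda>p. kervaire_invariants (False, p :: (real^'n) \<times> (real^'n)))"
    by (simp add: kervaire_invariants_def)
  have "continuous_on (\<S> \<times> \<D>) (\<lambda>p. slice_map frame_minus (right_polar p :: (real^'n) \<times> (real^'n)))"
    by (rule continuous_on_compose2[OF smooth_on_imp_continuous_on[OF smooth_open_embeddingD(1)[OF slice_minus(2)]] r])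
      (use right_polar_mem(1) in blast)
  then have cr: "continuous_on (\<S> \<times> \<D>) (\<lambda>p. kervaire_invariants (True, p :: (real^'n) \<times> (real^'n)))"
    by (simp add: kervaire_invariants_def)
  have ol: "openin (top_of_set (\<D> \<times> \<S>)) ((\<D> \<times> \<S>) \<inter> (\<lambda>p. kervaire_invariants (False, p)) -` U)"
    by (rule continuous_openin_preimage[OF cl _ U]) (use kervaire_invariants_left(1) in blast)
  have or: "openin (top_of_set (\<S> \<times> \<D>)) ((\<S> \<times> \<D>) \<inter> (\<lambda>p. kervaire_invariants (True, p)) -` U)"
    by (rule continuous_openin_preimage[OF cr _ U]) (use kervaire_invariants_right(1) in blast)
  have sets: "{p. (False, p) \<in> ?V} = (\<D> \<times> \<S>) \<inter> (\<lambda>p. kervaire_invariants (False, p)) -` U"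
    "{p. (True, p) \<in> ?V} = (\<S> \<times> \<D>) \<inter> (\<lambda>p. kervaire_invariants (True, p)) -` U"
    by (auto simp: mem_kervaire_pieces)
  have "openin (top_of_set (if i then \<S> \<times> \<D> else \<D> \<times> \<S>)) {p. (i, p) \<in> ?V}" for i
    using ol or unfolding sets[symmetric] by (cases i) simp_all
  moreover have "?V \<subseteq> Sigma UNIV (topspace \<circ> (\<lambda>i. top_of_set (if i then \<S> \<times> \<D> else \<D> \<times> \<S>)))"
    by (auto simp: mem_kervaire_pieces split: if_splits)
  ultimately show "openin kervaire_pieces ?V"
    unfolding kervaire_pieces_def[of] openin_sum_topology by (simp only: UNIV_I simp_thms ball_UNIV)
qed

lemma kervaire_space_homeomorphic:
  obtains h where "homeomorphic_map (kervaire_space :: (bool \<times> (real^'n::finite) \<times> (real^'n)) set topology)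
      (top_of_set (invariant_set :: 'n invariants set)) h"
    "\<And>a. a \<in> topspace kervaire_pieces \<Longrightarrow> h (kervaire_class a) = kervaire_invariants a"
proof -
  have 1: "Hausdorff_space (top_of_set (invariant_set :: 'n invariants set))"
    by (simp add: Hausdorff_space_subtopology)
  have 2: "kervaire_invariants ` topspace kervaire_pieces = topspace (top_of_set (invariant_set :: 'n invariants set))"
    using kervaire_invariants_image by simp
  show ?thesis
    using quotient_topology_homeomorphic[OF compact_kervaire_pieces 1 continuous_kervaire_invariants 2 kervaire_class_eq_iff]
      that unfolding kervaire_space_def by blast
qed

section \<open>Charts of the Kervaire manifold\<close>

lemma left_piece_embedding:
  "smooth_open_embedding (ball 0 1 \<times> \<S>) (\<lambda>p. kervaire_invariants (False, p))
     (invariant_set :: ('n::finite) invariants set) (\<lambda>q. left_polar_inv (fst (frame_section frame_plus q)))"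
  using smooth_open_embedding_compose[OF left_polar_embedding(2) slice_plus(2)]
  by (simp add: kervaire_invariants_def)

lemma right_piece_embedding:
  "smooth_open_embedding (\<S> \<times> ball 0 1) (\<lambda>p. kervaire_invariants (True, p))
     (invariant_set :: ('n::finite) invariants set) (\<lambda>q. right_polar_inv (fst (frame_section frame_minus q)))"
  using smooth_open_embedding_compose[OF right_polar_embedding(2) slice_minus(2)]
  by (simp add: kervaire_invariants_def)

lemma collar_embedding:
  "smooth_open_embedding ({-1<..<1} \<times> \<S> \<times> \<S>) collar_invariants
     (invariant_set :: ('n::finite) invariants set) (\<lambda>q. collar_polar_inv (fst (frame_section frame_plus q)))"
  using smooth_open_embedding_compose[OF collar_polar_embedding(2) slice_plus(2)]
  unfolding collar_invariants_def[abs_def] .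

text \<open>The open pieces account for the two strict inequalities between the norms, and the
  collar reaches all points where neither component vanishes, in particular the locus of
  equality.\<close>

lemma embeddings_cover:
  assumes q: "q \<in> (invariant_set :: ('n::finite) invariants set)"
  shows "q \<in> (\<lambda>p. kervaire_invariants (False, p)) ` (ball 0 1 \<times> \<S>) \<or>
    q \<in> (\<lambda>p. kervaire_invariants (True, p)) ` (\<S> \<times> ball 0 1) \<or>
    q \<in> collar_invariants ` ({-1<..<1} \<times> \<S> \<times> \<S>)"
proof -
  consider "norm (fst (snd q)) < norm (snd (snd q))" | "norm (snd (snd q)) < norm (fst (snd q))"
    | "norm (fst (snd q)) = norm (snd (snd q))" by linarith
  then show ?thesis
  proof cases
    case 1
    then obtain p where p: "p \<in> \<D> \<times> \<S>" "kervaire_invariants (False, p) = q"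
      using invariant_le_image[OF q] by fastforce
    have "p \<in> ball 0 1 \<times> \<S>" using kervaire_invariants_left(3)[OF p(1)] 1 unfolding p(2) by simp
    from imageI[OF this, of "\<lambda>p. kervaire_invariants (False, p)"] show ?thesis unfolding p(2) by blast
  next
    case 2
    then obtain p where p: "p \<in> \<S> \<times> \<D>" "kervaire_invariants (True, p) = q"
      using invariant_ge_image[OF q] by fastforce
    have "p \<in> \<S> \<times> ball 0 1" using kervaire_invariants_right(3)[OF p(1)] 2 unfolding p(2) by simp
    from imageI[OF this, of "\<lambda>p. kervaire_invariants (True, p)"] show ?thesis unfolding p(2) by blast
  next
    case 3
    then have "snd (snd q) \<noteq> 0" using invariant_second_components[OF q] by auto
    then have "q \<in> slice_map frame_plus ` {z \<in> \<S>. snd z \<noteq> 0}" unfolding slice_images(1) using q by simp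
    then obtain z where z: "z \<in> {z \<in> \<S>. snd z \<noteq> 0}" "q = slice_map frame_plus z" by blast
    then have "norm (fst z) = norm (snd z)" using 3 slice_plus_norms[OF z(1)] by simp
    then have "z \<in> collar_polar ` ({-1<..<1} \<times> \<S> \<times> \<S>)"
      unfolding collar_polar_embedding(1) using z(1) by auto
    then obtain s where s: "s \<in> {-1<..<1} \<times> \<S> \<times> \<S>" "z = collar_polar s" by blast
    have "q = collar_invariants s" unfolding collar_invariants_def z(2) s(2) ..
    then show ?thesis using imageI[OF s(1), of collar_invariants] by simp
  qed
qed

text \<open>The case distinction at t = 0 in the bicollar disappears in the invariants: both halves
  follow the same smooth map. Here the radial collars are seen to fit together.\<close>

lemma kervaire_bicollar_class:
  fixes q :: "real \<times> (real^'n::finite) \<times> (real^'n)"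
  assumes q: "q \<in> {-1<..<1} \<times> \<S> \<times> \<S>"
  shows "\<exists>a\<in>topspace kervaire_pieces. kervaire_bicollar q = kervaire_class a \<and> kervaire_invariants a = collar_invariants q"
proof -
  obtain t x y where txy: "q = (t, x, y)" "t \<in> {-1<..<1}" "norm x = 1" "norm y = 1"
    using q by (cases q) auto
  show ?thesis
  proof (cases "t \<le> 0")
    case True
    have "(False, ((1 + t) *\<^sub>R x, y)) \<in> topspace kervaire_pieces"
      unfolding mem_kervaire_pieces using txy(2-4) True by simp
    moreover have "kervaire_bicollar q = kervaire_class (False, ((1 + t) *\<^sub>R x, y))"
      using True by (simp add: txy(1) kervaire_bicollar_def)
    ultimately show ?thesis
      using left_piece_collar[OF txy(3,4), of t] unfolding txy(1) by blast
  next
    case False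
    obtain x' y' where g: "kervaire_gluing (x, y) = (x', y')" by (cases "kervaire_gluing (x, y)")
    note r = right_piece_collar[OF txy(3,4,2) g]
    have "(True, (x', (1 - t) *\<^sub>R y')) \<in> topspace kervaire_pieces"
      unfolding mem_kervaire_pieces using txy(2) r(2,3) False by simp
    moreover have "kervaire_bicollar q = kervaire_class (True, (x', (1 - t) *\<^sub>R y'))"
      using False by (simp add: txy(1) kervaire_bicollar_def g)
    ultimately show ?thesis using r(1) unfolding txy(1) by blast
  qed
qed

lemma smooth_diffeo_onto_open_cong:
  assumes "\<And>x. x \<in> S \<Longrightarrow> f x = g x"
  shows "smooth_diffeo_onto_open S f \<longleftrightarrow> smooth_diffeo_onto_open S g"
proof -
  have "smooth_diffeo_onto_open S g"
    if f: "smooth_diffeo_onto_open S f" and fg: "\<And>x. x \<in> S \<Longrightarrow> f x = g x"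
    for f g :: "'a \<Rightarrow> 'b"
  proof -
    note f' = smooth_diffeo_onto_openD[OF f]
    have im: "g ` S = f ` S" by (rule image_cong[OF refl fg[symmetric]])
    show ?thesis
    proof (rule smooth_diffeo_onto_openI[where g = "inv_into S f"])
      show "smooth_on S g" by (rule smooth_on_cong[OF f'(1)]) (rule fg[symmetric])
      show "open (g ` S)" "smooth_on (g ` S) (inv_into S f)" unfolding im by (rule f'(3), rule f'(4))
      show "inv_into S f (g x) = x" if "x \<in> S" for x
        unfolding fg[OF that, symmetric] by (rule inv_into_f_f[OF f'(2) that])
    qed
  qed
  from this[of f g] this[of g f] show ?thesis using assms by auto
qed

lemma smooth_diffeo_embedding_cong:
  assumes "\<And>s. s \<in> S \<Longrightarrow> (d s \<in> V) = (c s \<in> U) \<and> \<psi> (d s) = \<phi> (c s)"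
  shows "smooth_diffeo_onto_open {s \<in> S. c s \<in> U} (\<lambda>s. \<phi> (c s)) \<longleftrightarrow>
    smooth_diffeo_onto_open {s \<in> S. d s \<in> V} (\<lambda>s. \<psi> (d s))"
proof -
  have S: "{s \<in> S. c s \<in> U} = {s \<in> S. d s \<in> V}" using assms by blast
  show ?thesis unfolding S by (rule smooth_diffeo_onto_open_cong) (use assms in simp)
qed

text \<open>The three parametrisations of the pieces and the bicollar are open embeddings into the
  invariant set and cover it. So a chart satisfies the three conditions exactly when it is a
  diffeomorphism near every point.\<close>

lemma kervaire_charts_eq_induced_charts:
  fixes h :: "(bool \<times> (real^'n::finite) \<times> (real^'n)) set \<Rightarrow> 'n invariants"
  assumes h: "homeomorphic_map kervaire_space (top_of_set (invariant_set :: 'n invariants set)) h"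
    and hp: "\<And>a. a \<in> topspace kervaire_pieces \<Longrightarrow> h (kervaire_class a) = kervaire_invariants a"
  shows "(kervaire_charts :: (_, 'e::euclidean_space) chart set) = induced_charts kervaire_space h"
proof -
  let ?X = "kervaire_space :: (bool \<times> (real^'n) \<times> (real^'n)) set topology"
  let ?k = "inv_into (topspace ?X) h"
  have top: "topspace ?X = kervaire_class ` topspace kervaire_pieces"
    by (simp add: kervaire_space_def topspace_quotient_topology)
  \<comment> \<open>The dictionary between a class c and its image u under h, stated for an
    arbitrary representative a because the representative of a bicollar point depends on the sign of
    t.\<close>
  have cls: "(u \<in> h ` U) = (c \<in> U) \<and> ?k u = c"
    if "U \<subseteq> topspace ?X" "a \<in> topspace kervaire_pieces" "c = kervaire_class a" "kervaire_invariants a = u" for U a c u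
  proof -
    have c: "c \<in> topspace ?X" unfolding top that(3) using that(2) by (rule imageI)
    have u: "u = h c" using hp[OF that(2)] that(3,4) by simp
    have k: "?k u = c" unfolding u by (rule homeomorphic_map_inv_into_f(1)[OF h c])
    have "c \<in> U" if "u \<in> h ` U"
    proof -
      obtain d where d: "d \<in> U" "u = h d" using \<open>u \<in> h ` U\<close> by blast
      then have "?k u = d" using homeomorphic_map_inv_into_f(1)[OF h] \<open>U \<subseteq> topspace ?X\<close> by blast
      then show ?thesis using k d(1) by simp
    qed
    moreover have "u \<in> h ` U" if "c \<in> U" unfolding u using that by (rule imageI)
    ultimately show ?thesis using k by blast
  qed
  have key: "smooth_diffeo_onto_open {p \<in> ball 0 1 \<times> \<S>. kervaire_class (False, p) \<in> U} (\<lambda>p. \<phi> (kervaire_class (False, p))) \<and>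
      smooth_diffeo_onto_open {p \<in> \<S> \<times> ball 0 1. kervaire_class (True, p) \<in> U} (\<lambda>p. \<phi> (kervaire_class (True, p))) \<and>
      smooth_diffeo_onto_open {q \<in> {-1<..<1} \<times> \<S> \<times> \<S>. kervaire_bicollar q \<in> U} (\<lambda>q. \<phi> (kervaire_bicollar q)) \<longleftrightarrow>
      smooth_diffeo_onto_open (h ` U) (\<phi> \<circ> ?k)"
    (is "?left \<and> ?right \<and> ?collar \<longleftrightarrow> ?D")
    if c: "is_chart ?X (U, \<phi>)" for U and \<phi> :: "_ \<Rightarrow> 'e"
  proof -
    have U: "U \<subseteq> topspace ?X" using c openin_subset by (auto simp: is_chart_def)
    have c': "is_chart (top_of_set invariant_set) (h ` U, \<phi> \<circ> ?k)" by (rule is_chart_pushforward[OF h c])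
    have L: "?left \<longleftrightarrow> smooth_diffeo_onto_open {p \<in> ball 0 1 \<times> \<S>. kervaire_invariants (False, p) \<in> h ` U}
        (\<lambda>p. (\<phi> \<circ> ?k) (kervaire_invariants (False, p)))"
    proof (rule smooth_diffeo_embedding_cong)
      fix p :: "(real^'n) \<times> (real^'n)" assume "p \<in> ball 0 1 \<times> \<S>"
      then have "(False, p) \<in> topspace kervaire_pieces" unfolding mem_kervaire_pieces by auto
      from cls[OF U this refl refl] show "(kervaire_invariants (False, p) \<in> h ` U) = (kervaire_class (False, p) \<in> U) \<and>
        (\<phi> \<circ> ?k) (kervaire_invariants (False, p)) = \<phi> (kervaire_class (False, p))" by simp
    qed
    have R: "?right \<longleftrightarrow> smooth_diffeo_onto_open {p \<in> \<S> \<times> ball 0 1. kervaire_invariants (True, p) \<in> h ` U}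
        (\<lambda>p. (\<phi> \<circ> ?k) (kervaire_invariants (True, p)))"
    proof (rule smooth_diffeo_embedding_cong)
      fix p :: "(real^'n) \<times> (real^'n)" assume "p \<in> \<S> \<times> ball 0 1"
      then have "(True, p) \<in> topspace kervaire_pieces" unfolding mem_kervaire_pieces by auto
      from cls[OF U this refl refl] show "(kervaire_invariants (True, p) \<in> h ` U) = (kervaire_class (True, p) \<in> U) \<and>
        (\<phi> \<circ> ?k) (kervaire_invariants (True, p)) = \<phi> (kervaire_class (True, p))" by simp
    qed
    have B: "?collar \<longleftrightarrow> smooth_diffeo_onto_open {q \<in> {-1<..<1} \<times> \<S> \<times> \<S>. collar_invariants q \<in> h ` U}
        (\<lambda>q. (\<phi> \<circ> ?k) (collar_invariants q))"
    proof (rule smooth_diffeo_embedding_cong)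
      fix q :: "real \<times> (real^'n) \<times> (real^'n)" assume "q \<in> {-1<..<1} \<times> \<S> \<times> \<S>"
      then obtain a where a: "a \<in> topspace kervaire_pieces" "kervaire_bicollar q = kervaire_class a"
          "kervaire_invariants a = collar_invariants q"
        using kervaire_bicollar_class by blast
      from cls[OF U a] show "(collar_invariants q \<in> h ` U) = (kervaire_bicollar q \<in> U) \<and>
        (\<phi> \<circ> ?k) (collar_invariants q) = \<phi> (kervaire_bicollar q)" by simp
    qed
    show ?thesis
    proof
      assume ?D
      then show "?left \<and> ?right \<and> ?collar"
        unfolding L R B using smooth_diffeo_compose_embedding[OF c' left_piece_embedding]
          smooth_diffeo_compose_embedding[OF c' right_piece_embedding]
          smooth_diffeo_compose_embedding[OF c' collar_embedding] by blast
    next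
      assume A: "?left \<and> ?right \<and> ?collar"
      note A' = A[THEN conjunct1, unfolded L] A[THEN conjunct2, THEN conjunct1, unfolded R]
        A[THEN conjunct2, THEN conjunct2, unfolded B]
      show ?D
      proof (rule smooth_diffeo_onto_open_local[OF c'])
        fix q assume "q \<in> h ` U"
        then have "q \<in> invariant_set" using is_chart_top_of_setD(2)[OF c'] by blast
        from embeddings_cover[OF this]
        show "\<exists>T. openin (top_of_set invariant_set) T \<and> q \<in> T \<and> smooth_diffeo_onto_open (h ` U \<inter> T) (\<phi> \<circ> ?k)"
        proof (elim disjE)
          assume "q \<in> (\<lambda>p. kervaire_invariants (False, p)) ` (ball 0 1 \<times> \<S>)"
          with smooth_open_embeddingD(2)[OF left_piece_embedding]
            smooth_diffeo_of_embedding[OF left_piece_embedding A'(1)]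
          show ?thesis by (intro exI conjI)
        next
          assume "q \<in> (\<lambda>p. kervaire_invariants (True, p)) ` (\<S> \<times> ball 0 1)"
          with smooth_open_embeddingD(2)[OF right_piece_embedding]
            smooth_diffeo_of_embedding[OF right_piece_embedding A'(2)]
          show ?thesis by (intro exI conjI)
        next
          assume "q \<in> collar_invariants ` ({-1<..<1} \<times> \<S> \<times> \<S>)"
          with smooth_open_embeddingD(2)[OF collar_embedding]
            smooth_diffeo_of_embedding[OF collar_embedding A'(3)]
          show ?thesis by (intro exI conjI)
        qed
      qed
    qed
  qed
  have "(U, \<phi>) \<in> kervaire_charts \<longleftrightarrow> (U, \<phi>) \<in> induced_charts ?X h" for U and \<phi> :: "_ \<Rightarrow> 'e"
    unfolding kervaire_charts_def induced_charts_def mem_Collect_eq split_conv by (rule conj_cong[OF refl key])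
  then show ?thesis by (intro set_eqI) (simp only: split_paired_all)
qed

theorem mainTheorem2:
  assumes "CARD('n::finite) \<ge> 2"
    and "CARD('m::finite) = 2 * CARD('n) - 1"
  shows "free_action star_action
           (pullback_bundle :: 'n pullback_ambient set) \<and>
         smooth_manifold
           (orbit_space star_action
             (pullback_bundle :: 'n pullback_ambient set))
           (orbit_charts star_action pullback_bundle :: (_, real^'m) chart set) \<and>
         smooth_manifold
           (kervaire_space :: (bool \<times> (real^'n) \<times> (real^'n)) set topology)
           (kervaire_charts :: (_, real^'m) chart set) \<and>
         diffeomorphic
           (orbit_space star_action
             (pullback_bundle :: 'n pullback_ambient set))
           (orbit_charts star_action pullback_bundle :: (_, real^'m) chart set)
           (kervaire_space :: (bool \<times> (real^'n) \<times> (real^'n)) set topology)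
           (kervaire_charts :: (_, real^'m) chart set)"
proof -
  obtain h where h: "homeomorphic_map (orbit_space star_action (pullback_bundle :: 'n pullback_ambient set))
      (top_of_set (invariant_set :: 'n invariants set)) h"
    "\<And>p. p \<in> pullback_bundle \<Longrightarrow> h (orbit star_action p) = star_invariants p"
    using orbit_space_homeomorphic by blast
  obtain k where k: "homeomorphic_map (kervaire_space :: (bool \<times> (real^'n) \<times> (real^'n)) set topology)
      (top_of_set (invariant_set :: 'n invariants set)) k"
    "\<And>a. a \<in> topspace kervaire_pieces \<Longrightarrow> k (kervaire_class a) = kervaire_invariants a"
    using kervaire_space_homeomorphic by blast
  have ch: "\<exists>W \<xi>. openin (top_of_set invariant_set) W \<and> q \<in> W \<and>
      smooth_diffeo_onto_open W (\<xi> :: 'n invariants \<Rightarrow> real^'m)" if "q \<in> invariant_set" for q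
    by (rule invariant_set_chart[OF that assms(2)])
  have eX: "(orbit_charts star_action pullback_bundle :: ('n pullback_ambient set, real^'m) chart set) =
      induced_charts (orbit_space star_action pullback_bundle) h"
    by (rule orbit_charts_eq_induced_charts[OF h assms(2)])
  have eY: "(kervaire_charts :: ((bool \<times> (real^'n) \<times> (real^'n)) set, real^'m) chart set) =
      induced_charts kervaire_space k"
    by (rule kervaire_charts_eq_induced_charts[OF k])
  \<comment> \<open>Both structures are now induced from the same set of invariants; the
    diffeomorphism is h followed by the inverse of k.\<close>
  show ?thesis
    unfolding eX eY
    by (intro conjI free_star_action smooth_manifold_induced_charts[OF h(1) ch]
        smooth_manifold_induced_charts[OF k(1) ch] diffeomorphic_induced_charts[OF h(1) k(1)])
qed

end
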